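(* Let $k$ be an infinite field of characteristic not $2$, let $l/k$ be a normal and separable extension field, and let $$i\colon \mathrm{Gal}(l/k) \hookrightarrow U_{\mathrm{l}} \subset G_{\max} \cong W(E_6) \subset S_{27}$$ be an injective group homomorphism. Then there exists a nonsingular cubic surface $S$ over $k$ such that (i) the $27$ lines on $S$ are defined over $l$ and each $\sigma \in \mathrm{Gal}(l/k)$ permutes them as described by $i(\sigma) \in U_{\mathrm{l}} \subset S_{27}$; (ii) $S$ is $k$-unirational.
   Context: A nonsingular cubic surface over an algebraically closed (or separably closed) field contains exactly $27$ lines. The maximal group of permutations of the $27$ lines respecting the intersection pairing is, up to permutation isomorphism, a fixed subgroup $G_{\max} \subset S_{27}$, isomorphic to the Weyl group $W(E_6)$ of order $51840$. The subgroup $U_{\mathrm{l}} \subset G_{\max}$ is the stabiliser of a line; it has index $27$. That $\sigma$ permutes the lines as described by $i(\sigma)$ means that there is a numbering of the $27$ lines by $\{1,\dots,27\}$, carrying the group of permutations respecting the intersection pairing to $G_{\max}$, under which each $\sigma \in \mathrm{Gal}(l/k)$ acts as $i(\sigma)$. A surface $S$ is $k$-unirational if there is a dominant rational map over $k$ from a projective space to $S$. *)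

theory Defs
  imports
    "HOL-Analysis.Cartesian_Space"
    "HOL-Library.Poly_Mapping"
    "HOL-Library.Numeral_Type"
    "HOL-Algebra.Algebraic_Closure_Type"
    "HOL-Algebra.Sym_Groups"
begin

section \<open>Field extensions\<close>

text \<open>A field extension is a pair of field types with an embedding of the smaller field
  into the larger one.\<close>

definition field_embedding :: "('a::field \<Rightarrow> 'b::field) \<Rightarrow> bool" where
  "field_embedding e \<longleftrightarrow> e 1 = 1 \<and> (\<forall>x y. e (x + y) = e x + e y) \<and> (\<forall>x y. e (x * y) = e x * e y)"

definition algebraic_extension :: "('k::field \<Rightarrow> 'l::field) \<Rightarrow> bool" where
  "algebraic_extension e \<longleftrightarrow> (\<forall>x. \<exists>p::'k poly. p \<noteq> 0 \<and> poly (map_poly e p) x = 0)"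

definition normal_extension :: "('k::field \<Rightarrow> 'l::field) \<Rightarrow> bool" where
  "normal_extension e \<longleftrightarrow> algebraic_extension e \<and>
     (\<forall>p::'k poly. irreducible p \<longrightarrow> (\<exists>x. poly (map_poly e p) x = 0) \<longrightarrow>
        (\<exists>c xs. map_poly e p = smult c (\<Prod>x\<leftarrow>xs. [:- x, 1:])))"

text \<open>An irreducible polynomial with a root in the extension is, up to a unit, the minimal
  polynomial of that root; separability says that it has only simple roots in an algebraic
  closure.\<close>

definition separable_extension :: "('k::field \<Rightarrow> 'l::field) \<Rightarrow> bool" where
  "separable_extension e \<longleftrightarrow> algebraic_extension e \<and>
     (\<forall>p::'k poly. irreducible p \<longrightarrow> (\<exists>x. poly (map_poly e p) x = 0) \<longrightarrow>
        rsquarefree (map_poly to_ac p))"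

definition galois_group :: "('k::field \<Rightarrow> 'l::field) \<Rightarrow> ('l \<Rightarrow> 'l) monoid" where
  "galois_group e =
     \<lparr>carrier = {\<sigma>. bij \<sigma> \<and> field_embedding \<sigma> \<and> (\<forall>a. \<sigma> (e a) = e a)}, monoid.mult = (\<circ>), one = id\<rparr>"


section \<open>Polynomials in several variables\<close>

text \<open>Monomials are finitely supported exponent functions on the variables.\<close>

type_synonym ('v, 'a) mpoly = "('v \<Rightarrow>\<^sub>0 nat) \<Rightarrow>\<^sub>0 'a"

text \<open>Evaluation at a point of an extension field, embedding the coefficients by e.\<close>

definition mp_eval :: "('a::zero \<Rightarrow> 'b::comm_semiring_1) \<Rightarrow> ('v, 'a) mpoly \<Rightarrow> ('v \<Rightarrow> 'b) \<Rightarrow> 'b" where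
  "mp_eval e P x = (\<Sum>m\<in>Poly_Mapping.keys P.
     e (Poly_Mapping.lookup P m) * (\<Prod>i\<in>Poly_Mapping.keys m. x i ^ Poly_Mapping.lookup m i))"

definition mp_homogeneous :: "nat \<Rightarrow> ('v, 'a::zero) mpoly \<Rightarrow> bool" where
  "mp_homogeneous d P \<longleftrightarrow>
     (\<forall>m\<in>Poly_Mapping.keys P. (\<Sum>i\<in>Poly_Mapping.keys m. Poly_Mapping.lookup m i) = d)"

definition mp_vars :: "('v, 'a::zero) mpoly \<Rightarrow> 'v set" where
  "mp_vars P = (\<Union>m\<in>Poly_Mapping.keys P. Poly_Mapping.keys m)"

text \<open>Formal partial derivative; the exponent subtraction truncates only where the
  coefficient is zero.\<close>

definition mp_deriv :: "'v \<Rightarrow> ('v, 'a::comm_semiring_1) mpoly \<Rightarrow> ('v, 'a) mpoly" where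
  "mp_deriv i P = (\<Sum>m\<in>Poly_Mapping.keys P.
     Poly_Mapping.single (m - Poly_Mapping.single i 1)
       (of_nat (Poly_Mapping.lookup m i) * Poly_Mapping.lookup P m))"


section \<open>Cubic surfaces in projective 3-space\<close>

text \<open>A point of projective 3-space is given by a nonzero vector of homogeneous coordinates.
  A hypersurface is given by a form with coefficients in the base field.\<close>

definition surface_points :: "('a::zero \<Rightarrow> 'b::field) \<Rightarrow> (4, 'a) mpoly \<Rightarrow> ('b ^ 4) set" where
  "surface_points e F = {x. x \<noteq> 0 \<and> mp_eval e F (($) x) = 0}"

definition nonsingular_cubic_surface :: "(4, 'k::field) mpoly \<Rightarrow> bool" where
  "nonsingular_cubic_surface F \<longleftrightarrow> F \<noteq> 0 \<and> mp_homogeneous 3 F \<and>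
     \<not> (\<exists>x \<in> surface_points (to_ac :: 'k \<Rightarrow> 'k alg_closure) F.
           \<forall>i. mp_eval to_ac (mp_deriv i F) (($) x) = 0)"

text \<open>Lines are two-dimensional linear subspaces of the coordinate space. Here the target
  of e is meant to be algebraically closed, so that containment can be tested on points.\<close>

definition lines_on :: "('a::zero \<Rightarrow> 'b::field) \<Rightarrow> (4, 'a) mpoly \<Rightarrow> ('b ^ 4) set set" where
  "lines_on e F = {L. vec.subspace L \<and> vec.dim L = 2 \<and> L - {0} \<subseteq> surface_points e F}"

text \<open>Distinct lines on a nonsingular cubic surface have intersection number 1 if they meet
  and 0 if they are skew; by adjunction each line has self-intersection -1.\<close>

definition line_pairing :: "('a::field ^ 4) set \<Rightarrow> ('a ^ 4) set \<Rightarrow> int" where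
  "line_pairing L M = (if L = M then -1 else if L \<inter> M \<noteq> {0} then 1 else 0)"

definition map_coords :: "('a \<Rightarrow> 'b) \<Rightarrow> 'a ^ 'n \<Rightarrow> 'b ^ 'n" where
  "map_coords f v = (\<chi> i. f (v $ i))"

text \<open>The line is spanned by points with coordinates in the subfield.\<close>

definition line_defined_over :: "('l::field \<Rightarrow> 'b::field) \<Rightarrow> ('b ^ 4) set \<Rightarrow> bool" where
  "line_defined_over e L \<longleftrightarrow> (\<exists>W :: ('l ^ 4) set. L = vec.span (map_coords e ` W))"

text \<open>Action of an automorphism of a field on the lines defined over it: apply the
  automorphism to the coordinates of the rational points and take the span.\<close>

definition conj_line :: "('l::field \<Rightarrow> 'b::field) \<Rightarrow> ('l \<Rightarrow> 'l) \<Rightarrow> ('b ^ 4) set \<Rightarrow> ('b ^ 4) set" where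
  "conj_line e \<sigma> L = vec.span {map_coords e (map_coords \<sigma> v) | v. map_coords e v \<in> L}"


section \<open>The permutation group of the 27 lines\<close>

text \<open>The permutations of the numbers 1 to 27 that respect a given pairing.\<close>

definition pairing_group :: "(nat \<Rightarrow> nat \<Rightarrow> int) \<Rightarrow> (nat \<Rightarrow> nat) set" where
  "pairing_group b = {p. p permutes {1..27} \<and>
     (\<forall>m\<in>{1..27}. \<forall>n\<in>{1..27}. b (p m) (p n) = b m n)}"

text \<open>The reference configuration is that of the blow-up of the plane in six general points.
  The list [d, m1, ..., m6] stands for the class d H - m1 E1 - ... - m6 E6 in its Picard
  lattice. The 27 lines are the six exceptional curves, the strict transforms of the six conics
  through five of the points, and those of the fifteen lines through two of them.\<close>

definition line_classes :: "int list list" where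
  "line_classes =
     [0 # map (\<lambda>j. if j = a then -1 else 0) [0..<6]. a \<leftarrow> [0..<6]] @
     [2 # map (\<lambda>j. if j = a then 0 else 1) [0..<6]. a \<leftarrow> [0..<6]] @
     [1 # map (\<lambda>j. if j = a \<or> j = b then 1 else 0) [0..<6]. b \<leftarrow> [0..<6], a \<leftarrow> [0..<b]]"

definition lattice_pairing :: "int list \<Rightarrow> int list \<Rightarrow> int" where
  "lattice_pairing u v = hd u * hd v - sum_list (map2 (*) (tl u) (tl v))"

definition reference_pairing :: "nat \<Rightarrow> nat \<Rightarrow> int" where
  "reference_pairing m n = lattice_pairing (line_classes ! (m - 1)) (line_classes ! (n - 1))"

definition G_max :: "(nat \<Rightarrow> nat) set" where
  "G_max = pairing_group reference_pairing"

definition U_line :: "nat \<Rightarrow> (nat \<Rightarrow> nat) set" where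
  "U_line a = {p \<in> G_max. p a = a}"

definition line_numbering :: "('a::zero \<Rightarrow> 'b::field) \<Rightarrow> (4, 'a) mpoly \<Rightarrow> (nat \<Rightarrow> ('b ^ 4) set) \<Rightarrow> bool" where
  "line_numbering e F \<nu> \<longleftrightarrow> bij_betw \<nu> {1..27} (lines_on e F) \<and>
     pairing_group (\<lambda>m n. line_pairing (\<nu> m) (\<nu> n)) = G_max"


section \<open>Unirationality\<close>

text \<open>Zariski closed subsets of projective 3-space, as sets of nonzero coordinate vectors.\<close>

definition zariski_closed :: "('a::field ^ 4) set \<Rightarrow> bool" where
  "zariski_closed Z \<longleftrightarrow> (\<exists>T :: (4, 'a) mpoly set.
     (\<forall>H\<in>T. \<exists>d. mp_homogeneous d H) \<and>
     Z = {x. x \<noteq> 0 \<and> (\<forall>H\<in>T. mp_eval id H (($) x) = 0)})"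

text \<open>A rational map from projective n-space to projective 3-space over k is given by four forms
  of the same degree over k in the variables 0, ..., n, not all zero; it is defined (at least)
  where they do not all vanish. Only the first n + 1 entries of t matter below.\<close>

definition rational_map_forms :: "nat \<Rightarrow> (4 \<Rightarrow> (nat, 'k::field) mpoly) \<Rightarrow> bool" where
  "rational_map_forms n G \<longleftrightarrow> (\<exists>j. G j \<noteq> 0) \<and> (\<forall>j. mp_vars (G j) \<subseteq> {..n}) \<and>
     (\<exists>d. \<forall>j. mp_homogeneous d (G j))"

definition rational_map_image :: "('k::field \<Rightarrow> 'b::field) \<Rightarrow> (4 \<Rightarrow> (nat, 'k) mpoly) \<Rightarrow> ('b ^ 4) set" where
  "rational_map_image e G = {x. x \<noteq> 0 \<and> (\<exists>t. x = (\<chi> j. mp_eval e (G j) t))}"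

text \<open>The map goes to the surface, and is dominant: its image on points over the algebraic
  closure is Zariski dense in the surface.\<close>

definition unirational_surface :: "(4, 'k::field) mpoly \<Rightarrow> bool" where
  "unirational_surface F \<longleftrightarrow> (\<exists>n G. rational_map_forms n G \<and>
     rational_map_image (to_ac :: 'k \<Rightarrow> 'k alg_closure) G \<subseteq> surface_points to_ac F \<and>
     (\<forall>Z. zariski_closed Z \<and> rational_map_image to_ac G \<subseteq> Z \<longrightarrow> surface_points to_ac F \<subseteq> Z))"

end

(*
  Let f(t) be the quintic with roots beta_1^2, ..., beta_5^2 and d = beta_1 ... beta_5. In the
  coordinates X, Y, s, t (numbered 1 to 4 below), the cubic form

    F = t X^2 - s Y^2 + 2 d s^2 X + 2 t^2 Y + f4 t^3 + f3 t^2 s + f2 t s^2 + f1 s^3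

  satisfies s t F = s (t X + d s^2)^2 - t (s Y - t^2)^2 + f(t, s), where f(t, s) is the
  homogenized quintic with lower coefficients f4, ..., f1, -d^2. It contains the line s = t = 0;
  each plane t = beta_i^2 s through this line cuts out two further lines, which are swapped by
  the sign change of beta_i; and the 16 lines skew to it correspond to the factorizations
  f(T^2) = - P(T) P(-T) with P monic and P(0) = d. So the stabilizer of a line, acting by signed
  permutations with an even number of signs, permutes the beta_i as it permutes the lines, and
  the coefficients of F are its invariants. Dedekind's independence of characters and the
  infinity of k provide generic elements beta_i of l on which the Galois group acts as
  prescribed; F is then defined over k. It is unirational since the residual conics in the
  tangent planes along the rational line s = t = 0 carry rational points.
*)

theory Submission
  imports Defs
begin

text \<open>The identity presents the surface as a conic bundle \<open>s U^2 - t W^2 + f = 0\<close>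
  with \<open>U = t X + d s^2\<close> and \<open>W = s Y - t^2\<close>. A fibre with
  \<open>f = 0\<close> splits as \<open>U = b W\<close> or \<open>U = - b W\<close>, where
  \<open>b^2 = t / s\<close>. This is why five square roots are the right data: the stabilizer of a
  line is the Weyl group of D5, and its restriction to even sign changes is exactly what keeps the
  product \<open>d\<close> invariant. In characteristic 2 the roots \<open>b\<close> and
  \<open>- b\<close> would coincide. Nonsingularity and dominance refer to the closure of k, but the
  lines to the closure of l. Hence surface and lines are built from labels in an arbitrary field of
  characteristic other than 2, and the construction is shown to commute with field embeddings;
  Galois conjugation then is just another embedding. The Galois group is finite because it embeds
  into permutations of 27 numbers.\<close>

no_notation fps_nth (infixl \<open>$\<close> 75)

section \<open>Field embeddings\<close>

locale field_emb =
  fixes e :: "'a::field \<Rightarrow> 'b::field"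
  assumes emb: "field_embedding e"
begin

lemma one [simp]: "e 1 = 1" and add [simp]: "e (x + y) = e x + e y"
  and mult [simp]: "e (x * y) = e x * e y"
  using emb by (simp_all add: field_embedding_def)

lemma zero [simp]: "e 0 = 0"
proof -
  have "e 0 + e 0 = e 0 + 0" by (simp flip: add)
  then show ?thesis by (rule add_left_imp_eq)
qed

lemma uminus [simp]: "e (- x) = - e x"
  using add[of x "- x"] by (simp add: eq_neg_iff_add_eq_0 add.commute)

lemma diff [simp]: "e (x - y) = e x - e y"
  using add[of x "- y"] by simp

lemma eq_0_iff [simp]: "e x = 0 \<longleftrightarrow> x = 0"
proof
  assume "e x = 0"
  then have "e (x * inverse x) = 0" by simp
  then show "x = 0" by (cases "x = 0") auto
qed simp

lemma eq_iff [simp]: "e x = e y \<longleftrightarrow> x = y"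
  using eq_0_iff[of "x - y"] by simp

lemma inj_e: "inj e"
  by (rule injI) simp

lemma inverse [simp]: "e (inverse x) = inverse (e x)"
proof (cases "x = 0")
  case False
  then have "e x * e (inverse x) = 1" by (simp flip: mult)
  then show ?thesis by (metis inverse_unique)
qed simp

lemma divide [simp]: "e (x / y) = e x / e y"
  by (simp add: divide_inverse)

lemma power [simp]: "e (x ^ n) = e x ^ n"
  by (induction n) auto

lemma of_nat [simp]: "e (of_nat n) = of_nat n"
  by (induction n) auto

lemma numeral [simp]: "e (numeral n) = numeral n"
  using of_nat[of "numeral n"] by simp

lemma sum: "e (sum f A) = (\<Sum>x\<in>A. e (f x))"
  by (induction A rule: infinite_finite_induct) auto

lemma coeff_map [simp]: "poly.coeff (map_poly e p) n = e (poly.coeff p n)"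
  by (simp add: coeff_map_poly)

lemma map_poly_pCons_e [simp]: "map_poly e (pCons a p) = pCons (e a) (map_poly e p)"
  by (rule map_poly_pCons) simp

lemma map_poly_add [simp]: "map_poly e (p + q) = map_poly e p + map_poly e q"
  by (rule poly_eqI) simp

lemma map_poly_mult [simp]: "map_poly e (p * q) = map_poly e p * map_poly e q"
  by (rule poly_eqI) (simp add: coeff_mult sum)

lemma map_poly_prod: "map_poly e (prod f A) = (\<Prod>x\<in>A. map_poly e (f x))"
  by (induction A rule: infinite_finite_induct) auto

lemma map_poly_eq_0 [simp]: "map_poly e p = 0 \<longleftrightarrow> p = 0"
  by (simp add: poly_eq_iff)

lemma degree_map [simp]: "Polynomial.degree (map_poly e p) = Polynomial.degree p"
  by (rule degree_map_poly) simp

lemma poly_map [simp]: "poly (map_poly e p) (e x) = e (poly p x)"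
  by (induction p) auto

lemma map_poly_pderiv: "map_poly e (pderiv p) = pderiv (map_poly e p)"
  by (rule poly_eqI) (simp add: coeff_pderiv del: of_nat_Suc)

lemma two_nonzero: "(2::'a) \<noteq> 0 \<Longrightarrow> (2::'b) \<noteq> 0"
  using eq_0_iff[of 2] by simp

end

lemma field_embedding_comp:
  "field_embedding f \<Longrightarrow> field_embedding g \<Longrightarrow> field_embedding (\<lambda>x. g (f x))"
  by (simp add: field_embedding_def)

lemma field_embedding_to_ac: "field_embedding to_ac"
  by (simp add: field_embedding_def)

section \<open>Extending embeddings of algebraic extensions\<close>

text \<open>A partial embedding of \<open>'l\<close> into \<open>'c\<close> over the base field is handled through its graph,
  which is a subalgebra of the product ring; the last condition makes it single-valued.\<close>

definition partial_emb :: "('k::field \<Rightarrow> 'l::field) \<Rightarrow> ('k \<Rightarrow> 'c::field) \<Rightarrow> ('l \<times> 'c) set \<Rightarrow> bool" where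
  "partial_emb \<phi> e R \<longleftrightarrow>
     (\<forall>a. (\<phi> a, e a) \<in> R) \<and>
     (\<forall>x y x' y'. (x, y) \<in> R \<longrightarrow> (x', y') \<in> R \<longrightarrow> (x + x', y + y') \<in> R \<and> (x * x', y * y') \<in> R) \<and>
     (\<forall>z. (0, z) \<in> R \<longrightarrow> z = 0)"

locale two_embeddings = phi: field_emb \<phi> + e: field_emb e
  for \<phi> :: "'k::field \<Rightarrow> 'l::field" and e :: "'k \<Rightarrow> 'c::field"
begin

abbreviation pe where "pe \<equiv> partial_emb \<phi> e"

lemma pe_base: "pe R \<Longrightarrow> (\<phi> a, e a) \<in> R"
  and pe_add: "pe R \<Longrightarrow> (x, y) \<in> R \<Longrightarrow> (x', y') \<in> R \<Longrightarrow> (x + x', y + y') \<in> R"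
  and pe_mult: "pe R \<Longrightarrow> (x, y) \<in> R \<Longrightarrow> (x', y') \<in> R \<Longrightarrow> (x * x', y * y') \<in> R"
  and pe_0: "pe R \<Longrightarrow> (0, z) \<in> R \<Longrightarrow> z = 0"
  unfolding partial_emb_def by blast+

lemma pe_00: "pe R \<Longrightarrow> (0, 0) \<in> R"
  using pe_base[of R 0] by simp

lemma pe_diff: "pe R \<Longrightarrow> (x, y) \<in> R \<Longrightarrow> (x', y') \<in> R \<Longrightarrow> (x - x', y - y') \<in> R"
  using pe_add[of R x y "- x'" "- y'"] pe_mult[of R "\<phi> (- 1)" "e (- 1)" x' y'] pe_base[of R "- 1"] by simp

lemma pe_unique: "pe R \<Longrightarrow> (x, y) \<in> R \<Longrightarrow> (x, y') \<in> R \<Longrightarrow> y = y'"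
  using pe_diff[of R x y x y'] pe_0[of R "y - y'"] by simp

lemma pe_poly:
  assumes "pe R" "(x, y) \<in> R"
  shows "(poly (map_poly \<phi> p) x, poly (map_poly e p) y) \<in> R"
proof (induction p)
  case 0
  then show ?case using pe_00[OF assms(1)] by simp
next
  case (pCons a p)
  then show ?case
    using pe_add[OF assms(1) pe_base[OF assms(1)] pe_mult[OF assms(1) assms(2) pCons.IH]] by simp
qed

text \<open>A partial embedding is only a ring, so inverses come from algebraicity: a relation of
  least degree for \<open>x\<close> has nonzero constant term \<open>c\<close>, and
  \<open>x * q(x) = - c\<close> inverts \<open>x\<close> by a polynomial in \<open>x\<close>, which
  \<open>R\<close> can follow.\<close>

lemma pe_inverse:
  assumes R: "pe R" and xy: "(x, y) \<in> R" and x: "x \<noteq> 0"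
    and alg: "\<exists>p. p \<noteq> 0 \<and> poly (map_poly \<phi> p) x = 0"
  obtains y' where "(inverse x, y') \<in> R" "y' * y = 1"
proof -
  define P where "P = (\<lambda>p. p \<noteq> 0 \<and> poly (map_poly \<phi> p) x = 0)"
  obtain p where p: "P p" and min: "\<And>q. P q \<Longrightarrow> Polynomial.degree p \<le> Polynomial.degree q"
    using ex_has_least_nat[of P _ Polynomial.degree] alg unfolding P_def by blast
  obtain c q where pq: "p = pCons c q" by (cases p)
  have c: "c \<noteq> 0"
  proof
    assume "c = 0"
    with p pq x have "P q" by (auto simp: P_def)
    from min[OF this] pq \<open>P q\<close> show False by (simp add: P_def)
  qed
  define r where "r = [:- 1 / c:] * q"
  have "\<phi> c + x * poly (map_poly \<phi> q) x = 0" using p pq by (simp add: P_def)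
  then have "x * poly (map_poly \<phi> q) x = - \<phi> c" by (metis add.commute add_eq_0_iff)
  moreover have "poly (map_poly \<phi> r) x = - poly (map_poly \<phi> q) x / \<phi> c"
    by (simp add: r_def del: mult_pCons_left)
  ultimately have "x * poly (map_poly \<phi> r) x = 1" using c by simp
  then have inv: "poly (map_poly \<phi> r) x = inverse x" by (metis inverse_unique)
  define y' where "y' = poly (map_poly e r) y"
  have mem: "(inverse x, y') \<in> R"
    using pe_poly[OF R xy, of r] unfolding inv y'_def .
  have "(1, y' * y) \<in> R" "(1, 1) \<in> R"
    using pe_mult[OF R mem xy] x pe_base[OF R, of 1] by auto
  then have "y' * y = 1" using pe_unique[OF R] by blast
  with mem show ?thesis by (rule that)
qed

text \<open>The polynomial ring over the graph \<open>R\<close>: \<open>h\<close> is the image of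
  \<open>g\<close> under the partial embedding. Keeping pairs avoids treating the domain of
  \<open>R\<close> as a field of its own.\<close>

definition rel_polys :: "('l \<times> 'c) set \<Rightarrow> ('l poly \<times> 'c poly) set" where
  "rel_polys R = {(g, h). \<forall>i. (poly.coeff g i, poly.coeff h i) \<in> R}"

lemma rel_polys_add:
  "pe R \<Longrightarrow> (g, h) \<in> rel_polys R \<Longrightarrow> (g', h') \<in> rel_polys R \<Longrightarrow> (g + g', h + h') \<in> rel_polys R"
  by (auto simp: rel_polys_def intro: pe_add)

lemma rel_polys_diff:
  "pe R \<Longrightarrow> (g, h) \<in> rel_polys R \<Longrightarrow> (g', h') \<in> rel_polys R \<Longrightarrow> (g - g', h - h') \<in> rel_polys R"
  by (auto simp: rel_polys_def intro: pe_diff)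

lemma pe_sum:
  assumes "pe R" "\<And>i. i \<in> A \<Longrightarrow> (f i, g i) \<in> R"
  shows "(sum f A, sum g A) \<in> R"
  using assms(2) by (induction A rule: infinite_finite_induct) (auto intro: pe_add pe_00 assms(1))

lemma rel_polys_mult:
  "pe R \<Longrightarrow> (g, h) \<in> rel_polys R \<Longrightarrow> (g', h') \<in> rel_polys R \<Longrightarrow> (g * g', h * h') \<in> rel_polys R"
  by (auto simp: rel_polys_def coeff_mult intro!: pe_sum pe_mult)

lemma rel_polys_monom:
  "pe R \<Longrightarrow> (x, y) \<in> R \<Longrightarrow> (Polynomial.monom x n, Polynomial.monom y n) \<in> rel_polys R"
  by (auto simp: rel_polys_def intro: pe_00)

lemma rel_polys_map: "pe R \<Longrightarrow> (map_poly \<phi> p, map_poly e p) \<in> rel_polys R"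
  by (auto simp: rel_polys_def intro: pe_base)

lemma rel_polys_0: "pe R \<Longrightarrow> (0, h) \<in> rel_polys R \<Longrightarrow> h = 0"
  by (auto simp: rel_polys_def poly_eq_iff intro: pe_0)

text \<open>Division with remainder by a minimal polynomial \<open>q\<close> of \<open>y\<close>,
  carried out on both coordinates at once. It makes sending \<open>y\<close> to a root of
  \<open>q'\<close> well defined.\<close>

lemma rel_polys_dvd:
  assumes R: "pe R"
    and alg: "\<And>x. \<exists>p. p \<noteq> 0 \<and> poly (map_poly \<phi> p) x = 0"
    and q: "(q, q') \<in> rel_polys R" "q \<noteq> 0" "poly q y = 0"
    and min: "\<And>g h. (g, h) \<in> rel_polys R \<Longrightarrow> g \<noteq> 0 \<Longrightarrow> poly g y = 0 \<Longrightarrow> Polynomial.degree q \<le> Polynomial.degree g"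
    and gh: "(g, h) \<in> rel_polys R" "poly g y = 0"
  shows "q' dvd h"
  using gh
proof (induction "Polynomial.degree g" arbitrary: g h rule: less_induct)
  case less
  show ?case
  proof (cases "g = 0")
    case True
    then show ?thesis using rel_polys_0[OF R] less.prems by auto
  next
    case False
    then have deg: "Polynomial.degree q \<le> Polynomial.degree g" using min less.prems by blast
    define k where "k = Polynomial.degree g - Polynomial.degree q"
    obtain w where w: "(inverse (Polynomial.lead_coeff q), w) \<in> R"
      using pe_inverse[OF R _ _ alg, of "Polynomial.lead_coeff q" "poly.coeff q' (Polynomial.degree q)"] q(1,2)
      unfolding rel_polys_def by auto
    define a where "a = Polynomial.lead_coeff g * inverse (Polynomial.lead_coeff q)"
    \<comment> \<open>The coefficient of \<open>h\<close> is taken at the degree of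
      \<open>g\<close>, because there it is the image of the leading coefficient of
      \<open>g\<close>.\<close>
    define a' where "a' = poly.coeff h (Polynomial.degree g) * w"
    have a: "(a, a') \<in> R" unfolding a_def a'_def
      using pe_mult[OF R _ w] less.prems(1) by (auto simp: rel_polys_def)
    define g1 where "g1 = g - Polynomial.monom a k * q"
    define h1 where "h1 = h - Polynomial.monom a' k * q'"
    have rel: "(g1, h1) \<in> rel_polys R" unfolding g1_def h1_def
      by (intro rel_polys_diff rel_polys_mult rel_polys_monom R less.prems q a)
    have root: "poly g1 y = 0" using less.prems q by (simp add: g1_def)
    have "q' dvd h1"
    proof (cases "g1 = 0")
      case True
      then show ?thesis using rel_polys_0[OF R] rel by auto
    next
      case g1: False
      have "a \<noteq> 0" using False q by (simp add: a_def)
      then have d: "Polynomial.degree (Polynomial.monom a k * q) = Polynomial.degree g"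
        using q deg by (subst degree_mult_eq) (auto simp: degree_monom_eq k_def)
      moreover have "Polynomial.lead_coeff (Polynomial.monom a k * q) = a * Polynomial.lead_coeff q"
        using \<open>a \<noteq> 0\<close> by (simp only: lead_coeff_mult) (simp add: degree_monom_eq)
      then have "Polynomial.lead_coeff (Polynomial.monom a k * q) = Polynomial.lead_coeff g"
        using q by (simp add: a_def)
      ultimately have "poly.coeff g1 (Polynomial.degree g) = 0" by (simp add: g1_def)
      moreover have "Polynomial.degree g1 \<le> Polynomial.degree g"
        unfolding g1_def using d by (metis degree_diff_le order_refl)
      ultimately have "Polynomial.degree g1 < Polynomial.degree g"
        using g1 by (metis leading_coeff_0_iff order_le_less)
      then show ?thesis using less.hyps rel root by blast
    qed
    then have "q' dvd h1 + Polynomial.monom a' k * q'" by simp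
    then show ?thesis by (simp add: h1_def)
  qed
qed

end

text \<open>A linear factor whose root is not a root of \<open>q\<close> can be cancelled; if all of
  them could, \<open>q\<close> would divide a constant.\<close>

lemma dvd_split_poly_has_root:
  fixes q :: "'a::field poly"
  assumes "q dvd smult c (\<Prod>x\<leftarrow>xs. [:- x, 1:])" "c \<noteq> 0" "Polynomial.degree q > 0"
  obtains x where "poly q x = 0"
proof -
  have "\<exists>x. poly q x = 0" using assms
  proof (induction xs arbitrary: q)
    case Nil
    then have "Polynomial.degree q \<le> Polynomial.degree [:c:]" by (intro dvd_imp_degree_le) auto
    with Nil show ?case by simp
  next
    case (Cons a xs)
    show ?case
    proof (cases "poly q a = 0")
      case False
      obtain r where r: "[:- a, 1:] * smult c (\<Prod>x\<leftarrow>xs. [:- x, 1:]) = q * r"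
        using Cons.prems(1) by (auto elim: dvdE)
      have "poly q a * poly r a = 0" by (simp flip: poly_mult r)
      with False have "poly r a = 0" by simp
      then obtain s where "r = [:- a, 1:] * s" using poly_eq_0_iff_dvd by (metis dvdE)
      with r have "[:- a, 1:] * smult c (\<Prod>x\<leftarrow>xs. [:- x, 1:]) = [:- a, 1:] * (q * s)"
        by (simp add: mult.left_commute)
      then have "smult c (\<Prod>x\<leftarrow>xs. [:- x, 1:]) = q * s" by (subst (asm) mult_cancel_left) simp
      then have "q dvd smult c (\<Prod>x\<leftarrow>xs. [:- x, 1:])" by simp
      from Cons.IH[OF this Cons.prems(2,3)] show ?thesis .
    qed blast
  qed
  with that show ?thesis by blast
qed

context two_embeddings
begin

text \<open>The image \<open>q'\<close> of a minimal polynomial of \<open>y\<close> over the domain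
  of \<open>R\<close> divides the image of \<open>p\<close>, which splits; any root
  \<open>y'\<close> of \<open>q'\<close> can serve as the image of \<open>y\<close>.\<close>

lemma pe_adjoin:
  assumes R: "pe R"
    and alg: "\<And>x. \<exists>p. p \<noteq> 0 \<and> poly (map_poly \<phi> p) x = 0"
    and p: "p \<noteq> 0" "poly (map_poly \<phi> p) y = 0"
    and splits: "map_poly e p = smult c (\<Prod>x\<leftarrow>xs. [:- x, 1:])"
  shows "\<exists>R'. pe R' \<and> R \<subseteq> R' \<and> y \<in> fst ` R'"
proof -
  define P where "P = (\<lambda>(g, h). (g, h) \<in> rel_polys R \<and> g \<noteq> 0 \<and> poly g y = 0)"
  have "P (map_poly \<phi> p, map_poly e p)" using p rel_polys_map[OF R] by (simp add: P_def)
  then obtain qq where qq: "P qq" and minq: "\<And>x. P x \<Longrightarrow> Polynomial.degree (fst qq) \<le> Polynomial.degree (fst x)"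
    using ex_has_least_nat[of P _ "\<lambda>x. Polynomial.degree (fst x)"] by blast
  obtain q q' where q: "(q, q') \<in> rel_polys R" "q \<noteq> 0" "poly q y = 0" and qq_eq: "qq = (q, q')"
    using qq by (cases qq) (auto simp: P_def)
  have dvd: "q' dvd h" if "(g, h) \<in> rel_polys R" "poly g y = 0" for g h
    by (rule rel_polys_dvd[OF R alg q _ that]) (use minq in \<open>auto simp: P_def qq_eq\<close>)
  have "Polynomial.degree q > 0" using q(2,3) by (cases "Polynomial.degree q = 0") (auto elim!: degree_eq_zeroE)
  \<comment> \<open>The leading coefficient of \<open>q\<close> has an inverse within
    \<open>R\<close>, so its image is nonzero and \<open>q'\<close> has not dropped to a
    constant.\<close>
  moreover have "poly.coeff q' (Polynomial.degree q) \<noteq> 0"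
  proof -
    have "(Polynomial.lead_coeff q, poly.coeff q' (Polynomial.degree q)) \<in> R"
      using q by (auto simp: rel_polys_def)
    then obtain y' where "y' * poly.coeff q' (Polynomial.degree q) = 1"
      using pe_inverse[OF R _ _ alg] q(2) by (meson leading_coeff_0_iff)
    then show ?thesis by auto
  qed
  ultimately have deg: "Polynomial.degree q' > 0" by (metis le_degree less_le_trans)
  have "q' dvd smult c (\<Prod>x\<leftarrow>xs. [:- x, 1:])"
    unfolding splits[symmetric] using rel_polys_map[OF R] p(2) by (rule dvd)
  moreover have "c \<noteq> 0" using p(1) splits by (metis e.map_poly_eq_0 smult_0_left)
  ultimately obtain y' where y': "poly q' y' = 0" using deg dvd_split_poly_has_root by blast
  \<comment> \<open>The graph of \<open>g(y) \<mapsto> h(y')\<close>; it is single-valued because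
    \<open>q'\<close> divides \<open>h\<close> whenever \<open>g(y) = 0\<close>.\<close>
  define R' where "R' = {(poly g y, poly h y') | g h. (g, h) \<in> rel_polys R}"
  have sub: "R \<subseteq> R'"
  proof
    fix z assume "z \<in> R"
    then obtain x x' where "z = (x, x')" "(x, x') \<in> R" by (cases z) auto
    then show "z \<in> R'" unfolding R'_def using rel_polys_monom[OF R, of x x' 0]
      by (auto simp: poly_monom intro!: exI[of _ "Polynomial.monom x 0"] exI[of _ "Polynomial.monom x' 0"])
  qed
  have "pe R'" unfolding partial_emb_def
  proof (intro conjI allI impI)
    fix a show "(\<phi> a, e a) \<in> R'" using pe_base[OF R] sub by blast
  next
    fix x z x' z' assume "(x, z) \<in> R'" "(x', z') \<in> R'"
    then obtain g h g' h' where *: "(g, h) \<in> rel_polys R" "x = poly g y" "z = poly h y'"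
      "(g', h') \<in> rel_polys R" "x' = poly g' y" "z' = poly h' y'" unfolding R'_def by blast
    show "(x + x', z + z') \<in> R'"
      using rel_polys_add[OF R *(1,4)] * unfolding R'_def by (metis (mono_tags, lifting) CollectI poly_add)
    show "(x * x', z * z') \<in> R'"
      using rel_polys_mult[OF R *(1,4)] * unfolding R'_def by (metis (mono_tags, lifting) CollectI poly_mult)
  next
    fix z assume "(0, z) \<in> R'"
    then obtain g h where *: "(g, h) \<in> rel_polys R" "poly g y = 0" "z = poly h y'" unfolding R'_def by auto
    then have "q' dvd h" using dvd by blast
    then show "z = 0" using y' * by (auto elim: dvdE)
  qed
  moreover have "(y, y') \<in> R'" unfolding R'_def
    using rel_polys_monom[OF R pe_base[OF R, of 1], of 1]
    by (auto simp: poly_monom intro!: exI[of _ "Polynomial.monom (1::'l) 1"] exI[of _ "Polynomial.monom (1::'c) 1"])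
  then have "y \<in> fst ` R'" by force
  ultimately show ?thesis using sub by blast
qed

text \<open>By Zorn's lemma there is a maximal partial embedding, and \<open>pe_adjoin\<close> shows
  that it is total. The splitting hypothesis covers two situations: an algebraically closed target
  and a normal extension.\<close>

lemma pe_extend:
  assumes R: "pe R"
    and splits: "\<And>x. \<exists>p c xs. p \<noteq> 0 \<and> poly (map_poly \<phi> p) x = 0 \<and>
        map_poly e p = smult c (\<Prod>z\<leftarrow>xs. [:- z, 1:])"
  obtains f where "field_embedding f" "\<And>a. f (\<phi> a) = e a" "\<And>x y. (x, y) \<in> R \<Longrightarrow> f x = y"
proof -
  define A where "A = {R'. pe R' \<and> R \<subseteq> R'}"
  have "\<exists>M\<in>A. \<forall>U\<in>A. M \<subseteq> U \<longrightarrow> U = M"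
  proof (rule subset_Zorn_nonempty)
    show "A \<noteq> {}" using R by (auto simp: A_def)
  next
    fix C assume C: "C \<noteq> {}" "subset.chain A C"
    have two: "\<exists>U\<in>C. a \<in> U \<and> b \<in> U" if "a \<in> \<Union>C" "b \<in> \<Union>C" for a b
      using that C(2) unfolding subset_chain_def by blast
    have pe: "pe U" if "U \<in> C" for U using that C(2) unfolding subset_chain_def A_def by blast
    have "pe (\<Union>C)" unfolding partial_emb_def
    proof (intro conjI allI impI)
      show "(\<phi> a, e a) \<in> \<Union>C" for a using C(1) pe pe_base by blast
    next
      fix x y x' y' assume "(x, y) \<in> \<Union>C" "(x', y') \<in> \<Union>C"
      from two[OF this] obtain U where U: "U \<in> C" "(x, y) \<in> U" "(x', y') \<in> U" by blast
      then show "(x + x', y + y') \<in> \<Union>C" "(x * x', y * y') \<in> \<Union>C"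
        using pe pe_add pe_mult by blast+
    next
      show "z = 0" if "(0, z) \<in> \<Union>C" for z using that pe pe_0 by blast
    qed
    moreover have "R \<subseteq> \<Union>C" using C unfolding subset_chain_def A_def by blast
    ultimately show "\<Union>C \<in> A" by (simp add: A_def)
  qed
  then obtain M where "M \<in> A" and maxA: "\<And>U. U \<in> A \<Longrightarrow> M \<subseteq> U \<Longrightarrow> U = M" by blast
  then have M: "pe M" "R \<subseteq> M" by (auto simp: A_def)
  then have max: "U = M" if "pe U" "M \<subseteq> U" for U using maxA that by (auto simp: A_def)
  have total: "\<exists>z. (y, z) \<in> M" for y
  proof -
    obtain p c xs where p: "p \<noteq> 0" "poly (map_poly \<phi> p) y = 0" "map_poly e p = smult c (\<Prod>z\<leftarrow>xs. [:- z, 1:])"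
      using splits by blast
    have alg: "\<exists>p. p \<noteq> 0 \<and> poly (map_poly \<phi> p) x = 0" for x using splits by blast
    obtain R' where "pe R'" "M \<subseteq> R'" "y \<in> fst ` R'" using pe_adjoin[OF M(1) alg p] by blast
    moreover from this have "R' = M" by (intro max)
    ultimately show ?thesis by auto
  qed
  define f where "f = (\<lambda>y. SOME z. (y, z) \<in> M)"
  have f: "(y, f y) \<in> M" for y unfolding f_def using total by (rule someI_ex)
  have f_eq: "f y = z" if "(y, z) \<in> M" for y z using pe_unique[OF M(1) f that] .
  have "field_embedding f" unfolding field_embedding_def
    using f_eq pe_base[OF M(1), of 1] pe_add[OF M(1) f f] pe_mult[OF M(1) f f] by auto
  moreover have "f (\<phi> a) = e a" for a using f_eq pe_base[OF M(1)] by blast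
  moreover have "f x = y" if "(x, y) \<in> R" for x y using that M(2) f_eq by blast
  ultimately show ?thesis by (rule that)
qed

end

section \<open>Minimal polynomials, separability and the fixed field of the Galois group\<close>

lemma (in field_emb) minimal_polynomial:
  assumes "p0 \<noteq> 0" "poly (map_poly e p0) x = 0"
  obtains p where "irreducible p" "poly (map_poly e p) x = 0"
    "\<And>g. poly (map_poly e g) x = 0 \<Longrightarrow> p dvd g"
proof -
  define P where "P = (\<lambda>p. p \<noteq> 0 \<and> poly (map_poly e p) x = 0)"
  have "P p0" using assms by (simp add: P_def)
  then obtain p where p: "P p" and min: "\<And>q. P q \<Longrightarrow> Polynomial.degree p \<le> Polynomial.degree q"
    using ex_has_least_nat[of P _ Polynomial.degree] by blast
  have p0: "p \<noteq> 0" and px: "poly (map_poly e p) x = 0" using p by (simp_all add: P_def)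
  have dvd: "p dvd g" if "poly (map_poly e g) x = 0" for g
  proof (rule ccontr)
    assume "\<not> p dvd g"
    then have nz: "g mod p \<noteq> 0" by (simp add: dvd_eq_mod_eq_0)
    have "map_poly e g = map_poly e (g div p * p + g mod p)" by simp
    then have "poly (map_poly e (g mod p)) x = 0"
      using that px by (simp only: map_poly_add map_poly_mult poly_add poly_mult) simp
    then have "P (g mod p)" using nz by (simp add: P_def)
    from min[OF this] show False using degree_mod_less'[OF p0 nz] by simp
  qed
  have "irreducible p"
  proof (rule irreducibleI)
    show "\<not> p dvd 1"
    proof
      assume "p dvd 1"
      then obtain q where "1 = p * q" by (rule dvdE)
      then have "map_poly e 1 = map_poly e p * map_poly e q" by (metis map_poly_mult)
      then have "poly (map_poly e 1) x = poly (map_poly e p) x * poly (map_poly e q) x" by (simp only: poly_mult)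
      then show False using px by simp
    qed
  next
    fix a b assume ab: "p = a * b"
    have unit: "v dvd 1" if "p = u * v" "poly (map_poly e u) x = 0" for u v
    proof -
      have nz: "u \<noteq> 0" "v \<noteq> 0" using that(1) p0 by auto
      then have "P u" using that by (simp add: P_def)
      from min[OF this] have "Polynomial.degree v = 0" using nz that(1) by (simp add: degree_mult_eq)
      then show ?thesis using nz is_unit_iff_degree by blast
    qed
    have "poly (map_poly e a) x = 0 \<or> poly (map_poly e b) x = 0" using px ab by simp
    then show "a dvd 1 \<or> b dvd 1" using unit[of a b] unit[of b a] ab by (auto simp: mult.commute)
  qed (use p0 in simp)
  then show ?thesis using px dvd by (rule that)
qed

lemma pderiv_degree_less:
  fixes p :: "'a::field poly"
  assumes "Polynomial.degree p \<noteq> 0" "pderiv p \<noteq> 0"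
  shows "Polynomial.degree (pderiv p) < Polynomial.degree p"
proof -
  have "Polynomial.degree (pderiv p) \<le> Polynomial.degree p - 1"
    by (rule degree_le) (auto simp: coeff_pderiv coeff_eq_0)
  then show ?thesis using assms by simp
qed

text \<open>If the derivative vanished, so would the cofactor of \<open>T - z\<close> at
  \<open>z\<close>, and \<open>z\<close> would be a double root.\<close>

lemma rsquarefree_imp_pderiv_nonzero:
  fixes p :: "'a::field poly"
  assumes "rsquarefree p" "poly p z = 0"
  shows "pderiv p \<noteq> 0"
proof
  assume pd: "pderiv p = 0"
  have p0: "p \<noteq> 0" using assms(1) by (simp add: rsquarefree_def)
  obtain q where q: "p = [:- z, 1:] * q" using assms(2) poly_eq_0_iff_dvd by (metis dvdE)
  have "poly (pderiv p) z = poly q z" unfolding q pderiv_mult by (simp add: pderiv_pCons)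
  then have "[:- z, 1:] dvd q" using pd by (simp add: poly_eq_0_iff_dvd)
  then have "[:- z, 1:] ^ 2 dvd p" unfolding q power2_eq_square by (rule mult_dvd_mono[OF dvd_refl])
  then have "2 \<le> Polynomial.order z p" using p0 by (simp add: order_divides)
  moreover have "Polynomial.order z p = 1" using rsquarefree_root_order[OF assms p0] .
  ultimately show False by simp
qed

text \<open>Transports the labels from the extension field to the closure of the base field, where
  nonsingularity and dominance are tested.\<close>

lemma embed_into_alg_closed:
  fixes \<phi> :: "'k::field \<Rightarrow> 'l::field" and e :: "'k \<Rightarrow> 'c::alg_closed_field"
  assumes "field_embedding \<phi>" "algebraic_extension \<phi>" "field_embedding e"
  obtains f where "field_embedding f" "\<And>a. f (\<phi> a) = e a"
proof -
  interpret two_embeddings \<phi> e using assms by unfold_locales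
  have R: "pe (range (\<lambda>a. (\<phi> a, e a)))" unfolding partial_emb_def
  proof (intro conjI allI impI)
    fix x y x' y' assume "(x, y) \<in> range (\<lambda>a. (\<phi> a, e a))" "(x', y') \<in> range (\<lambda>a. (\<phi> a, e a))"
    then obtain a b where "x = \<phi> a" "y = e a" "x' = \<phi> b" "y' = e b" by blast
    then show "(x + x', y + y') \<in> range (\<lambda>a. (\<phi> a, e a))" "(x * x', y * y') \<in> range (\<lambda>a. (\<phi> a, e a))"
      by (auto intro: range_eqI[of _ _ "a + b"] range_eqI[of _ _ "a * b"])
  next
    fix z assume "(0, z) \<in> range (\<lambda>a. (\<phi> a, e a))"
    then obtain a where "\<phi> a = 0" "z = e a" by auto
    then show "z = 0" by simp
  qed auto
  have "\<exists>p c xs. p \<noteq> 0 \<and> poly (map_poly \<phi> p) x = 0 \<and> map_poly e p = smult c (\<Prod>z\<leftarrow>xs. [:- z, 1:])" for x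
  proof -
    obtain p where p: "p \<noteq> 0" "poly (map_poly \<phi> p) x = 0"
      using assms(2) by (auto simp: algebraic_extension_def)
    then have "map_poly e p \<noteq> 0" by simp
    from alg_closed_imp_factorization[OF this] obtain A
      where A: "map_poly e p = smult (Polynomial.lead_coeff (map_poly e p)) (\<Prod>x\<in>#A. [:- x, 1:])" by blast
    obtain xs where "A = mset xs" by (metis ex_mset)
    then show ?thesis using p A by (metis mset_map prod_mset_prod_list)
  qed
  from pe_extend[OF R this] show ?thesis using that by metis
qed

text \<open>A polynomial over the base field with root \<open>y\<close> has finitely many roots;
  \<open>f\<close> maps them injectively to themselves, so \<open>y\<close> is hit.\<close>

lemma algebraic_endomorphism_bij:
  fixes \<phi> :: "'k::field \<Rightarrow> 'l::field"
  assumes "field_embedding \<phi>" "algebraic_extension \<phi>" "field_embedding f" "\<And>a. f (\<phi> a) = \<phi> a"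
  shows "bij f"
proof -
  interpret phi: field_emb \<phi> using assms by unfold_locales
  interpret f: field_emb f using assms by unfold_locales
  have "y \<in> range f" for y
  proof -
    obtain p where p: "p \<noteq> 0" "poly (map_poly \<phi> p) y = 0"
      using assms(2) by (auto simp: algebraic_extension_def)
    define Z where "Z = {z. poly (map_poly \<phi> p) z = 0}"
    have fin: "finite Z" unfolding Z_def using p by (intro poly_roots_finite) simp
    have "map_poly f (map_poly \<phi> p) = map_poly \<phi> p"
      by (rule poly_eqI) (simp add: assms)
    then have "f ` Z \<subseteq> Z" unfolding Z_def using f.poly_map[of "map_poly \<phi> p"] by auto
    then have "f ` Z = Z" using fin f.inj_e by (intro card_subset_eq) (auto simp: card_image inj_on_def)
    moreover have "y \<in> Z" using p by (simp add: Z_def)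
    ultimately show ?thesis by blast
  qed
  then show ?thesis using f.inj_e by (auto simp: bij_def)
qed

text \<open>The minimal polynomial of an element outside the base field has degree at least two.
  Normality splits it over \<open>'l\<close>, separability supplies a root \<open>y\<close> other
  than \<open>x\<close>, and \<open>x \<mapsto> y\<close> extends to an automorphism.\<close>

lemma galois_fixed_field:
  fixes \<phi> :: "'k::field \<Rightarrow> 'l::field"
  assumes phi: "field_embedding \<phi>" and normal: "normal_extension \<phi>" and sep: "separable_extension \<phi>"
    and fixed: "\<And>\<sigma>. \<sigma> \<in> carrier (galois_group \<phi>) \<Longrightarrow> \<sigma> x = x"
  shows "x \<in> range \<phi>"
proof (rule ccontr)
  assume x: "x \<notin> range \<phi>"
  interpret two_embeddings \<phi> \<phi> using assms by unfold_locales
  have alg: "algebraic_extension \<phi>" using normal by (simp add: normal_extension_def)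
  have min: "\<exists>p. irreducible p \<and> poly (map_poly \<phi> p) y = 0 \<and> (\<forall>g. poly (map_poly \<phi> g) y = 0 \<longrightarrow> p dvd g)" for y
    using alg phi.minimal_polynomial[of _ y] unfolding algebraic_extension_def by metis
  obtain p where irr: "irreducible p" and px: "poly (map_poly \<phi> p) x = 0"
    and dvd: "\<And>g. poly (map_poly \<phi> g) x = 0 \<Longrightarrow> p dvd g" using min[of x] by blast
  have p0: "p \<noteq> 0" using irr by auto
  have deg0: "Polynomial.degree p \<noteq> 0"
  proof
    assume "Polynomial.degree p = 0"
    then obtain a where "p = [:a:]" by (rule degree_eq_zeroE)
    then show False using p0 px by simp
  qed
  have deg1: "Polynomial.degree p \<noteq> 1"
  proof
    assume "Polynomial.degree p = 1"
    then obtain a b where ab: "p = [:a, b:]" "b \<noteq> 0"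
      by (metis degree_eq_zeroE degree_pCons_eq_if nat.inject One_nat_def pCons_cases degree_0 zero_neq_one pCons_0_0)
    then have "\<phi> a + x * \<phi> b = 0" using px by simp
    then have "x * \<phi> b = \<phi> (- a)" by (metis add.commute add_eq_0_iff phi.uminus)
    then have "x = \<phi> (- a / b)" using ab(2) by (simp add: field_simps)
    with x show False by blast
  qed
  obtain c xs where split: "map_poly \<phi> p = smult c (\<Prod>z\<leftarrow>xs. [:- z, 1:])"
    using normal irr px unfolding normal_extension_def by blast
  have rsq: "rsquarefree (map_poly to_ac p)"
    using sep irr px unfolding separable_extension_def by blast
  \<comment> \<open>If \<open>x\<close> were the only root, \<open>p\<close> would be a multiple of
    \<open>(T - x)^n\<close> with \<open>n \<ge> 2\<close>. Its derivative then vanishes at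
    \<open>x\<close>, hence is 0 by minimality, against separability.\<close>
  have "\<exists>y\<in>set xs. y \<noteq> x"
  proof (rule ccontr)
    assume "\<not> ?thesis"
    then have "xs = replicate (length xs) x" by (simp add: list_eq_iff_nth_eq)
    then have pow: "map_poly \<phi> p = smult c ([:- x, 1:] ^ length xs)"
      using split by (metis map_replicate prod_list_replicate)
    define n where "n = length xs"
    have "Polynomial.degree (map_poly \<phi> p) \<le> n" unfolding pow n_def
      by (rule order_trans[OF degree_smult_le]) (simp add: degree_power_eq)
    then obtain m where m: "n = Suc (Suc m)" using deg0 deg1 by (metis One_nat_def le_SucE le_zero_eq not0_implies_Suc phi.degree_map le_0_eq less_Suc0 not_less)
    have "map_poly \<phi> p = [:- x, 1:] * ([:- x, 1:] * smult c ([:- x, 1:] ^ m))"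
      unfolding pow n_def[symmetric] m by simp
    then have "poly (pderiv (map_poly \<phi> p)) x = 0"
      by (simp only: pderiv_mult poly_add poly_mult) simp
    then have "poly (map_poly \<phi> (pderiv p)) x = 0" by (simp add: phi.map_poly_pderiv)
    from dvd[OF this] have "pderiv p = 0"
      using dvd_imp_degree_le[of p "pderiv p"] pderiv_degree_less[of p] deg0 by fastforce
    interpret ac: field_emb "to_ac :: 'k \<Rightarrow> 'k alg_closure"
      by unfold_locales (rule field_embedding_to_ac)
    obtain z :: "'k alg_closure" where "poly (map_poly to_ac p) z = 0"
      using alg_closed_imp_poly_has_root[of "map_poly to_ac p"] deg0 by auto
    from rsquarefree_imp_pderiv_nonzero[OF rsq this] show False
      using \<open>pderiv p = 0\<close> ac.map_poly_pderiv[of p] by simp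
  qed
  then obtain y where y: "y \<in> set xs" "y \<noteq> x" by blast
  have py: "poly (map_poly \<phi> p) y = 0" unfolding split using split_list[OF y(1)] by auto
  \<comment> \<open>The graph of the map from k[x] to k[y] over k; it is well defined because
    \<open>p\<close> divides every relation of \<open>x\<close> and vanishes at
    \<open>y\<close>.\<close>
  define R where "R = {(poly (map_poly \<phi> g) x, poly (map_poly \<phi> g) y) | g. True}"
  have R: "pe R" unfolding partial_emb_def
  proof (intro conjI allI impI)
    show "(\<phi> a, \<phi> a) \<in> R" for a unfolding R_def by (auto intro!: exI[of _ "[:a:]"])
  next
    fix x1 y1 x2 y2 assume "(x1, y1) \<in> R" "(x2, y2) \<in> R"
    then obtain g h where *: "x1 = poly (map_poly \<phi> g) x" "y1 = poly (map_poly \<phi> g) y"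
      "x2 = poly (map_poly \<phi> h) x" "y2 = poly (map_poly \<phi> h) y" unfolding R_def by blast
    show "(x1 + x2, y1 + y2) \<in> R" unfolding R_def * by (auto intro!: exI[of _ "g + h"])
    show "(x1 * x2, y1 * y2) \<in> R" unfolding R_def * by (auto intro!: exI[of _ "g * h"])
  next
    fix z assume "(0, z) \<in> R"
    then obtain g where g: "poly (map_poly \<phi> g) x = 0" "z = poly (map_poly \<phi> g) y" unfolding R_def by auto
    from dvd[OF g(1)] obtain h where "g = p * h" by (rule dvdE)
    then show "z = 0" using g py by simp
  qed
  have "\<exists>p c xs. p \<noteq> 0 \<and> poly (map_poly \<phi> p) z = 0 \<and> map_poly \<phi> p = smult c (\<Prod>z\<leftarrow>xs. [:- z, 1:])" for z
  proof -
    obtain q where "irreducible q" "poly (map_poly \<phi> q) z = 0" using min[of z] by blast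
    then show ?thesis using normal unfolding normal_extension_def by (metis not_irreducible_zero)
  qed
  from pe_extend[OF R this] obtain f where f: "field_embedding f" "\<And>a. f (\<phi> a) = \<phi> a"
    and fR: "\<And>x y. (x, y) \<in> R \<Longrightarrow> f x = y" by metis
  have "(x, y) \<in> R" unfolding R_def by (auto intro!: exI[of _ "[:0, 1:]"])
  then have "f x = y" by (rule fR)
  moreover have "f \<in> carrier (galois_group \<phi>)"
    using f algebraic_endomorphism_bij[OF phi alg f] by (simp add: galois_group_def)
  ultimately show False using fixed y(2) by auto
qed

section \<open>Polynomials in several variables\<close>

definition mono_eval :: "('v \<Rightarrow> 'b::comm_semiring_1) \<Rightarrow> ('v \<Rightarrow>\<^sub>0 nat) \<Rightarrow> 'b" where
  "mono_eval x m = (\<Prod>i\<in>Poly_Mapping.keys m. x i ^ Poly_Mapping.lookup m i)"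

lemma mono_eval_superset:
  "finite A \<Longrightarrow> Poly_Mapping.keys m \<subseteq> A \<Longrightarrow> mono_eval x m = (\<Prod>i\<in>A. x i ^ Poly_Mapping.lookup m i)"
  unfolding mono_eval_def by (rule prod.mono_neutral_left) (auto simp: in_keys_iff)

lemma mono_eval_add: "mono_eval x (m + m') = mono_eval x m * mono_eval x m'"
proof -
  define A where "A = Poly_Mapping.keys m \<union> Poly_Mapping.keys m'"
  have "finite A" "Poly_Mapping.keys m \<subseteq> A" "Poly_Mapping.keys m' \<subseteq> A" "Poly_Mapping.keys (m + m') \<subseteq> A"
    using Poly_Mapping.keys_add[of m m'] by (auto simp: A_def)
  then show ?thesis
    by (simp add: mono_eval_superset[of A] lookup_add power_add prod.distrib)
qed

lemma mono_eval_single [simp]: "mono_eval x (Poly_Mapping.single i n) = x i ^ n"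
  by (simp add: mono_eval_superset[of "{i}"])

lemma mono_eval_0 [simp]: "mono_eval x 0 = 1"
  by (simp add: mono_eval_def)

definition mono_degree :: "('v \<Rightarrow>\<^sub>0 nat) \<Rightarrow> nat" where
  "mono_degree m = (\<Sum>i\<in>Poly_Mapping.keys m. Poly_Mapping.lookup m i)"

lemma mono_degree_superset:
  "finite A \<Longrightarrow> Poly_Mapping.keys m \<subseteq> A \<Longrightarrow> mono_degree m = (\<Sum>i\<in>A. Poly_Mapping.lookup m i)"
  unfolding mono_degree_def by (rule sum.mono_neutral_left) (auto simp: in_keys_iff)

lemma mono_degree_add: "mono_degree (m + m') = mono_degree m + mono_degree m'"
proof -
  define A where "A = Poly_Mapping.keys m \<union> Poly_Mapping.keys m'"
  have "finite A" "Poly_Mapping.keys m \<subseteq> A" "Poly_Mapping.keys m' \<subseteq> A" "Poly_Mapping.keys (m + m') \<subseteq> A"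
    using Poly_Mapping.keys_add[of m m'] by (auto simp: A_def)
  then show ?thesis
    by (simp add: mono_degree_superset[of A] lookup_add sum.distrib)
qed

lemma mono_degree_single [simp]: "mono_degree (Poly_Mapping.single i n) = n"
  by (simp add: mono_degree_superset[of "{i}"])

lemma sum_single_lookup:
  assumes "finite A" "Poly_Mapping.keys P \<subseteq> A"
  shows "(\<Sum>m\<in>A. Poly_Mapping.single m (Poly_Mapping.lookup P m)) = P"
proof (rule poly_mapping_eqI)
  fix k
  have "Poly_Mapping.lookup (\<Sum>m\<in>A. Poly_Mapping.single m (Poly_Mapping.lookup P m)) k
      = (\<Sum>m\<in>A. if m = k then Poly_Mapping.lookup P k else 0)"
    unfolding lookup_sum by (intro sum.cong) (auto simp: lookup_single when_def)
  also have "\<dots> = Poly_Mapping.lookup P k"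
    using assms by (auto simp: in_keys_iff)
  finally show "Poly_Mapping.lookup (\<Sum>m\<in>A. Poly_Mapping.single m (Poly_Mapping.lookup P m)) k
      = Poly_Mapping.lookup P k" .
qed

text \<open>Reduces multiplicativity of evaluation and the product rule to single terms, whose
  products are explicit.\<close>

lemma mp_induct [case_names single add]:
  assumes "\<And>m c. Q (Poly_Mapping.single m c)" "\<And>P P'. Q P \<Longrightarrow> Q P' \<Longrightarrow> Q (P + P')"
  shows "Q (P :: ('v, 'a::comm_monoid_add) mpoly)"
proof -
  have "Q (\<Sum>m\<in>A. Poly_Mapping.single m (Poly_Mapping.lookup P m))" if "finite A" for A
    using that
  proof induction
    case empty
    then show ?case using assms(1)[of 0 0] by simp
  qed (auto intro: assms)
  from this[of "Poly_Mapping.keys P"] show ?thesis by (simp add: sum_single_lookup)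
qed

abbreviation mp_var :: "'v \<Rightarrow> ('v, 'a::zero_neq_one) mpoly" where
  "mp_var i \<equiv> Poly_Mapping.single (Poly_Mapping.single i 1) 1"

abbreviation mp_const :: "'a::zero \<Rightarrow> ('v, 'a) mpoly" where
  "mp_const c \<equiv> Poly_Mapping.single 0 c"

context field_emb
begin

lemma mp_eval_superset:
  "finite A \<Longrightarrow> Poly_Mapping.keys P \<subseteq> A \<Longrightarrow>
    mp_eval e P x = (\<Sum>m\<in>A. e (Poly_Mapping.lookup P m) * mono_eval x m)"
  unfolding mp_eval_def mono_eval_def[symmetric]
  by (rule sum.mono_neutral_left) (auto simp: in_keys_iff)

lemma mp_eval_add [simp]: "mp_eval e (P + Q) x = mp_eval e P x + mp_eval e Q x"
proof -
  define A where "A = Poly_Mapping.keys P \<union> Poly_Mapping.keys Q"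
  have "finite A" "Poly_Mapping.keys P \<subseteq> A" "Poly_Mapping.keys Q \<subseteq> A" "Poly_Mapping.keys (P + Q) \<subseteq> A"
    using Poly_Mapping.keys_add[of P Q] by (auto simp: A_def)
  then show ?thesis
    by (simp add: mp_eval_superset[of A] lookup_add sum.distrib algebra_simps)
qed

lemma mp_eval_zero [simp]: "mp_eval e 0 x = 0"
  by (simp add: mp_eval_def)

lemma mp_eval_single: "mp_eval e (Poly_Mapping.single m c) x = e c * mono_eval x m"
  by (simp add: mp_eval_superset[of "{m}"])

lemma mp_eval_var [simp]: "mp_eval e (mp_var i) x = x i"
  by (simp add: mp_eval_single)

lemma mp_eval_const [simp]: "mp_eval e (mp_const c) x = e c"
  by (simp add: mp_eval_single)

lemma mp_eval_mult [simp]: "mp_eval e (P * Q) x = mp_eval e P x * mp_eval e Q x"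
proof (induction P rule: mp_induct)
  case (single m c)
  show ?case
    by (induction Q rule: mp_induct)
      (auto simp: mult_single mp_eval_single mono_eval_add algebra_simps)
qed (auto simp: algebra_simps)

lemma mp_eval_uminus [simp]: "mp_eval e (- P) x = - mp_eval e P x"
  using mp_eval_add[of P "- P" x] by (simp add: eq_neg_iff_add_eq_0 add.commute)

lemma mp_eval_diff [simp]: "mp_eval e (P - Q) x = mp_eval e P x - mp_eval e Q x"
  using mp_eval_add[of P "- Q" x] by simp

end

section \<open>Partial derivatives and the product rule\<close>

definition mp_deriv_single :: "'v \<Rightarrow> ('v \<Rightarrow>\<^sub>0 nat) \<Rightarrow> 'a \<Rightarrow> ('v, 'a::comm_semiring_1) mpoly" where
  "mp_deriv_single i m c = Poly_Mapping.single (m - Poly_Mapping.single i 1) (of_nat (Poly_Mapping.lookup m i) * c)"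

lemma mp_deriv_superset:
  assumes "finite A" "Poly_Mapping.keys P \<subseteq> A"
  shows "mp_deriv i P = (\<Sum>m\<in>A. mp_deriv_single i m (Poly_Mapping.lookup P m))"
  unfolding mp_deriv_def mp_deriv_single_def
  by (rule sum.mono_neutral_left) (use assms in \<open>auto simp: in_keys_iff\<close>)

lemma mp_deriv_single: "mp_deriv i (Poly_Mapping.single m c) = mp_deriv_single i m c"
  by (simp add: mp_deriv_superset[of "{m}"])

lemma mp_deriv_add [simp]: "mp_deriv i (P + Q) = mp_deriv i P + mp_deriv i Q"
proof -
  define A where "A = Poly_Mapping.keys P \<union> Poly_Mapping.keys Q"
  have "finite A" "Poly_Mapping.keys P \<subseteq> A" "Poly_Mapping.keys Q \<subseteq> A" "Poly_Mapping.keys (P + Q) \<subseteq> A"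
    using Poly_Mapping.keys_add[of P Q] by (auto simp: A_def)
  then show ?thesis
    by (simp add: mp_deriv_superset[of A] lookup_add mp_deriv_single_def single_add algebra_simps flip: sum.distrib)
qed

lemma mp_deriv_uminus [simp]: "mp_deriv i (- P) = - mp_deriv i (P :: ('v, 'a::comm_ring_1) mpoly)"
  using mp_deriv_add[of i P "- P"] by (simp add: eq_neg_iff_add_eq_0 add.commute mp_deriv_def)

lemma mp_deriv_diff [simp]: "mp_deriv i (P - Q) = mp_deriv i P - mp_deriv i (Q :: ('v, 'a::comm_ring_1) mpoly)"
  using mp_deriv_add[of i P "- Q"] by simp

lemma mp_deriv_mult_single:
  "mp_deriv i (Poly_Mapping.single m a * Poly_Mapping.single n b) =
    mp_deriv i (Poly_Mapping.single m a) * Poly_Mapping.single n b +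
    Poly_Mapping.single m a * mp_deriv i (Poly_Mapping.single n (b :: 'a::comm_semiring_1))"
proof -
  let ?s = "Poly_Mapping.single i (1::nat)"
  \<comment> \<open>Truncated subtraction of exponents commutes with addition only if the variable
    occurs; if it does not, the coefficient \<open>of_nat 0\<close> removes the term.\<close>
  have shift: "m + n - ?s = (m - ?s) + n" if "Poly_Mapping.lookup m i \<noteq> 0" for m n :: "'b \<Rightarrow>\<^sub>0 nat"
    using that by (intro poly_mapping_eqI) (auto simp: lookup_add lookup_minus lookup_single when_def)
  have "Poly_Mapping.single (m + n - ?s) (of_nat (Poly_Mapping.lookup m i) * (a * b)) =
      Poly_Mapping.single (m - ?s + n) (of_nat (Poly_Mapping.lookup m i) * (a * b))"
    using shift[of m n] by (cases "Poly_Mapping.lookup m i = 0") auto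
  moreover have "Poly_Mapping.single (m + n - ?s) (of_nat (Poly_Mapping.lookup n i) * (a * b)) =
      Poly_Mapping.single (m + (n - ?s)) (of_nat (Poly_Mapping.lookup n i) * (a * b))"
    using shift[of n m] by (cases "Poly_Mapping.lookup n i = 0") (auto simp: add.commute)
  ultimately show ?thesis
    by (simp add: mult_single mp_deriv_single mp_deriv_single_def lookup_add single_add algebra_simps)
qed

lemma mp_deriv_mult [simp]:
  "mp_deriv i (P * Q) = mp_deriv i P * Q + P * mp_deriv i (Q :: ('v, 'a::comm_semiring_1) mpoly)"
proof (induction P rule: mp_induct)
  case (single m c)
  show ?case
    by (induction Q rule: mp_induct) (auto simp: mp_deriv_mult_single algebra_simps)
qed (auto simp: algebra_simps)

lemma mp_deriv_const [simp]: "mp_deriv i (mp_const c) = 0"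
  by (simp add: mp_deriv_single mp_deriv_single_def)

lemma mp_deriv_var [simp]: "mp_deriv i (mp_var j) = (if i = j then 1 else 0)"
  by (simp add: mp_deriv_single mp_deriv_single_def lookup_single)

lemma (in field_emb) mp_eval_numeral [simp]: "mp_eval e (numeral n) x = numeral n"
  using mp_eval_const[of "numeral n" x] by (simp del: mp_eval_const)

lemma (in field_emb) mp_eval_1 [simp]: "mp_eval e 1 x = 1"
  using mp_eval_const[of 1 x] by (simp del: mp_eval_const)

lemma mp_deriv_numeral [simp]: "mp_deriv i (numeral n :: ('v, 'a::comm_ring_1) mpoly) = 0"
  using mp_deriv_const[of i "numeral n :: 'a"] by (simp del: mp_deriv_const)

lemma (in field_emb) mp_eval_power [simp]: "mp_eval e (P ^ n) x = mp_eval e P x ^ n"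
  by (induction n) auto

section \<open>Degrees and occurring variables of forms\<close>

lemma mp_homogeneous_altdef: "mp_homogeneous d P \<longleftrightarrow> (\<forall>m\<in>Poly_Mapping.keys P. mono_degree m = d)"
  by (simp add: mp_homogeneous_def mono_degree_def)

lemma mp_homogeneous_single: "mono_degree m = d \<Longrightarrow> mp_homogeneous d (Poly_Mapping.single m c)"
  by (simp add: mp_homogeneous_altdef)

lemma mp_homogeneous_add: "mp_homogeneous d P \<Longrightarrow> mp_homogeneous d Q \<Longrightarrow> mp_homogeneous d (P + Q)"
  using Poly_Mapping.keys_add[of P Q] by (auto simp: mp_homogeneous_altdef)

lemma keys_diff_subset:
  "Poly_Mapping.keys (P - Q) \<subseteq> Poly_Mapping.keys P \<union> Poly_Mapping.keys (Q :: 'v \<Rightarrow>\<^sub>0 'a::ab_group_add)"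
  by (auto simp: in_keys_iff lookup_minus)

lemma mp_homogeneous_diff:
  "mp_homogeneous d P \<Longrightarrow> mp_homogeneous d Q \<Longrightarrow> mp_homogeneous d (P - (Q :: ('v, 'a::ab_group_add) mpoly))"
  using keys_diff_subset[of P Q] by (auto simp: mp_homogeneous_altdef)

lemma mp_homogeneous_mult:
  "mp_homogeneous d P \<Longrightarrow> mp_homogeneous d' Q \<Longrightarrow> mp_homogeneous (d + d') (P * (Q :: ('v, 'a::comm_semiring_1) mpoly))"
  using Poly_Mapping.keys_mult[of P Q] by (auto simp: mp_homogeneous_altdef mono_degree_add)

lemma mp_homogeneous_var: "mp_homogeneous 1 (mp_var i)"
  by (rule mp_homogeneous_single) simp

lemma mp_homogeneous_const: "mp_homogeneous 0 (mp_const c)"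
  by (rule mp_homogeneous_single) (simp add: mono_degree_def)

lemma mp_homogeneous_uminus: "mp_homogeneous n P \<Longrightarrow> mp_homogeneous n (- (P :: ('v, 'a::ab_group_add) mpoly))"
  by (simp add: mp_homogeneous_altdef in_keys_iff)

lemma mp_homogeneous_numeral: "mp_homogeneous 0 (numeral n :: ('v, 'a::comm_semiring_1) mpoly)"
  using mp_homogeneous_const[of "numeral n :: 'a"] by simp

text \<open>The degree is a variable with a separate equation, so that the rule applies backwards to
  goals with a numeral as degree.\<close>

lemma mp_homogeneous_mult':
  "mp_homogeneous a P \<Longrightarrow> mp_homogeneous b Q \<Longrightarrow> a + b = n \<Longrightarrow>
    mp_homogeneous n (P * (Q :: ('v, 'a::comm_semiring_1) mpoly))"
  using mp_homogeneous_mult by blast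

lemma mp_homogeneous_power:
  assumes "mp_homogeneous a P"
  shows "mp_homogeneous (k * a) ((P :: ('v, 'a::comm_semiring_1) mpoly) ^ k)"
proof (induction k)
  case 0
  show ?case using mp_homogeneous_const[of "1 :: 'a"] by simp
next
  case (Suc k)
  show ?case using mp_homogeneous_mult[OF assms Suc] by simp
qed

lemma mp_homogeneous_power': "mp_homogeneous a P \<Longrightarrow> k * a = n \<Longrightarrow>
    mp_homogeneous n ((P :: ('v, 'a::comm_semiring_1) mpoly) ^ k)"
  using mp_homogeneous_power by blast

lemma mp_vars_add: "mp_vars P \<subseteq> A \<Longrightarrow> mp_vars Q \<subseteq> A \<Longrightarrow> mp_vars (P + Q) \<subseteq> A"
  unfolding mp_vars_def using Poly_Mapping.keys_add[of P Q] by blast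

lemma mp_vars_diff:
  "mp_vars P \<subseteq> A \<Longrightarrow> mp_vars Q \<subseteq> A \<Longrightarrow> mp_vars (P - (Q :: ('v, 'a::ab_group_add) mpoly)) \<subseteq> A"
  unfolding mp_vars_def using keys_diff_subset[of P Q] by blast

lemma mp_vars_mult:
  assumes "mp_vars P \<subseteq> A" "mp_vars Q \<subseteq> A"
  shows "mp_vars (P * (Q :: ('v, 'a::comm_semiring_1) mpoly)) \<subseteq> A"
  unfolding mp_vars_def
proof (rule UN_least)
  fix m assume "m \<in> Poly_Mapping.keys (P * Q)"
  then obtain a b where "m = a + b" "a \<in> Poly_Mapping.keys P" "b \<in> Poly_Mapping.keys Q"
    using Poly_Mapping.keys_mult[of P Q] by blast
  then show "Poly_Mapping.keys m \<subseteq> A"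
    using assms Poly_Mapping.keys_add[of a b] unfolding mp_vars_def by blast
qed

lemma mp_vars_var: "i \<in> A \<Longrightarrow> mp_vars (mp_var i) \<subseteq> A"
  by (auto simp: mp_vars_def)

lemma mp_vars_const: "mp_vars (mp_const c) \<subseteq> A"
  by (auto simp: mp_vars_def)

lemma mp_vars_power: "mp_vars P \<subseteq> A \<Longrightarrow> mp_vars ((P :: ('v, 'a::comm_semiring_1) mpoly) ^ k) \<subseteq> A"
proof (induction k)
  case 0
  show ?case using mp_vars_const[of "1 :: 'a" A] by simp
next
  case (Suc k)
  then show ?case unfolding power_Suc by (intro mp_vars_mult) auto
qed

lemma mp_vars_uminus: "mp_vars P \<subseteq> A \<Longrightarrow> mp_vars (- (P :: ('v, 'a::ab_group_add) mpoly)) \<subseteq> A"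
  by (simp add: mp_vars_def in_keys_iff Poly_Mapping.keys.rep_eq)

lemma mp_vars_numeral: "mp_vars (numeral n :: ('v, 'a::comm_semiring_1) mpoly) \<subseteq> A"
  using mp_vars_const[of "numeral n :: 'a" A] by simp

lemma mp_eval_on_line:
  obtains p where "\<And>l. poly p l = mp_eval id H (\<lambda>i. x i + l * y i)"
proof
  show "poly (\<Sum>m\<in>Poly_Mapping.keys H. smult (Poly_Mapping.lookup H m)
      (\<Prod>i\<in>Poly_Mapping.keys m. [:x i, y i:] ^ Poly_Mapping.lookup m i)) l
    = mp_eval id H (\<lambda>i. x i + l * y i)" for l
    by (simp add: mp_eval_def poly_sum poly_prod)
qed

text \<open>Restricted to a line the polynomial has one variable, hence finitely many zeros unless
  it vanishes. This serves as the density argument for dominance.\<close>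

lemma mp_eval_eq_0_on_line:
  fixes H :: "('v, 'a::idom) mpoly"
  assumes "infinite (UNIV :: 'a set)" "finite N" "\<And>l. l \<notin> N \<Longrightarrow> mp_eval id H (\<lambda>i. x i + l * y i) = 0"
  shows "mp_eval id H (\<lambda>i. x i + l * y i) = 0"
proof -
  obtain p where p: "\<And>l. poly p l = mp_eval id H (\<lambda>i. x i + l * y i)"
    using mp_eval_on_line by blast
  have "- N \<subseteq> {l. poly p l = 0}" using assms(3) by (auto simp: p)
  moreover have "infinite (- N)" using assms(1,2) by (simp add: Compl_eq_Diff_UNIV)
  ultimately have "p = 0" using poly_roots_finite finite_subset by blast
  then show ?thesis using p[of l] by simp
qed

lemma mp_eval_homogeneous:
  fixes H :: "('v, 'a::comm_semiring_1) mpoly"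
  assumes "mp_homogeneous d H"
  shows "mp_eval id H (\<lambda>i. c * x i) = c ^ d * mp_eval id H x"
proof -
  have "(\<Prod>i\<in>Poly_Mapping.keys m. (c * x i) ^ Poly_Mapping.lookup m i) =
     c ^ d * (\<Prod>i\<in>Poly_Mapping.keys m. x i ^ Poly_Mapping.lookup m i)" if "m \<in> Poly_Mapping.keys H" for m
    using assms that by (auto simp: mp_homogeneous_def power_mult_distrib prod.distrib power_sum)
  then show ?thesis by (simp add: mp_eval_def sum_distrib_left mult.left_commute)
qed

section \<open>Lines in projective 3-space\<close>

definition vec4 :: "'a \<Rightarrow> 'a \<Rightarrow> 'a \<Rightarrow> 'a \<Rightarrow> 'a ^ 4" where
  "vec4 a b c d = (\<chi> i. if i = 1 then a else if i = 2 then b else if i = 3 then c else d)"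

lemma vec4_nth [simp]:
  "vec4 a b c d $ 1 = a" "vec4 a b c d $ 2 = b" "vec4 a b c d $ 3 = c" "vec4 a b c d $ 4 = d"
  by (simp_all add: vec4_def)

lemma vec4_eq_iff: "x = y \<longleftrightarrow> x $ 1 = y $ 1 \<and> x $ 2 = y $ 2 \<and> x $ 3 = y $ 3 \<and> x $ 4 = y $ (4::4)"
  by (simp add: vec_eq_iff forall_4)

text \<open>Every line is a graph over two of the four coordinates; the vectors \<open>u\<close> and \<open>w\<close> will
  be normalized to have the unit vectors as their \<open>i\<close>-th and \<open>j\<close>-th coordinates.\<close>

definition graph_line :: "4 \<Rightarrow> 4 \<Rightarrow> 'a::field ^ 4 \<Rightarrow> 'a ^ 4 \<Rightarrow> ('a ^ 4) set" where
  "graph_line i j u w = {x. x = x $ i *s u + x $ j *s w}"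

definition normalized :: "4 \<Rightarrow> 4 \<Rightarrow> 'a::field ^ 4 \<Rightarrow> 'a ^ 4 \<Rightarrow> bool" where
  "normalized i j u w \<longleftrightarrow> u $ i = 1 \<and> u $ j = 0 \<and> w $ i = 0 \<and> w $ j = 1"

lemma graph_line_mem:
  assumes "normalized i j u w"
  shows "u \<in> graph_line i j u w" "w \<in> graph_line i j u w"
  using assms by (auto simp: normalized_def graph_line_def)

lemma graph_line_eq_span:
  assumes "normalized i j u w"
  shows "graph_line i j u w = vec.span {u, w}"
proof -
  have "x \<in> graph_line i j u w" if "x = p *s u + q *s w" for x p q
  proof -
    have "x $ i = p" "x $ j = q" using assms that by (auto simp: normalized_def)
    then show ?thesis using that by (simp add: graph_line_def)
  qed
  moreover have "\<exists>p q. x = p *s u + q *s w" if "x \<in> graph_line i j u w" for x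
    using that unfolding graph_line_def by blast
  moreover have "x \<in> vec.span {u, w} \<longleftrightarrow> (\<exists>p q. x = p *s u + q *s w)" for x
    by (auto simp: vec.span_insert vec.span_singleton algebra_simps)
  ultimately show ?thesis by blast
qed

lemma graph_line_subspace: "normalized i j u w \<Longrightarrow> vec.subspace (graph_line i j u w)"
  by (simp add: graph_line_eq_span vec.subspace_span)

lemma graph_line_dim:
  assumes "normalized i j u w"
  shows "vec.dim (graph_line i j u w) = 2"
proof -
  have "u \<notin> vec.span {w}" "w \<noteq> 0"
    using assms by (auto simp: normalized_def vec.span_singleton)
  then have "vec.independent {u, w}" "u \<noteq> w"
    by (auto simp: vec.independent_insert vec.span_base)
  then have "vec.dim {u, w} = 2" by (simp add: vec.dim_eq_card_independent)
  then show ?thesis unfolding graph_line_eq_span[OF assms] by simp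
qed

lemma graph_line_eqI:
  assumes "normalized i j u w" "vec.subspace M" "vec.dim M = 2" "u \<in> M" "w \<in> M"
  shows "M = graph_line i j u w"
proof -
  have "graph_line i j u w \<subseteq> M"
    unfolding graph_line_eq_span[OF assms(1)] using assms by (intro vec.span_minimal) auto
  moreover have "vec.dim M \<le> vec.dim (graph_line i j u w)"
    using graph_line_dim[OF assms(1)] assms(3) by linarith
  ultimately have "graph_line i j u w = M"
    by (intro vec.subspace_dim_equal graph_line_subspace assms(1,2))
  then show ?thesis ..
qed

lemma subspace_inter_nontrivial:
  assumes "vec.subspace L" "vec.subspace M"
  shows "L \<inter> M \<noteq> {0} \<longleftrightarrow> (\<exists>x. x \<noteq> 0 \<and> x \<in> L \<and> x \<in> M)"
  using vec.subspace_0[OF assms(1)] vec.subspace_0[OF assms(2)] by blast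

section \<open>The cubic surfaces\<close>

definition cubic :: "'a::field \<Rightarrow> 'a \<Rightarrow> 'a \<Rightarrow> 'a \<Rightarrow> 'a \<Rightarrow> 'a ^ 4 \<Rightarrow> 'a" where
  "cubic d f1 f2 f3 f4 x = x $ 4 * x $ 1 * x $ 1 - x $ 3 * x $ 2 * x $ 2
     + 2 * d * x $ 3 * x $ 3 * x $ 1 + 2 * x $ 4 * x $ 4 * x $ 2
     + f4 * x $ 4 * x $ 4 * x $ 4 + f3 * x $ 4 * x $ 4 * x $ 3 + f2 * x $ 4 * x $ 3 * x $ 3 + f1 * x $ 3 * x $ 3 * x $ 3"

definition cubic_poly :: "'a::field \<Rightarrow> 'a \<Rightarrow> 'a \<Rightarrow> 'a \<Rightarrow> 'a \<Rightarrow> (4, 'a) mpoly" where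
  "cubic_poly d f1 f2 f3 f4 =
     mp_var 4 * mp_var 1 * mp_var 1 - mp_var 3 * mp_var 2 * mp_var 2
     + mp_const (2 * d) * mp_var 3 * mp_var 3 * mp_var 1 + mp_const 2 * mp_var 4 * mp_var 4 * mp_var 2
     + mp_const f4 * mp_var 4 * mp_var 4 * mp_var 4 + mp_const f3 * mp_var 4 * mp_var 4 * mp_var 3
     + mp_const f2 * mp_var 4 * mp_var 3 * mp_var 3 + mp_const f1 * mp_var 3 * mp_var 3 * mp_var 3"

lemma (in field_emb) mp_eval_cubic_poly:
  "mp_eval e (cubic_poly d f1 f2 f3 f4) (($) x) = cubic (e d) (e f1) (e f2) (e f3) (e f4) x"
  by (simp add: cubic_poly_def cubic_def del: One_nat_def)

lemma mp_homogeneous_cubic_poly: "mp_homogeneous 3 (cubic_poly d f1 f2 f3 f4)"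
proof -
  have 3: "mp_homogeneous 3 (P * Q * R)" if "mp_homogeneous 1 P" "mp_homogeneous 1 Q" "mp_homogeneous 1 R"
    for P Q R :: "(4, 'a) mpoly"
    using mp_homogeneous_mult[OF mp_homogeneous_mult[OF that(1,2)] that(3)] by (simp add: numeral_3_eq_3)
  have 4: "mp_homogeneous 3 (mp_const c * P * Q * R)" if "mp_homogeneous 1 P" "mp_homogeneous 1 Q" "mp_homogeneous 1 R"
    for c and P Q R :: "(4, 'a) mpoly"
    using mp_homogeneous_mult[OF mp_homogeneous_const 3[OF that]] by (simp add: mult.assoc)
  show ?thesis unfolding cubic_poly_def
    by (intro mp_homogeneous_add mp_homogeneous_diff 3 4 mp_homogeneous_var)
qed

text \<open>The pure powers \<open>d^2 s^5\<close> and \<open>t^5\<close> from the two squares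
  cancel against the extreme terms of the quintic, and every other term contains \<open>s t\<close>.
  This is what forces the constant coefficient to be \<open>- d^2\<close>.\<close>

lemma cubic_identity:
  "x $ 3 * x $ 4 * cubic d f1 f2 f3 f4 x =
     x $ 3 * (x $ 4 * x $ 1 + d * (x $ 3)\<^sup>2)\<^sup>2 - x $ 4 * (x $ 3 * x $ 2 - (x $ 4)\<^sup>2)\<^sup>2
     + ((x $ 4)^5 + f4 * (x $ 4)^4 * x $ 3 + f3 * (x $ 4)^3 * (x $ 3)^2 + f2 * (x $ 4)^2 * (x $ 3)^3
        + f1 * x $ 4 * (x $ 3)^4 - d\<^sup>2 * (x $ 3)^5)"
  by (simp add: cubic_def algebra_simps power_numeral_reduce)

text \<open>\<open>B\<close> holds the square roots of the roots of the quintic \<open>f\<close>, so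
  the polynomial is \<open>f(T^2)\<close>, of degree ten. As a product over a set it has only simple
  roots, which is the smoothness condition.\<close>

locale cubic_data =
  fixes d f1 f2 f3 f4 :: "'a::field" and B :: "'a set"
  assumes two: "(2::'a) \<noteq> 0" and d: "d \<noteq> 0" and finB: "finite B"
    and quintic: "[:- d\<^sup>2, 0, f1, 0, f2, 0, f3, 0, f4, 0, 1:] = (\<Prod>b\<in>B. [:- b, 1:])"
begin

abbreviation "cub \<equiv> cubic d f1 f2 f3 f4"

lemma quintic_eval: "t^10 + f4 * t^8 + f3 * t^6 + f2 * t^4 + f1 * t^2 - d\<^sup>2 = (\<Prod>b\<in>B. t - b)"
proof -
  have "(\<Prod>b\<in>B. t - b) = poly [:- d\<^sup>2, 0, f1, 0, f2, 0, f3, 0, f4, 0, 1:] t"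
    unfolding quintic by (simp add: poly_prod)
  then show ?thesis by (simp add: algebra_simps power_numeral_reduce)
qed

lemma mem_B: "b \<in> B \<longleftrightarrow> b^10 + f4 * b^8 + f3 * b^6 + f2 * b^4 + f1 * b^2 - d\<^sup>2 = 0"
  unfolding quintic_eval using finB by simp

lemma B_nonzero: "b \<in> B \<Longrightarrow> b \<noteq> 0"
  using d by (auto simp: mem_B)

text \<open>The expression is \<open>f'(b^2)\<close>: the derivative of \<open>f(T^2)\<close> is
  \<open>2 T f'(T^2)\<close>, and it is nonzero at the simple root \<open>b\<close>.\<close>

lemma B_simple: "b \<in> B \<Longrightarrow> 5 * b^8 + 4 * f4 * b^6 + 3 * f3 * b^4 + 2 * f2 * b^2 + f1 \<noteq> 0"
proof
  assume b: "b \<in> B" and 0: "5 * b^8 + 4 * f4 * b^6 + 3 * f3 * b^4 + 2 * f2 * b^2 + f1 = 0"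
  define r where "r = (\<Prod>c\<in>B - {b}. [:- c, 1:])"
  have "[:- d\<^sup>2, 0, f1, 0, f2, 0, f3, 0, f4, 0, 1:] = [:- b, 1:] * r"
    unfolding quintic r_def using b finB by (simp add: prod.remove[of B b])
  then have "poly (pderiv [:- d\<^sup>2, 0, f1, 0, f2, 0, f3, 0, f4, 0, 1:]) b = poly (pderiv ([:- b, 1:] * r)) b"
    by simp
  also have "\<dots> = poly r b"
    unfolding pderiv_mult by (simp add: pderiv_pCons)
  finally have "poly r b = poly (pderiv [:- d\<^sup>2, 0, f1, 0, f2, 0, f3, 0, f4, 0, 1:]) b" ..
  also have "\<dots> = 2 * b * (5 * b^8 + 4 * f4 * b^6 + 3 * f3 * b^4 + 2 * f2 * b^2 + f1)"
    by (simp add: pderiv_pCons algebra_simps power_numeral_reduce)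
  finally have "poly r b = 0" using 0 by simp
  then show False using finB by (simp add: r_def poly_prod)
qed

end

section \<open>The three families of lines and their incidence\<close>

definition line0 :: "('a::field ^ 4) set" where
  "line0 = graph_line 1 2 (vec4 1 0 0 0) (vec4 0 1 0 0)"

text \<open>In the plane \<open>t = b^2 s\<close> the equation \<open>U = b W\<close>, where
  \<open>U = t X + d s^2\<close> and \<open>W = s Y - t^2\<close>, becomes
  \<open>Y = b X + (d / b + b^4) s\<close> after division by \<open>b s\<close>.\<close>

definition conic_line :: "'a::field \<Rightarrow> 'a \<Rightarrow> ('a ^ 4) set" where
  "conic_line d b = graph_line 1 3 (vec4 1 b 0 0) (vec4 0 (d / b + b ^ 4) 1 (b\<^sup>2))"

text \<open>Let \<open>p\<close> be a monic quintic with \<open>p(0) = d\<close>. For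
  \<open>s = 1\<close> and \<open>t = T^2\<close>, these points have the even part of
  \<open>p\<close> as \<open>U\<close> and its odd part as \<open>- T W\<close>. So
  \<open>U - T W = p(T)\<close>, \<open>U + T W = p(- T)\<close>, and \<open>U^2 - T^2 W^2\<close>
  is their product.\<close>

definition section_line :: "'a::field poly \<Rightarrow> ('a ^ 4) set" where
  "section_line p = graph_line 3 4 (vec4 (poly.coeff p 2) (- poly.coeff p 1) 1 0)
     (vec4 (poly.coeff p 4) (- poly.coeff p 3) 0 1)"

lemma normalized_lines:
  "normalized 1 2 (vec4 1 0 0 0) (vec4 0 1 0 0)"
  "normalized 1 3 (vec4 1 b 0 0) (vec4 0 c 1 a)"
  "normalized 3 4 (vec4 a b 1 0) (vec4 c e 0 1)"
  by (simp_all add: normalized_def)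

lemma mem_line0: "x \<in> line0 \<longleftrightarrow> x $ 3 = 0 \<and> x $ 4 = 0"
  by (auto simp: line0_def graph_line_def vec4_eq_iff)

lemma mem_conic_line:
  "x \<in> conic_line d b \<longleftrightarrow> x $ 2 = b * x $ 1 + (d / b + b ^ 4) * x $ 3 \<and> x $ 4 = b\<^sup>2 * x $ 3"
  by (auto simp: conic_line_def graph_line_def vec4_eq_iff mult.commute)

lemma mem_section_line:
  "x \<in> section_line p \<longleftrightarrow> x $ 1 = poly.coeff p 2 * x $ 3 + poly.coeff p 4 * x $ 4 \<and>
     x $ 2 = - poly.coeff p 1 * x $ 3 - poly.coeff p 3 * x $ 4"
  by (auto simp: section_line_def graph_line_def vec4_eq_iff mult.commute)

lemma line_subspace [simp]:
  "vec.subspace line0" "vec.subspace (conic_line d b)" "vec.subspace (section_line p)"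
  by (simp_all only: line0_def conic_line_def section_line_def graph_line_subspace normalized_lines)

lemma line_dim [simp]:
  "vec.dim line0 = 2" "vec.dim (conic_line d b) = 2" "vec.dim (section_line p) = 2"
  by (simp_all only: line0_def conic_line_def section_line_def graph_line_dim normalized_lines)

lemma line0_inter_conic_line: "line0 \<inter> conic_line d b \<noteq> {0}"
proof -
  have "vec4 1 b 0 0 \<in> line0 \<inter> conic_line d b" by (simp add: mem_line0 mem_conic_line)
  moreover have "vec4 1 b 0 0 \<noteq> 0" by (simp add: vec4_eq_iff)
  ultimately show ?thesis by blast
qed

lemma line0_inter_section_line: "line0 \<inter> section_line p = {0}"
  by (auto simp: mem_line0 mem_section_line vec4_eq_iff)

lemma conic_lines_disjoint: "b\<^sup>2 \<noteq> c\<^sup>2 \<Longrightarrow> b \<noteq> c \<Longrightarrow> conic_line d b \<inter> conic_line d c = {0}"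
  by (auto simp: mem_conic_line vec4_eq_iff)

lemma conic_lines_partner:
  assumes "b \<noteq> 0"
  shows "conic_line d b \<inter> conic_line d (- b) \<noteq> {0}"
proof -
  have "vec4 (- d / b\<^sup>2) (b ^ 4) 1 (b\<^sup>2) \<in> conic_line d b \<inter> conic_line d (- b)"
    using assms by (simp add: mem_conic_line power2_eq_square)
  moreover have "vec4 (- d / b\<^sup>2) (b ^ 4) 1 (b\<^sup>2) \<noteq> 0" by (simp add: vec4_eq_iff)
  ultimately show ?thesis by blast
qed

lemma conic_line_inj: "conic_line d b = conic_line d c \<Longrightarrow> b = c"
  using mem_conic_line[of "vec4 1 b 0 0" d b] mem_conic_line[of "vec4 1 b 0 0" d c] by simp

lemma conic_line_ne_line0: "conic_line d b \<noteq> line0"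
  using mem_conic_line[of "vec4 0 (d / b + b ^ 4) 1 (b\<^sup>2)" d b] mem_line0[of "vec4 0 (d / b + b ^ 4) 1 (b\<^sup>2)"]
  by auto

text \<open>For \<open>t = b^2 s\<close> the section line has \<open>U - b W = s^2 p(b)\<close>,
  while the conic line is given by \<open>U = b W\<close>.\<close>

lemma conic_line_inter_section_line:
  assumes "b \<noteq> 0" "p = [:d, c1, c2, c3, c4, 1:]"
  shows "conic_line d b \<inter> section_line p \<noteq> {0} \<longleftrightarrow> poly p b = 0"
proof -
  \<comment> \<open>\<open>k\<close> replaces the fraction, so that \<open>key\<close> is a
    polynomial identity.\<close>
  define k where "k = d / b"
  have dk: "d = b * k" using assms(1) by (simp add: k_def)
  have key: "b * (b * (c2 * s + c4 * (b\<^sup>2 * s)) + (k + b ^ 4) * s - (- c1 * s - c3 * (b\<^sup>2 * s))) = s * poly p b" for s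
    by (simp add: assms(2) dk algebra_simps power_numeral_reduce)
  have coeffs: "poly.coeff p (Suc 0) = c1" "poly.coeff p 2 = c2" "poly.coeff p 3 = c3" "poly.coeff p 4 = c4"
    by (simp_all add: assms(2) numeral_eq_Suc)
  show ?thesis
  proof
    assume "conic_line d b \<inter> section_line p \<noteq> {0}"
    from this[unfolded subspace_inter_nontrivial[OF line_subspace(2,3)]]
    obtain x where x: "x \<noteq> 0" "x \<in> conic_line d b" "x \<in> section_line p" by blast
    then have "x $ 3 \<noteq> 0" by (auto simp: mem_conic_line mem_section_line vec4_eq_iff)
    moreover have x4: "x $ 4 = b\<^sup>2 * x $ 3" and x2: "x $ 2 = b * x $ 1 + (k + b ^ 4) * x $ 3"
      using x(2) by (simp_all add: mem_conic_line k_def)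
    have sec: "x $ 1 = c2 * x $ 3 + c4 * (b\<^sup>2 * x $ 3)" "x $ 2 = - c1 * x $ 3 - c3 * (b\<^sup>2 * x $ 3)"
      using x(3) by (simp_all add: mem_section_line coeffs x4)
    have "x $ 3 * poly p b = b * (b * x $ 1 + (k + b ^ 4) * x $ 3 - x $ 2)"
      unfolding key[symmetric] sec ..
    then have "x $ 3 * poly p b = 0" by (simp add: x2)
    ultimately show "poly p b = 0" by simp
  next
    assume "poly p b = 0"
    then have "b * (b * (c2 + c4 * b\<^sup>2) + (k + b ^ 4) - (- c1 - c3 * b\<^sup>2)) = 0"
      using key[of 1] by simp
    then have "b * (c2 + c4 * b\<^sup>2) + (k + b ^ 4) - (- c1 - c3 * b\<^sup>2) = 0"
      using assms(1) by (simp only: mult_eq_0_iff) simp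
    then have "- c1 - c3 * b\<^sup>2 = b * (c2 + c4 * b\<^sup>2) + (k + b ^ 4)"
      by (simp only: right_minus_eq)
    then have "vec4 (c2 + c4 * b\<^sup>2) (- c1 - c3 * b\<^sup>2) 1 (b\<^sup>2) \<in> conic_line d b"
      unfolding mem_conic_line vec4_nth by (simp only: k_def mult_1_right)
    then have "vec4 (c2 + c4 * b\<^sup>2) (- c1 - c3 * b\<^sup>2) 1 (b\<^sup>2) \<in> conic_line d b \<inter> section_line p"
      by (simp add: mem_section_line coeffs)
    moreover have "vec4 (c2 + c4 * b\<^sup>2) (- c1 - c3 * b\<^sup>2) 1 (b\<^sup>2) \<noteq> 0" by (simp add: vec4_eq_iff)
    ultimately show "conic_line d b \<inter> section_line p \<noteq> {0}" by blast
  qed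
qed

text \<open>Equating the coordinates \<open>X\<close> and \<open>Y\<close> on both lines gives two
  linear equations for \<open>(s, t)\<close>, with determinant
  \<open>a 2 * a 3 - a 1 * a 4\<close>.\<close>

lemma section_lines_inter:
  fixes p q :: "'a::field poly"
  defines "a i \<equiv> poly.coeff p i - poly.coeff q i"
  shows "section_line p \<inter> section_line q \<noteq> {0} \<longleftrightarrow> a 2 * a 3 = a 1 * a 4"
proof -
  have mem: "x \<in> section_line p \<inter> section_line q \<longleftrightarrow>
      x \<in> section_line p \<and> a 2 * x $ 3 + a 4 * x $ 4 = 0 \<and> a 1 * x $ 3 + a 3 * x $ 4 = 0" for x
  proof -
    have 1: "poly.coeff q 2 * x $ 3 + poly.coeff q 4 * x $ 4
        = (poly.coeff p 2 * x $ 3 + poly.coeff p 4 * x $ 4) - (a 2 * x $ 3 + a 4 * x $ 4)"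
      and 2: "- poly.coeff q 1 * x $ 3 - poly.coeff q 3 * x $ 4
        = (- poly.coeff p 1 * x $ 3 - poly.coeff p 3 * x $ 4) + (a 1 * x $ 3 + a 3 * x $ 4)"
      by (simp_all add: a_def algebra_simps)
    have "(x1 = r \<and> x2 = s) \<and> (x1 = r - t \<and> x2 = s + u) \<longleftrightarrow> (x1 = r \<and> x2 = s) \<and> t = 0 \<and> u = 0"
      for x1 x2 r s t u :: 'a by auto
    then show ?thesis unfolding Int_iff mem_section_line[of x p] mem_section_line[of x q] 1 2 .
  qed
  show ?thesis
  proof
    assume "section_line p \<inter> section_line q \<noteq> {0}"
    from this[unfolded subspace_inter_nontrivial[OF line_subspace(3,3)]]
    obtain x where x: "x \<noteq> 0" "x \<in> section_line p \<inter> section_line q" by blast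
    then have nz: "x $ 3 \<noteq> 0 \<or> x $ 4 \<noteq> 0" by (auto simp: mem_section_line vec4_eq_iff)
    have eq: "a 2 * x $ 3 + a 4 * x $ 4 = 0" "a 1 * x $ 3 + a 3 * x $ 4 = 0" using x mem by blast+
    have "x $ 3 * (a 2 * a 3 - a 1 * a 4) = a 3 * (a 2 * x $ 3 + a 4 * x $ 4) - a 4 * (a 1 * x $ 3 + a 3 * x $ 4)"
      "x $ 4 * (a 2 * a 3 - a 1 * a 4) = a 2 * (a 1 * x $ 3 + a 3 * x $ 4) - a 1 * (a 2 * x $ 3 + a 4 * x $ 4)"
      by (simp_all add: algebra_simps)
    then have "x $ 3 * (a 2 * a 3 - a 1 * a 4) = 0" "x $ 4 * (a 2 * a 3 - a 1 * a 4) = 0" unfolding eq by simp_all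
    then show "a 2 * a 3 = a 1 * a 4" using nz by auto
  next
    assume det: "a 2 * a 3 = a 1 * a 4"
    have "\<exists>s t. (s \<noteq> 0 \<or> t \<noteq> 0) \<and> a 2 * s + a 4 * t = 0 \<and> a 1 * s + a 3 * t = 0"
    proof (cases "a 2 = 0 \<and> a 4 = 0")
      case True
      show ?thesis
      proof (cases "a 1 = 0 \<and> a 3 = 0")
        case False
        then show ?thesis using True by (intro exI[of _ "a 3"] exI[of _ "- a 1"]) auto
      qed (use True in \<open>auto intro: exI[of _ 1]\<close>)
    next
      case False
      then show ?thesis using det by (intro exI[of _ "a 4"] exI[of _ "- a 2"]) (auto simp: mult.commute)
    qed
    then obtain s t where st: "s \<noteq> 0 \<or> t \<noteq> 0" "a 2 * s + a 4 * t = 0" "a 1 * s + a 3 * t = 0" by blast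
    define x where "x = vec4 (poly.coeff p 2 * s + poly.coeff p 4 * t) (- poly.coeff p 1 * s - poly.coeff p 3 * t) s t"
    have "x \<in> section_line p \<inter> section_line q" unfolding mem using st by (simp add: x_def mem_section_line)
    moreover have "x \<noteq> 0" using st(1) by (auto simp: x_def vec4_eq_iff)
    ultimately show "section_line p \<inter> section_line q \<noteq> {0}" by blast
  qed
qed

context cubic_data
begin

lemma cub_line0: "x \<in> line0 \<Longrightarrow> cub x = 0"
  by (simp add: mem_line0 cubic_def)

lemma cub_conic_line:
  assumes "b \<in> B" "x \<in> conic_line d b"
  shows "cub x = 0"
proof -
  define k where "k = d / b"
  have b: "b \<noteq> 0" and dk: "d = b * k" using B_nonzero[OF assms(1)] by (simp_all add: k_def)
  have x: "x $ 2 = b * x $ 1 + (k + b ^ 4) * x $ 3" "x $ 4 = b\<^sup>2 * x $ 3"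
    using assms(2) by (simp_all add: mem_conic_line k_def)
  have "b\<^sup>2 * cub x = (x $ 3) ^ 3 * (b^10 + f4 * b^8 + f3 * b^6 + f2 * b^4 + f1 * b^2 - d\<^sup>2)"
    unfolding cubic_def x dk by (simp add: algebra_simps power_numeral_reduce)
  then show ?thesis using assms(1) b by (simp add: mem_B)
qed

text \<open>The four equations compare coefficients in \<open>p(T) * (- p(- T)) = f(T^2)\<close>;
  the leading and constant coefficients agree anyway.\<close>

definition section_poly :: "'a poly \<Rightarrow> bool" where
  "section_poly p \<longleftrightarrow> (\<exists>c1 c2 c3 c4. p = [:d, c1, c2, c3, c4, 1:] \<and>
     f4 = 2 * c3 - c4\<^sup>2 \<and> f3 = c3\<^sup>2 + 2 * c1 - 2 * c4 * c2 \<and>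
     f2 = 2 * c3 * c1 - c2\<^sup>2 - 2 * c4 * d \<and> f1 = c1\<^sup>2 - 2 * c2 * d)"

lemma cub_section_line:
  assumes "section_poly p" "x \<in> section_line p"
  shows "cub x = 0"
proof -
  obtain c1 c2 c3 c4 where p: "p = [:d, c1, c2, c3, c4, 1:]" and
    f: "f4 = 2 * c3 - c4\<^sup>2" "f3 = c3\<^sup>2 + 2 * c1 - 2 * c4 * c2"
     "f2 = 2 * c3 * c1 - c2\<^sup>2 - 2 * c4 * d" "f1 = c1\<^sup>2 - 2 * c2 * d"
    using assms(1) unfolding section_poly_def by blast
  have coeffs: "poly.coeff p (Suc 0) = c1" "poly.coeff p 2 = c2" "poly.coeff p 3 = c3" "poly.coeff p 4 = c4"
    by (simp_all add: p numeral_eq_Suc)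
  have x: "x $ 1 = c2 * x $ 3 + c4 * x $ 4" "x $ 2 = - c1 * x $ 3 - c3 * x $ 4"
    using assms(2) by (simp_all add: mem_section_line coeffs)
  show ?thesis unfolding cubic_def x f by (simp add: algebra_simps power2_eq_square)
qed

text \<open>A line meeting \<open>line0\<close> in a point \<open>z\<close> lies in a plane through \<open>line0\<close>, which has to be
  one of the five planes with a degenerate residual conic.\<close>

lemma conic_line_if_point:
  assumes z: "z $ 3 = 0" "z $ 4 = 0" "z \<noteq> 0" and y: "y $ 3 \<noteq> 0 \<or> y $ 4 \<noteq> 0"
    and cub: "\<And>l. cub (l *s z + y) = 0"
  obtains b where "b \<in> B" "z = z $ 1 *s vec4 1 b 0 0" "z $ 1 \<noteq> 0" "y \<in> conic_line d b"
proof -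
  \<comment> \<open>\<open>A\<close> is the differential of the cubic at \<open>z\<close> applied to
    \<open>y\<close>; its vanishing says that the plane through \<open>line0\<close> and
    \<open>y\<close> is tangent at \<open>z\<close>.\<close>
  define A where "A = y $ 4 * (z $ 1)\<^sup>2 - y $ 3 * (z $ 2)\<^sup>2"
  define C where "C = 2 * (y $ 4 * z $ 1 * y $ 1 - y $ 3 * z $ 2 * y $ 2 + d * (y $ 3)\<^sup>2 * z $ 1 + (y $ 4)\<^sup>2 * z $ 2)"
  have exp: "cub (l *s z + y) = l\<^sup>2 * A + l * C + cub y" for l
    by (simp add: cubic_def A_def C_def z algebra_simps power2_eq_square)
  \<comment> \<open>The three values 0, 1, -1 of \<open>l\<close> determine a quadratic polynomial
    because \<open>2 \<noteq> 0\<close>.\<close>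
  have 0: "cub y = 0" using cub[of 0] by simp
  have 1: "A + C = 0" using cub[of 1] 0 by (simp only: exp) simp
  have 2: "A - C = 0" using cub[of "- 1"] 0 by (simp only: exp) simp
  have "2 * A = (A + C) + (A - C)" by simp
  then have A: "A = 0" using 1 2 two by simp
  with 1 have C: "C = 0" by simp
  have s: "y $ 3 \<noteq> 0"
  proof
    assume s: "y $ 3 = 0"
    with y have t: "y $ 4 \<noteq> 0" by simp
    with A s have "z $ 1 = 0" by (simp add: A_def)
    with C s t two have "z $ 2 = 0" by (simp add: C_def)
    with \<open>z $ 1 = 0\<close> z show False by (simp add: vec4_eq_iff)
  qed
  have z1: "z $ 1 \<noteq> 0"
  proof
    assume "z $ 1 = 0"
    with A s have "z $ 2 = 0" by (simp add: A_def)
    with \<open>z $ 1 = 0\<close> z show False by (simp add: vec4_eq_iff)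
  qed
  define b where "b = z $ 2 / z $ 1"
  have z2: "z $ 2 = b * z $ 1" using z1 by (simp add: b_def)
  have "(y $ 4 - b\<^sup>2 * y $ 3) * (z $ 1)\<^sup>2 = A" by (simp add: A_def z2 algebra_simps power2_eq_square)
  then have t: "y $ 4 = b\<^sup>2 * y $ 3" using A z1 by simp
  have "2 * z $ 1 * y $ 3 * (b\<^sup>2 * y $ 1 - b * y $ 2 + d * y $ 3 + b ^ 5 * y $ 3) = C"
    by (simp add: C_def z2 t algebra_simps power_numeral_reduce)
  then have lin: "b\<^sup>2 * y $ 1 - b * y $ 2 + d * y $ 3 + b ^ 5 * y $ 3 = 0" using C z1 s two by simp
  have b0: "b \<noteq> 0" using lin d s by auto
  define k where "k = d / b"
  have dk: "d = b * k" using b0 by (simp add: k_def)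
  have "b * (b * y $ 1 + (k + b ^ 4) * y $ 3 - y $ 2) = b\<^sup>2 * y $ 1 - b * y $ 2 + d * y $ 3 + b ^ 5 * y $ 3"
    by (simp add: dk algebra_simps power_numeral_reduce)
  then have y2: "y $ 2 = b * y $ 1 + (k + b ^ 4) * y $ 3" using lin b0 by simp
  then have "y \<in> conic_line d b" using t by (simp add: mem_conic_line k_def)
  moreover have "b \<in> B"
  proof -
    have "b\<^sup>2 * cub y = (y $ 3) ^ 3 * (b^10 + f4 * b^8 + f3 * b^6 + f2 * b^4 + f1 * b^2 - d\<^sup>2)"
      unfolding cubic_def y2 t dk by (simp add: algebra_simps power_numeral_reduce)
    then show ?thesis using 0 s by (simp add: mem_B)
  qed
  moreover have "z = z $ 1 *s vec4 1 b 0 0" using z z2 by (simp add: vec4_eq_iff)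
  ultimately show ?thesis using z1 that by blast
qed

text \<open>The restriction to the line is a binary cubic form; its vanishing at (1 : 0), (0 : 1),
  (1 : 1) and (1 : -1), distinct since \<open>2 \<noteq> 0\<close>, kills all coefficients, even
  over a field of three elements.\<close>

lemma section_line_if_points:
  assumes x: "x $ 3 = 1" "x $ 4 = 0" and y: "y $ 3 = 0" "y $ 4 = 1"
    and cub: "\<And>s t. cub (s *s x + t *s y) = 0"
  shows "section_poly [:d, - x $ 2, x $ 1, - y $ 2, y $ 1, 1:]"
proof -
  define g4 where "g4 = (y $ 1)\<^sup>2 + 2 * y $ 2 + f4"
  define g3 where "g3 = 2 * x $ 1 * y $ 1 - (y $ 2)\<^sup>2 + 2 * x $ 2 + f3"
  define g2 where "g2 = (x $ 1)\<^sup>2 - 2 * x $ 2 * y $ 2 + 2 * d * y $ 1 + f2"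
  define g1 where "g1 = - (x $ 2)\<^sup>2 + 2 * d * x $ 1 + f1"
  have exp: "cub (s *s x + t *s y) = g4 * t ^ 3 + g3 * t\<^sup>2 * s + g2 * t * s\<^sup>2 + g1 * s ^ 3" for s t
    by (simp add: cubic_def x y g1_def g2_def g3_def g4_def algebra_simps power_numeral_reduce)
  have 1: "g1 = 0" using cub[of 1 0] unfolding exp by simp
  have 4: "g4 = 0" using cub[of 0 1] unfolding exp by simp
  have "g3 + g2 = 0" using cub[of 1 1] 1 4 unfolding exp by simp
  moreover have "g3 - g2 = 0" using cub[of 1 "- 1"] 1 4 unfolding exp by simp
  ultimately have "2 * g3 = 0" by (simp add: eq_neg_iff_add_eq_0)
  then have 3: "g3 = 0" using two by simp
  with \<open>g3 + g2 = 0\<close> have 2: "g2 = 0" by simp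
  have "f4 = 2 * (- y $ 2) - (y $ 1)\<^sup>2 + g4" "f3 = (- y $ 2)\<^sup>2 + 2 * (- x $ 2) - 2 * y $ 1 * x $ 1 + g3"
    "f2 = 2 * (- y $ 2) * (- x $ 2) - (x $ 1)\<^sup>2 - 2 * y $ 1 * d + g2" "f1 = (- x $ 2)\<^sup>2 - 2 * x $ 1 * d + g1"
    by (simp_all add: g1_def g2_def g3_def g4_def algebra_simps)
  then show ?thesis unfolding section_poly_def 1 2 3 4 add_0_right by blast
qed

text \<open>The projection to \<open>(s, t)\<close> decides: if it is bijective on \<open>L\<close>,
  then \<open>L\<close> is a graph over these coordinates; otherwise \<open>L\<close> contains a
  point of \<open>line0\<close>.\<close>

lemma lines_classification:
  assumes sub: "vec.subspace L" and dim: "vec.dim L = 2" and cub: "\<And>x. x \<in> L \<Longrightarrow> cub x = 0"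
  shows "L = line0 \<or> (\<exists>b\<in>B. L = conic_line d b) \<or> (\<exists>p. section_poly p \<and> L = section_line p)"
proof -
  note closed = vec.subspace_add[OF sub] vec.subspace_scale[OF sub] vec.subspace_diff[OF sub]
  obtain E where E: "E \<subseteq> L" "vec.independent E" "L \<subseteq> vec.span E" "card E = vec.dim L"
    using vec.basis_exists by blast
  then have "card E = 2" using dim by simp
  then obtain x y where xy: "E = {x, y}" "x \<noteq> y" by (auto simp: card_2_iff)
  have mem: "x \<in> L" "y \<in> L" using E xy by auto
  have x0: "x \<noteq> 0" using E(2) xy vec.dependent_zero by blast
  have indep: "y - c *s x \<noteq> 0" for c
  proof
    assume "y - c *s x = 0"
    then have "y \<in> vec.span {x}" by (simp add: vec.span_scale vec.span_base)
    then show False using E(2) xy by (auto simp: vec.dependent_def insert_Diff_if)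
  qed
  \<comment> \<open>The minor of the basis in the coordinates \<open>s\<close> and
    \<open>t\<close>.\<close>
  define D where "D = x $ 3 * y $ 4 - x $ 4 * y $ 3"
  show ?thesis
  proof (cases "D = 0")
    case False
    define u where "u = (y $ 4 / D) *s x - (x $ 4 / D) *s y"
    define w where "w = (x $ 3 / D) *s y - (y $ 3 / D) *s x"
    have uw: "u \<in> L" "w \<in> L" unfolding u_def w_def by (intro closed mem)+
    have u: "u $ 3 = 1" "u $ 4 = 0" and w: "w $ 3 = 0" "w $ 4 = 1"
      using False by (simp_all add: u_def w_def flip: diff_divide_distrib) (simp_all add: D_def mult.commute)
    have cub': "cub (s *s u + t *s w) = 0" for s t by (intro cub closed uw)
    define p where "p = [:d, - u $ 2, u $ 1, - w $ 2, w $ 1, 1:]"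
    have "section_poly p" unfolding p_def by (rule section_line_if_points[OF u w cub'])
    moreover have "L = section_line p" unfolding section_line_def
    proof (rule graph_line_eqI[OF normalized_lines(3) sub dim])
      have "vec4 (poly.coeff p 2) (- poly.coeff p 1) 1 0 = u" "vec4 (poly.coeff p 4) (- poly.coeff p 3) 0 1 = w"
        using u w by (simp_all add: vec4_eq_iff p_def numeral_eq_Suc)
      then show "vec4 (poly.coeff p 2) (- poly.coeff p 1) 1 0 \<in> L" "vec4 (poly.coeff p 4) (- poly.coeff p 3) 0 1 \<in> L"
        using uw by simp_all
    qed
    ultimately show ?thesis by blast
  next
    case True
    have "\<exists>z\<in>L. z \<noteq> 0 \<and> z $ 3 = 0 \<and> z $ 4 = 0"
    proof (cases "x $ 3 = 0")
      case x3: True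
      show ?thesis
      proof (cases "x $ 4 = 0")
        case False
        have "y - (y $ 4 / x $ 4) *s x \<in> L" by (intro closed mem)
        moreover have "y $ 3 = 0" using True x3 False by (simp add: D_def)
        ultimately show ?thesis using x3 False indep by (intro bexI) auto
      qed (use x3 x0 mem in blast)
    next
      case False
      have "y - (y $ 3 / x $ 3) *s x \<in> L" by (intro closed mem)
      moreover have "y $ 4 = y $ 3 / x $ 3 * x $ 4" using True False by (simp add: D_def field_simps)
      ultimately show ?thesis using False indep by (intro bexI) auto
    qed
    then obtain z where z: "z \<in> L" "z \<noteq> 0" "z $ 3 = 0" "z $ 4 = 0" by blast
    show ?thesis
    proof (cases "L \<subseteq> line0")
      case True
      then have "L = line0" using vec.subspace_dim_equal[OF sub line_subspace(1)] dim by simp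
      then show ?thesis by blast
    next
      case False
      then obtain v where v: "v \<in> L" "v \<notin> line0" by blast
      then have v2: "v $ 3 \<noteq> 0 \<or> v $ 4 \<noteq> 0" by (simp add: mem_line0)
      have "cub (l *s z + v) = 0" for l by (intro cub closed z v)
      then obtain b where b: "b \<in> B" "z = z $ 1 *s vec4 1 b 0 0" "z $ 1 \<noteq> 0" "v \<in> conic_line d b"
        using conic_line_if_point[OF z(3,4,2) v2] by blast
      have v3: "v $ 3 \<noteq> 0" using b(4) v2 by (auto simp: mem_conic_line)
      have "L = conic_line d b" unfolding conic_line_def
      proof (rule graph_line_eqI[OF normalized_lines(2) sub dim])
        have "vec4 1 b 0 0 = (1 / z $ 1) *s z" using b(3) by (subst b(2)) (simp add: vec4_eq_iff)
        then show u: "vec4 1 b 0 0 \<in> L" using closed z(1) by simp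
        have "vec4 0 (d / b + b ^ 4) 1 (b\<^sup>2) = (1 / v $ 3) *s (v - v $ 1 *s vec4 1 b 0 0)"
          using b(4) v3 by (simp add: vec4_eq_iff mem_conic_line)
        moreover have "(1 / v $ 3) *s (v - v $ 1 *s vec4 1 b 0 0) \<in> L" by (intro closed v u)
        ultimately show "vec4 0 (d / b + b ^ 4) 1 (b\<^sup>2) \<in> L" by simp
      qed
      then show ?thesis using b(1) by blast
    qed
  qed
qed

end

section \<open>Nonsingularity\<close>

lemma (in field_emb) mp_eval_deriv_cubic_poly:
  "mp_eval e (mp_deriv 1 (cubic_poly d f1 f2 f3 f4)) (($) x) = 2 * (x $ 4 * x $ 1 + e d * (x $ 3)\<^sup>2)"
  "mp_eval e (mp_deriv 2 (cubic_poly d f1 f2 f3 f4)) (($) x) = 2 * ((x $ 4)\<^sup>2 - x $ 3 * x $ 2)"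
  "mp_eval e (mp_deriv 3 (cubic_poly d f1 f2 f3 f4)) (($) x) =
     - (x $ 2)\<^sup>2 + 4 * e d * x $ 3 * x $ 1 + e f3 * (x $ 4)\<^sup>2 + 2 * e f2 * x $ 4 * x $ 3 + 3 * e f1 * (x $ 3)\<^sup>2"
  "mp_eval e (mp_deriv 4 (cubic_poly d f1 f2 f3 f4)) (($) x) =
     (x $ 1)\<^sup>2 + 4 * x $ 4 * x $ 2 + 3 * e f4 * (x $ 4)\<^sup>2 + 2 * e f3 * x $ 4 * x $ 3 + e f2 * (x $ 3)\<^sup>2"
  by (simp_all add: cubic_poly_def algebra_simps power2_eq_square del: One_nat_def)

locale cubic_data_closed = cubic_data d f1 f2 f3 f4 B
  for d f1 f2 f3 f4 :: "'a::alg_closed_field" and B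
begin

text \<open>The first two partial derivatives are \<open>2 U\<close> and \<open>- 2 W\<close>, so a
  singular point has \<open>U = W = 0\<close>. The cubic and its derivative by \<open>t\<close> then
  make \<open>t / s\<close> a double root of the quintic.\<close>

lemma cub_nonsingular:
  assumes x: "x \<noteq> 0" and cub: "cub x = 0"
    and 1: "x $ 4 * x $ 1 + d * (x $ 3)\<^sup>2 = 0" and 2: "(x $ 4)\<^sup>2 - x $ 3 * x $ 2 = 0"
    and 3: "- (x $ 2)\<^sup>2 + 4 * d * x $ 3 * x $ 1 + f3 * (x $ 4)\<^sup>2 + 2 * f2 * x $ 4 * x $ 3 + 3 * f1 * (x $ 3)\<^sup>2 = 0"
    and 4: "(x $ 1)\<^sup>2 + 4 * x $ 4 * x $ 2 + 3 * f4 * (x $ 4)\<^sup>2 + 2 * f3 * x $ 4 * x $ 3 + f2 * (x $ 3)\<^sup>2 = 0"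
  shows False
proof -
  have s: "x $ 3 \<noteq> 0"
  proof
    assume s: "x $ 3 = 0"
    with 2 have t: "x $ 4 = 0" by simp
    with s 3 have "x $ 2 = 0" by simp
    moreover have "x $ 1 = 0" using s t 4 by simp
    ultimately show False using s t x by (simp add: vec4_eq_iff)
  qed
  have t: "x $ 4 \<noteq> 0" using 1 s d by auto
  \<comment> \<open>A square root of \<open>t / s\<close> is taken because \<open>B\<close> consists
    of the roots of \<open>f(T^2)\<close>.\<close>
  obtain b where b: "b\<^sup>2 = x $ 4 / x $ 3" using nth_root_exists[of 2 "x $ 4 / x $ 3"] by auto
  then have t_eq: "x $ 4 = b\<^sup>2 * x $ 3" using s by simp
  then have b0: "b \<noteq> 0" using t by auto
  have "x $ 3 * (b\<^sup>2 * x $ 1 + d * x $ 3) = 0" using 1 by (simp add: t_eq algebra_simps power2_eq_square)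
  then have x1: "b\<^sup>2 * x $ 1 = - d * x $ 3" using s by (simp add: eq_neg_iff_add_eq_0)
  have "x $ 3 * (b ^ 4 * x $ 3 - x $ 2) = 0" using 2 by (simp add: t_eq algebra_simps power_numeral_reduce)
  then have x2: "x $ 2 = b ^ 4 * x $ 3" using s by simp
  have W: "x $ 3 * x $ 2 - (x $ 4)\<^sup>2 = 0" using 2 by simp
  have "x $ 3 * x $ 4 * cub x = (x $ 3) ^ 5 * (b^10 + f4 * b^8 + f3 * b^6 + f2 * b^4 + f1 * b^2 - d\<^sup>2)"
    unfolding cubic_identity 1 W unfolding t_eq by (simp add: algebra_simps power_numeral_reduce)
  then have q: "b^10 + f4 * b^8 + f3 * b^6 + f2 * b^4 + f1 * b^2 - d\<^sup>2 = 0" using cub s b0 by simp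
  \<comment> \<open>The factor \<open>b^4\<close> turns \<open>X^2\<close> into
    \<open>(b^2 X)^2\<close>, which \<open>x1\<close> evaluates.\<close>
  have "b ^ 4 * ((x $ 1)\<^sup>2 + 4 * x $ 4 * x $ 2 + 3 * f4 * (x $ 4)\<^sup>2 + 2 * f3 * x $ 4 * x $ 3 + f2 * (x $ 3)\<^sup>2)
     = (b\<^sup>2 * x $ 1)\<^sup>2 + b ^ 4 * (4 * x $ 4 * x $ 2 + 3 * f4 * (x $ 4)\<^sup>2 + 2 * f3 * x $ 4 * x $ 3 + f2 * (x $ 3)\<^sup>2)"
    by (simp add: algebra_simps power_numeral_reduce)
  also have "\<dots> = (x $ 3)\<^sup>2 * (d\<^sup>2 + 4 * b ^ 10 + 3 * f4 * b ^ 8 + 2 * f3 * b ^ 6 + f2 * b ^ 4)"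
    unfolding x1 x2 t_eq by (simp add: algebra_simps power_numeral_reduce)
  finally have "d\<^sup>2 + 4 * b ^ 10 + 3 * f4 * b ^ 8 + 2 * f3 * b ^ 6 + f2 * b ^ 4 = 0" using 4 s by simp
  moreover have "b\<^sup>2 * (5 * b^8 + 4 * f4 * b^6 + 3 * f3 * b^4 + 2 * f2 * b^2 + f1)
     = (d\<^sup>2 + 4 * b ^ 10 + 3 * f4 * b ^ 8 + 2 * f3 * b ^ 6 + f2 * b ^ 4)
       + (b^10 + f4 * b^8 + f3 * b^6 + f2 * b^4 + f1 * b^2 - d\<^sup>2)"
    by (simp add: algebra_simps power_numeral_reduce)
  ultimately have "5 * b^8 + 4 * f4 * b^6 + 3 * f3 * b^4 + 2 * f2 * b^2 + f1 = 0" using q b0 by simp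
  moreover have "b \<in> B" using q by (simp add: mem_B)
  ultimately show False using B_simple by blast
qed

end

lemma nonsingular_cubic_poly:
  fixes d f1 f2 f3 f4 :: "'k::field"
  assumes "cubic_data (to_ac d) (to_ac f1) (to_ac f2) (to_ac f3) (to_ac f4) B"
  shows "nonsingular_cubic_surface (cubic_poly d f1 f2 f3 f4)"
proof -
  interpret ac: field_emb "to_ac :: 'k \<Rightarrow> 'k alg_closure"
    by unfold_locales (rule field_embedding_to_ac)
  interpret cubic_data_closed "to_ac d" "to_ac f1" "to_ac f2" "to_ac f3" "to_ac f4" B
    using assms by (simp add: cubic_data_closed_def)
  have "cubic_poly d f1 f2 f3 f4 \<noteq> 0"
  proof
    assume "cubic_poly d f1 f2 f3 f4 = 0"
    then have *: "cub x = 0" for x using ac.mp_eval_cubic_poly[of d f1 f2 f3 f4 x] by simp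
    \<comment> \<open>The values at these points are \<open>f1\<close> and
      \<open>f1 - 1\<close>.\<close>
    show False using *[of "vec4 0 0 1 0"] *[of "vec4 0 1 1 0"] by (simp add: cubic_def)
  qed
  moreover have False if "x \<in> surface_points to_ac (cubic_poly d f1 f2 f3 f4)"
    "\<forall>i. mp_eval to_ac (mp_deriv i (cubic_poly d f1 f2 f3 f4)) (($) x) = 0" for x :: "'k alg_closure ^ 4"
  proof (rule cub_nonsingular)
    show "x \<noteq> 0" "cub x = 0" using that(1) by (simp_all add: surface_points_def ac.mp_eval_cubic_poly)
    show "x $ 4 * x $ 1 + to_ac d * (x $ 3)\<^sup>2 = 0" using that(2)[rule_format, of 1] two
      by (simp only: ac.mp_eval_deriv_cubic_poly mult_eq_0_iff) simp
    show "(x $ 4)\<^sup>2 - x $ 3 * x $ 2 = 0" using that(2)[rule_format, of 2] two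
      by (simp only: ac.mp_eval_deriv_cubic_poly mult_eq_0_iff) simp
    show "- (x $ 2)\<^sup>2 + 4 * to_ac d * x $ 3 * x $ 1 + to_ac f3 * (x $ 4)\<^sup>2
        + 2 * to_ac f2 * x $ 4 * x $ 3 + 3 * to_ac f1 * (x $ 3)\<^sup>2 = 0"
      using that(2)[rule_format, of 3] by (simp only: ac.mp_eval_deriv_cubic_poly)
    show "(x $ 1)\<^sup>2 + 4 * x $ 4 * x $ 2 + 3 * to_ac f4 * (x $ 4)\<^sup>2
        + 2 * to_ac f3 * x $ 4 * x $ 3 + to_ac f2 * (x $ 3)\<^sup>2 = 0"
      using that(2)[rule_format, of 4] by (simp only: ac.mp_eval_deriv_cubic_poly)
  qed
  ultimately show ?thesis
    unfolding nonsingular_cubic_surface_def using mp_homogeneous_cubic_poly by blast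
qed

section \<open>Unirationality\<close>

text \<open>The double cover of the surface by the points of \<open>line0\<close>: over \<open>(u : v)\<close> the residual
  conic of the tangent plane is parametrized by the lines \<open>v X - u Y = c\<close> through the point
  \<open>(u : v : 0 : 0)\<close> on it.\<close>

definition conic_param :: "'r \<Rightarrow> 'r \<Rightarrow> 'r \<Rightarrow> 'r \<Rightarrow> 'r \<Rightarrow> 'r \<Rightarrow> 'r \<Rightarrow> 'r \<Rightarrow> 4 \<Rightarrow> 'r::comm_ring_1" where
  "conic_param d f1 f2 f3 f4 u v c j =
    (let D = c * u * v + d * u ^ 5 + v ^ 5;
         g = f4 * v ^ 6 + f3 * v ^ 4 * u ^ 2 + f2 * v ^ 2 * u ^ 4 + f1 * u ^ 6
     in if j = 1 then 2 * c * v ^ 4 + c ^ 2 * u - u * g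
        else if j = 2 then - (2 * c * d * u ^ 4) - c ^ 2 * v - v * g
        else if j = 3 then 2 * u ^ 2 * D else 2 * v ^ 2 * D)"

lemma conic_param_simps:
  "conic_param d f1 f2 f3 f4 u v c 1 = 2 * c * v ^ 4 + c ^ 2 * u
     - u * (f4 * v ^ 6 + f3 * v ^ 4 * u ^ 2 + f2 * v ^ 2 * u ^ 4 + f1 * u ^ 6)"
  "conic_param d f1 f2 f3 f4 u v c 2 = - (2 * c * d * u ^ 4) - c ^ 2 * v
     - v * (f4 * v ^ 6 + f3 * v ^ 4 * u ^ 2 + f2 * v ^ 2 * u ^ 4 + f1 * u ^ 6)"
  "conic_param d f1 f2 f3 f4 u v c 3 = 2 * u ^ 2 * (c * u * v + d * u ^ 5 + v ^ 5)"
  "conic_param d f1 f2 f3 f4 u v c 4 = 2 * v ^ 2 * (c * u * v + d * u ^ 5 + v ^ 5)"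
  by (simp_all add: conic_param_def)

definition conic_point :: "'a::field \<Rightarrow> 'a \<Rightarrow> 'a \<Rightarrow> 'a \<Rightarrow> 'a \<Rightarrow> 'a \<Rightarrow> 'a \<Rightarrow> 'a \<Rightarrow> 'a ^ 4" where
  "conic_point d f1 f2 f3 f4 u v c = (\<chi> j. conic_param d f1 f2 f3 f4 u v c j)"

lemma cubic_conic_point: "cubic d f1 f2 f3 f4 (conic_point d f1 f2 f3 f4 u v c) = 0"
proof -
  define g where "g = f4 * v ^ 6 + f3 * v ^ 4 * u ^ 2 + f2 * v ^ 2 * u ^ 4 + f1 * u ^ 6"
  define D where "D = c * u * v + d * u ^ 5 + v ^ 5"
  define X1 where "X1 = 2 * c * v ^ 4 + c ^ 2 * u - u * g"
  define X2 where "X2 = - (2 * c * d * u ^ 4) - c ^ 2 * v - v * g"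
  have coords: "conic_point d f1 f2 f3 f4 u v c $ 1 = X1" "conic_point d f1 f2 f3 f4 u v c $ 2 = X2"
    "conic_point d f1 f2 f3 f4 u v c $ 3 = 2 * u ^ 2 * D" "conic_point d f1 f2 f3 f4 u v c $ 4 = 2 * v ^ 2 * D"
    by (simp_all only: conic_point_def vec_lambda_beta conic_param_simps X1_def X2_def D_def g_def)
  have "cubic d f1 f2 f3 f4 (conic_point d f1 f2 f3 f4 u v c)
      = 2 * D * (v\<^sup>2 * X1\<^sup>2 - u\<^sup>2 * X2\<^sup>2 + 4 * D * (d * u ^ 4 * X1 + v ^ 4 * X2) + 4 * D\<^sup>2 * g)"
    unfolding cubic_def coords by (simp add: g_def algebra_simps power_numeral_reduce)
  also have "v\<^sup>2 * X1\<^sup>2 - u\<^sup>2 * X2\<^sup>2 + 4 * D * (d * u ^ 4 * X1 + v ^ 4 * X2) + 4 * D\<^sup>2 * g = 0"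
    unfolding X1_def X2_def D_def by (simp add: algebra_simps power_numeral_reduce)
  finally show ?thesis by simp
qed

text \<open>For fixed \<open>c\<close> the cubic becomes linear in \<open>X\<close> and
  \<open>Y\<close>, since \<open>(v X - u Y) (v X + u Y) = c (v X + u Y)\<close>. Together with
  \<open>v X - u Y = c\<close> it is a linear system of determinant
  \<open>2 (c u v + d u^5 + v^5)\<close>, and \<open>conic_param\<close> is Cramer's rule for
  it.\<close>

lemma conic_point_surjective:
  assumes "cubic d f1 f2 f3 f4 x = 0" "x $ 3 = u\<^sup>2" "x $ 4 = v\<^sup>2" "c = v * x $ 1 - u * x $ 2"
  shows "conic_point d f1 f2 f3 f4 u v c = (2 * (c * u * v + d * u ^ 5 + v ^ 5)) *s x"
proof -
  define g where "g = f4 * v ^ 6 + f3 * v ^ 4 * u ^ 2 + f2 * v ^ 2 * u ^ 4 + f1 * u ^ 6"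
  have "cubic d f1 f2 f3 f4 x = c * (v * x $ 1 + u * x $ 2) + 2 * d * u ^ 4 * x $ 1 + 2 * v ^ 4 * x $ 2 + g"
    by (simp add: cubic_def assms(2-) g_def algebra_simps power_numeral_reduce)
  then have g: "g = - (c * (v * x $ 1 + u * x $ 2) + 2 * d * u ^ 4 * x $ 1 + 2 * v ^ 4 * x $ 2)"
    using assms(1) by (simp add: eq_neg_iff_add_eq_0 algebra_simps)
  show ?thesis
    unfolding vec4_eq_iff conic_point_def
    by (simp add: conic_param_simps assms(2,3) flip: g_def)
      (simp add: g assms(4) algebra_simps power_numeral_reduce)
qed

text \<open>\<open>conic_param\<close> is defined over every commutative ring, so that one formula
  yields both the forms of the rational map and its values.\<close>

lemma (in field_emb) mp_eval_conic_param:
  "mp_eval e (conic_param (mp_const d) (mp_const f1) (mp_const f2) (mp_const f3) (mp_const f4) U V C j) t =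
    conic_param (e d) (e f1) (e f2) (e f3) (e f4) (mp_eval e U t) (mp_eval e V t) (mp_eval e C t) j"
  by (simp add: conic_param_def Let_def)

text \<open>Degree 3 for \<open>C\<close> balances \<open>C U V\<close> against \<open>U^5\<close>
  and \<open>V^5\<close>.\<close>

lemma mp_homogeneous_conic_param:
  fixes U V C :: "('v, 'a::comm_ring_1) mpoly"
  assumes "mp_homogeneous 1 U" "mp_homogeneous 1 V" "mp_homogeneous 3 C"
  shows "mp_homogeneous 7 (conic_param (mp_const d) (mp_const f1) (mp_const f2) (mp_const f3) (mp_const f4) U V C j)"
proof -
  note rules = assms mp_homogeneous_const mp_homogeneous_numeral mp_homogeneous_mult' mp_homogeneous_power'
    mp_homogeneous_add mp_homogeneous_diff mp_homogeneous_uminus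
  define D where "D = C * U * V + mp_const d * U ^ 5 + V ^ 5"
  define g where "g = mp_const f4 * V ^ 6 + mp_const f3 * V ^ 4 * U ^ 2 + mp_const f2 * V ^ 2 * U ^ 4 + mp_const f1 * U ^ 6"
  have D: "mp_homogeneous 5 D" unfolding D_def by (rule rules refl | simp)+
  have g: "mp_homogeneous 6 g" unfolding g_def by (rule rules refl | simp)+
  have 1: "mp_homogeneous 7 (2 * C * V ^ 4 + C ^ 2 * U - U * g)" by (rule rules g refl | simp)+
  have 2: "mp_homogeneous 7 (- (2 * C * mp_const d * U ^ 4) - C ^ 2 * V - V * g)" by (rule rules g refl | simp)+
  have 3: "mp_homogeneous 7 (2 * U ^ 2 * D)" "mp_homogeneous 7 (2 * V ^ 2 * D)" by (rule rules D refl | simp)+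
  show ?thesis
    unfolding conic_param_def Let_def D_def[symmetric] g_def[symmetric] using 1 2 3 by simp
qed

lemma mp_vars_conic_param:
  fixes U V C :: "('v, 'a::comm_ring_1) mpoly"
  assumes "mp_vars U \<subseteq> A" "mp_vars V \<subseteq> A" "mp_vars C \<subseteq> A"
  shows "mp_vars (conic_param (mp_const d) (mp_const f1) (mp_const f2) (mp_const f3) (mp_const f4) U V C j) \<subseteq> A"
proof -
  note rules = assms mp_vars_add mp_vars_diff mp_vars_uminus mp_vars_mult mp_vars_power mp_vars_numeral mp_vars_const
  define D where "D = C * U * V + mp_const d * U ^ 5 + V ^ 5"
  define g where "g = mp_const f4 * V ^ 6 + mp_const f3 * V ^ 4 * U ^ 2 + mp_const f2 * V ^ 2 * U ^ 4 + mp_const f1 * U ^ 6"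
  have D: "mp_vars D \<subseteq> A" and g: "mp_vars g \<subseteq> A" unfolding D_def g_def by (intro rules)+
  have "mp_vars (2 * C * V ^ 4 + C ^ 2 * U - U * g) \<subseteq> A"
    "mp_vars (- (2 * C * mp_const d * U ^ 4) - C ^ 2 * V - V * g) \<subseteq> A"
    "mp_vars (2 * U ^ 2 * D) \<subseteq> A" "mp_vars (2 * V ^ 2 * D) \<subseteq> A" by (intro rules D g)+
  then show ?thesis
    unfolding conic_param_def Let_def D_def[symmetric] g_def[symmetric] by simp
qed

lemma mp_form_vec_line:
  fixes H :: "(4, 'a::field) mpoly"
  assumes "infinite (UNIV :: 'a set)" "finite N" "\<And>l. l \<notin> N \<Longrightarrow> mp_eval id H (($) (x + l *s y)) = 0"
  shows "mp_eval id H (($) (x + l *s y)) = 0"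
proof -
  have "($) (x + l *s y) = (\<lambda>i. x $ i + l * y $ i)" for l by (rule ext) simp
  then show ?thesis using mp_eval_eq_0_on_line[OF assms(1,2), of H "($) x" "($) y"] assms(3) by simp
qed

lemma mp_form_vec_scale:
  fixes H :: "(4, 'a::field) mpoly"
  assumes "mp_homogeneous n H" "mp_eval id H (($) (a *s x)) = 0" "a \<noteq> 0"
  shows "mp_eval id H (($) x) = 0"
proof -
  have "($) (a *s x) = (\<lambda>i. a * x $ i)" by (rule ext) simp
  then show ?thesis using mp_eval_homogeneous[OF assms(1), of a "($) x"] assms(2,3) by simp
qed

context cubic_data_closed
begin

abbreviation "pt \<equiv> conic_point d f1 f2 f3 f4"

text \<open>The points missed by the parametrization are isolated on lines contained in the surface:
  on \<open>line0\<close>, and the five double points of the degenerate conics.\<close>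

lemma forms_vanishing_on_conic_points:
  fixes H :: "(4, 'a) mpoly"
  assumes inf: "infinite (UNIV :: 'a set)" and hom: "mp_homogeneous n H"
    and van: "\<And>u v c. pt u v c \<noteq> 0 \<Longrightarrow> mp_eval id H (($) (pt u v c)) = 0"
    and x: "x \<noteq> 0" "cub x = 0"
  shows "mp_eval id H (($) x) = 0"
proof -
  have hit: "mp_eval id H (($) y) = 0"
    if y: "cub y = 0" "y $ 3 = u\<^sup>2" "y $ 4 = v\<^sup>2" and nz: "u * (y $ 4 * y $ 1 + d * (y $ 3)\<^sup>2) - v * (y $ 3 * y $ 2 - (y $ 4)\<^sup>2) \<noteq> 0"
    for y u v
  proof -
    define c where "c = v * y $ 1 - u * y $ 2"
    define D where "D = c * u * v + d * u ^ 5 + v ^ 5"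
    \<comment> \<open>\<open>D\<close>, half the determinant of the linear system, equals
      \<open>u U - v W\<close>.\<close>
    have "u * (y $ 4 * y $ 1 + d * (y $ 3)\<^sup>2) - v * (y $ 3 * y $ 2 - (y $ 4)\<^sup>2) = D"
      by (simp add: D_def c_def y algebra_simps power_numeral_reduce)
    then have D: "2 * D \<noteq> 0" using nz two by simp
    have "y \<noteq> 0" using nz by auto
    have "pt u v c = (2 * D) *s y"
      unfolding D_def by (rule conic_point_surjective[OF y c_def])
    moreover have "(2 * D) *s y \<noteq> 0" using D \<open>y \<noteq> 0\<close> by simp
    ultimately have "mp_eval id H (($) ((2 * D) *s y)) = 0" using van[of u v c] by simp
    then show ?thesis using mp_form_vec_scale[OF hom _ D] by blast
  qed
  show ?thesis
  proof (cases "x \<in> line0")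
    case True
    then have x34: "x $ 3 = 0" "x $ 4 = 0" by (simp_all add: mem_line0)
    have gen: "mp_eval id H (($) (vec4 1 l 0 0)) = 0" if l: "l \<noteq> 0" "l \<notin> B" for l
    proof -
      \<comment> \<open>This \<open>c\<close> makes \<open>D = 0\<close> for \<open>u = 1\<close>
        and \<open>v = l\<close>, so \<open>s\<close> and \<open>t\<close> vanish at the image. The
        image is then a multiple of \<open>(1, l, 0, 0)\<close>, nonzero because \<open>l\<close> is
        not in \<open>B\<close>.\<close>
      define c where "c = - (d + l ^ 5) / l"
      have cl: "c * l = - d - l ^ 5" using l by (simp add: c_def)
      define z where "z = pt 1 l c"
      have z34: "z $ 3 = 0" "z $ 4 = 0"
        by (simp_all add: z_def conic_point_def conic_param_simps cl)
      have "l * z $ 1 - z $ 2 = 2 * c * (c * l + d + l ^ 5)"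
        by (simp add: z_def conic_point_def conic_param_simps algebra_simps power_numeral_reduce)
      then have z2: "z $ 2 = l * z $ 1" by (simp add: cl)
      have "2 * l\<^sup>2 * z $ 1 = l * (l * z $ 1 + z $ 2)" by (simp add: z2 power2_eq_square)
      also have "\<dots> = 2 * (c * l) * (l ^ 5 - d) - 2 * l\<^sup>2 * (f4 * l ^ 6 + f3 * l ^ 4 + f2 * l ^ 2 + f1)"
        by (simp add: z_def conic_point_def conic_param_simps algebra_simps power_numeral_reduce)
      also have "\<dots> = - 2 * (l^10 + f4 * l^8 + f3 * l^6 + f2 * l^4 + f1 * l^2 - d\<^sup>2)"
        unfolding cl by (simp add: algebra_simps power_numeral_reduce)
      finally have eq: "2 * l\<^sup>2 * z $ 1 = - 2 * (l^10 + f4 * l^8 + f3 * l^6 + f2 * l^4 + f1 * l^2 - d\<^sup>2)" .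
      have "- 2 * (l^10 + f4 * l^8 + f3 * l^6 + f2 * l^4 + f1 * l^2 - d\<^sup>2) \<noteq> 0"
        using l(2) two unfolding mem_B by (simp only: mult_eq_0_iff neg_equal_0_iff_equal) simp
      then have z1: "z $ 1 \<noteq> 0" unfolding eq[symmetric] by auto
      have z: "z = z $ 1 *s vec4 1 l 0 0" using z2 z34 by (simp add: vec4_eq_iff)
      have "z \<noteq> 0" using z1 by auto
      then have "mp_eval id H (($) z) = 0" using van[of 1 l c] by (simp add: z_def)
      then show ?thesis using mp_form_vec_scale[OF hom _ z1] z by metis
    qed
    have e1: "vec4 1 0 0 0 + l *s vec4 0 1 0 (0::'a) = vec4 1 l 0 0" for l by (simp add: vec4_eq_iff)
    have all: "mp_eval id H (($) (vec4 1 l 0 0)) = 0" for l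
      using mp_form_vec_line[OF inf, of "insert 0 B" H "vec4 1 0 0 0" "vec4 0 1 0 0" l] finB gen
      unfolding e1 by auto
    have all': "mp_eval id H (($) (vec4 l 1 0 0)) = 0" if "l \<noteq> 0" for l
    proof (rule mp_form_vec_scale[OF hom])
      have "(1 / l) *s vec4 l 1 0 0 = vec4 1 (1 / l) 0 0" using that by (simp add: vec4_eq_iff)
      then show "mp_eval id H (($) ((1 / l) *s vec4 l 1 0 0)) = 0" using all by simp
    qed (use that in simp)
    have e2: "vec4 0 1 0 0 + l *s vec4 1 0 0 (0::'a) = vec4 l 1 0 0" for l by (simp add: vec4_eq_iff)
    have zero: "mp_eval id H (($) (vec4 0 1 0 0)) = 0"
      using mp_form_vec_line[OF inf, of "{0}" H "vec4 0 1 0 0" "vec4 1 0 0 0" 0] all'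
      unfolding e2 by auto
    show ?thesis
    proof (cases "x $ 1 = 0")
      case True
      then have "x $ 2 \<noteq> 0" using x(1) x34 by (auto simp: vec4_eq_iff)
      moreover from this True x34 have "(1 / x $ 2) *s x = vec4 0 1 0 0" by (simp add: vec4_eq_iff)
      ultimately show ?thesis using mp_form_vec_scale[OF hom, of "1 / x $ 2" x] zero by simp
    next
      case False
      moreover from this x34 have "(1 / x $ 1) *s x = vec4 1 (x $ 2 / x $ 1) 0 0" by (simp add: vec4_eq_iff)
      ultimately show ?thesis using mp_form_vec_scale[OF hom, of "1 / x $ 1" x] all by simp
    qed
  next
    case False
    then have x34: "x $ 3 \<noteq> 0 \<or> x $ 4 \<noteq> 0" by (simp add: mem_line0)
    obtain u v where u: "x $ 3 = u\<^sup>2" and v: "x $ 4 = v\<^sup>2" using nth_root_exists[of 2] by (metis pos2)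
    define U where "U = x $ 4 * x $ 1 + d * (x $ 3)\<^sup>2"
    define W where "W = x $ 3 * x $ 2 - (x $ 4)\<^sup>2"
    \<comment> \<open>The root \<open>v\<close> is determined only up to sign; if both signs fail,
      then \<open>u U = v W = 0\<close>.\<close>
    show ?thesis
    proof (cases "u * U - v * W \<noteq> 0 \<or> u * U - (- v) * W \<noteq> 0")
      case True
      then show ?thesis
      proof
        assume "u * U - v * W \<noteq> 0"
        then show ?thesis unfolding U_def W_def by (rule hit[OF x(2) u v])
      next
        assume "u * U - (- v) * W \<noteq> 0"
        moreover have "x $ 4 = (- v)\<^sup>2" using v by simp
        ultimately show ?thesis unfolding U_def W_def by (intro hit[OF x(2) u])
      qed
    next
      case False
      then have ab: "u * U - v * W = 0" "u * U - (- v) * W = 0" by blast+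
      have "2 * (u * U) = (u * U - v * W) + (u * U - (- v) * W)"
        "2 * (v * W) = (u * U - (- v) * W) - (u * U - v * W)" by (simp_all add: algebra_simps)
      then have "2 * (u * U) = 0" "2 * (v * W) = 0" unfolding ab by simp_all
      then have uU: "u * U = 0" and vW: "v * W = 0" using two by simp_all
      have u0: "u \<noteq> 0" using vW x34 u v by (auto simp: W_def)
      have v0: "v \<noteq> 0" using uU x34 u v d by (auto simp: U_def)
      have U: "U = 0" and W: "W = 0" using uU vW u0 v0 by simp_all
      define b where "b = v / u"
      have vb: "v = b * u" and b0: "b \<noteq> 0" using u0 v0 by (simp_all add: b_def)
      have x4: "x $ 4 = b\<^sup>2 * x $ 3" unfolding u v vb by (simp add: power_mult_distrib)
      have x3: "x $ 3 \<noteq> 0" using u u0 by simp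
      have "x $ 3 * (b\<^sup>2 * x $ 1 + d * x $ 3) = U" by (simp add: U_def x4 algebra_simps power2_eq_square)
      then have x1: "b\<^sup>2 * x $ 1 + d * x $ 3 = 0" using U x3 by simp
      have "x $ 3 * (x $ 2 - b ^ 4 * x $ 3) = W" by (simp add: W_def x4 algebra_simps power_numeral_reduce)
      then have x2: "x $ 2 = b ^ 4 * x $ 3" using W x3 by simp
      have "x $ 3 * x $ 4 * cub x = (x $ 3) ^ 5 * (b^10 + f4 * b^8 + f3 * b^6 + f2 * b^4 + f1 * b^2 - d\<^sup>2)"
        unfolding cubic_identity U_def[symmetric] W_def[symmetric] U W unfolding x4
        by (simp add: algebra_simps power_numeral_reduce)
      then have b: "b \<in> B" using x(2) x3 by (simp add: mem_B)
      have "b * (b * x $ 1 + d / b * x $ 3) = 0" using x1 b0 by (simp add: algebra_simps power2_eq_square)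
      then have "b * x $ 1 + d / b * x $ 3 = 0" using b0 by (simp only: mult_eq_0_iff) simp
      moreover have "b * x $ 1 + (d / b + b ^ 4) * x $ 3 = (b * x $ 1 + d / b * x $ 3) + b ^ 4 * x $ 3"
        by (simp add: algebra_simps)
      ultimately have xm: "x \<in> conic_line d b" unfolding mem_conic_line by (simp add: x2 x4)
      \<comment> \<open>The exceptional point is approached along the line of the surface through it
        and \<open>(1, b, 0, 0)\<close>. There \<open>U = b W\<close>, so \<open>v = b u\<close>
        would give \<open>D = 0\<close> throughout; hence the other root \<open>- v\<close>.\<close>
      define y where "y = (\<lambda>l. x + l *s vec4 1 b 0 0)"
      have "mp_eval id H (($) (y l)) = 0" if "l \<noteq> 0" for l
      proof (rule hit[of "y l" u "- v"])
        have "y l \<in> conic_line d b" unfolding y_def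
          by (intro vec.subspace_add vec.subspace_scale line_subspace xm) (simp add: mem_conic_line)
        then show "cub (y l) = 0" by (rule cub_conic_line[OF b])
        show "y l $ 3 = u\<^sup>2" "y l $ 4 = (- v)\<^sup>2" using u v by (simp_all add: y_def)
        have "y l $ 4 * y l $ 1 + d * (y l $ 3)\<^sup>2 = U + l * x $ 4" "y l $ 3 * y l $ 2 - (y l $ 4)\<^sup>2 = W + l * b * x $ 3"
          by (simp_all add: y_def U_def W_def algebra_simps)
        then have "u * (y l $ 4 * y l $ 1 + d * (y l $ 3)\<^sup>2) - (- v) * (y l $ 3 * y l $ 2 - (y l $ 4)\<^sup>2) = 2 * (l * u * (b\<^sup>2 * x $ 3))"
          by (simp add: U W x4 vb algebra_simps power2_eq_square)
        then show "u * (y l $ 4 * y l $ 1 + d * (y l $ 3)\<^sup>2) - (- v) * (y l $ 3 * y l $ 2 - (y l $ 4)\<^sup>2) \<noteq> 0"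
          using that u0 b0 x3 two by simp
      qed
      then have "mp_eval id H (($) (x + 0 *s vec4 1 b 0 0)) = 0" unfolding y_def
        by - (rule mp_form_vec_line[OF inf, of "{0}"], auto)
      then show ?thesis by simp
    qed
  qed
qed

end

lemma unirational_cubic_poly:
  fixes d f1 f2 f3 f4 :: "'k::field"
  assumes inf: "infinite (UNIV :: 'k set)"
    and "cubic_data (to_ac d) (to_ac f1) (to_ac f2) (to_ac f3) (to_ac f4) B"
  shows "unirational_surface (cubic_poly d f1 f2 f3 f4)"
proof -
  interpret ac: field_emb "to_ac :: 'k \<Rightarrow> 'k alg_closure"
    by unfold_locales (rule field_embedding_to_ac)
  interpret cubic_data_closed "to_ac d" "to_ac f1" "to_ac f2" "to_ac f3" "to_ac f4" B
    using assms by (simp add: cubic_data_closed_def)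
  have inf': "infinite (UNIV :: 'k alg_closure set)"
    using inf inj_to_ac by (metis finite_imageD finite_subset subset_UNIV)
  \<comment> \<open>The parameter \<open>c\<close> needs degree 3 and is replaced by a cubic form in
    two further variables; with the last variable set to 1 it takes every value.\<close>
  define G :: "4 \<Rightarrow> (nat, 'k) mpoly" where
    "G = conic_param (mp_const d) (mp_const f1) (mp_const f2) (mp_const f3) (mp_const f4)
      (mp_var 0) (mp_var 1) (mp_var 2 * mp_var 3 * mp_var 3)"
  have eval: "(\<chi> j. mp_eval to_ac (G j) t) = pt (t 0) (t 1) (t 2 * t 3 * t 3)" for t
    unfolding G_def conic_point_def by (simp add: ac.mp_eval_conic_param del: One_nat_def single_one)
  have "mp_homogeneous 3 (mp_var 2 * mp_var 3 * mp_var 3 :: (nat, 'k) mpoly)"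
    using mp_homogeneous_mult[OF mp_homogeneous_mult[OF mp_homogeneous_var mp_homogeneous_var] mp_homogeneous_var]
    by (simp add: numeral_3_eq_3)
  then have hom: "mp_homogeneous 7 (G j)" for j
    unfolding G_def by (intro mp_homogeneous_conic_param mp_homogeneous_var)
  have vars: "mp_vars (G j) \<subseteq> {..3}" for j
    unfolding G_def by (intro mp_vars_conic_param mp_vars_mult mp_vars_var) auto
  \<comment> \<open>At \<open>(u, v, c) = (1, 0, 0)\<close> the third coordinate is
    \<open>2 d\<close>.\<close>
  have "G 3 \<noteq> 0"
  proof
    assume "G 3 = 0"
    then have "pt 1 0 0 $ 3 = 0"
      using arg_cong[OF eval[of "\<lambda>i. if i = 0 then 1 else 0"], of "\<lambda>x. x $ 3"] by simp
    then show False using two d by (simp add: conic_point_def conic_param_simps)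
  qed
  then have "rational_map_forms 3 G" unfolding rational_map_forms_def using hom vars by blast
  moreover have "rational_map_image to_ac G \<subseteq> surface_points to_ac (cubic_poly d f1 f2 f3 f4)"
    by (auto simp: rational_map_image_def surface_points_def ac.mp_eval_cubic_poly eval cubic_conic_point)
  moreover have "surface_points to_ac (cubic_poly d f1 f2 f3 f4) \<subseteq> Z"
    if closed: "zariski_closed Z" and sub: "rational_map_image to_ac G \<subseteq> Z" for Z
  proof
    fix x assume "x \<in> surface_points to_ac (cubic_poly d f1 f2 f3 f4)"
    then have x: "x \<noteq> 0" "cub x = 0" by (simp_all add: surface_points_def ac.mp_eval_cubic_poly)
    obtain T where T: "\<forall>H\<in>T. \<exists>d. mp_homogeneous d H" and Z: "Z = {x. x \<noteq> 0 \<and> (\<forall>H\<in>T. mp_eval id H (($) x) = 0)}"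
      using closed unfolding zariski_closed_def by blast
    have "mp_eval id H (($) x) = 0" if H: "H \<in> T" for H
    proof -
      obtain n where hom: "mp_homogeneous n H" using T H by blast
      show ?thesis
      proof (rule forms_vanishing_on_conic_points[OF inf' hom _ x])
        fix u v c assume nz: "pt u v c \<noteq> 0"
        have "pt u v c = (\<chi> j. mp_eval to_ac (G j) (\<lambda>i. if i = 0 then u else if i = 1 then v else if i = 2 then c else 1))"
          unfolding eval by simp
        then have "pt u v c \<in> rational_map_image to_ac G" unfolding rational_map_image_def using nz by blast
        then show "mp_eval id H (($) (pt u v c)) = 0" using sub H Z by blast
      qed
    qed
    then show "x \<in> Z" using Z x by blast
  qed
  ultimately show ?thesis unfolding unirational_surface_def by blast
qed

section \<open>Combinatorics of the 27 lines\<close>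

text \<open>Line 6 is the distinguished one; it is met by the ten lines \<open>conics\<close>, which form five
  pairs of incident lines. The list \<open>meets n\<close> contains, for each of the 16 lines \<open>n\<close> skew to
  line 6, the five among the ten that are met by \<open>n\<close>, exactly one from each pair.\<close>

definition conics :: "nat list" where
  "conics = [7, 8, 9, 10, 11, 23, 24, 25, 26, 27]"

definition partner :: "nat \<Rightarrow> nat" where
  "partner m = (if m \<le> 11 then m + 16 else m - 16)"

definition sections :: "nat list" where
  "sections = [1, 2, 3, 4, 5, 12, 13, 14, 15, 16, 17, 18, 19, 20, 21, 22]"

definition meets :: "nat \<Rightarrow> nat list" where
  "meets n = [[8, 9, 10, 11, 23], [7, 9, 10, 11, 24], [7, 8, 10, 11, 25], [7, 8, 9, 11, 26], [7, 8, 9, 10, 27],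
     [], [], [], [], [], [], [23, 24, 25, 26, 27],
     [7, 8, 25, 26, 27], [7, 9, 24, 26, 27], [8, 9, 23, 26, 27], [7, 10, 24, 25, 27], [8, 10, 23, 25, 27],
     [9, 10, 23, 24, 27], [7, 11, 24, 25, 26], [8, 11, 23, 25, 26], [9, 11, 23, 24, 26], [10, 11, 23, 24, 25],
     [], [], [], [], []] ! (n - 1)"

definition shared :: "nat \<Rightarrow> nat \<Rightarrow> nat list" where
  "shared m n = filter (List.member (meets m)) (meets n)"

text \<open>This table is what the equations of the lines yield directly, while
  \<open>reference_pairing\<close> comes from the lattice; the two are compared once, by
  evaluation.\<close>

definition incidence :: "nat \<Rightarrow> nat \<Rightarrow> int" where
  "incidence m n =
    (if m = n then -1
     else if m = 6 then (if n \<in> set conics then 1 else 0)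
     else if n = 6 then (if m \<in> set conics then 1 else 0)
     else if m \<in> set conics then
       (if n \<in> set conics then (if n = partner m then 1 else 0) else if m \<in> set (meets n) then 1 else 0)
     else if n \<in> set conics then (if n \<in> set (meets m) then 1 else 0)
     else if length (shared m n) = 1 then 1 else 0)"

lemma shared_altdef: "shared m n = filter (\<lambda>x. x \<in> set (meets m)) (meets n)"
  unfolding shared_def by (rule filter_cong) simp_all

lemma reference_pairing_eq_incidence:
  assumes "m \<in> {1..27}" "n \<in> {1..27}"
  shows "reference_pairing m n = incidence m n"
proof -
  have "\<forall>m\<in>set [1..<28]. \<forall>n\<in>set [1..<28]. reference_pairing m n = incidence m n"
    by code_simp
  then show ?thesis using assms by auto
qed

lemma label_cases: "n \<in> {1..27} \<longleftrightarrow> n = 6 \<or> n \<in> set conics \<or> n \<in> set sections"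
proof -
  have "set (6 # conics @ sections) = set [1..<28]" by code_simp
  also have "\<dots> = {1..27}" by auto
  finally have "{1..27} = set (6 # conics @ sections)" ..
  then show ?thesis by simp
qed

lemma label_disjoint:
  "6 \<notin> set conics" "6 \<notin> set sections" "m \<in> set conics \<Longrightarrow> m \<notin> set sections"
  by (auto simp: conics_def sections_def)

lemma partner_conics:
  assumes "m \<in> set conics"
  shows "partner m \<in> set conics" "partner (partner m) = m" "partner m \<noteq> m"
  using assms by (auto simp: conics_def partner_def)

lemma meets_sections:
  assumes "n \<in> set sections"
  shows "distinct (meets n)" "length (meets n) = 5" "set (meets n) \<subseteq> set conics"
    "set conics = set (meets n) \<union> partner ` set (meets n)"
    "set (meets n) \<inter> partner ` set (meets n) = {}"
proof -
  have "\<forall>n\<in>set sections. distinct (meets n) \<and> length (meets n) = 5 \<and> set (meets n) \<subseteq> set conics \<and>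
     set conics = set (meets n @ map partner (meets n)) \<and>
     (\<forall>x\<in>set (meets n). x \<notin> set (map partner (meets n)))"
    by code_simp
  with assms show "distinct (meets n)" "length (meets n) = 5" "set (meets n) \<subseteq> set conics"
    "set conics = set (meets n) \<union> partner ` set (meets n)"
    "set (meets n) \<inter> partner ` set (meets n) = {}"
    by auto
qed

text \<open>All sixteen selections have the same parity, so two of them differ in two or four of the
  five pairs, and there they contain partners.\<close>

lemma meets_two_sections:
  assumes "m \<in> set sections" "n \<in> set sections" "m \<noteq> n"
  shows "length (shared m n) = 1 \<or> length (shared m n) = 3"
    "set (meets m) = set (shared m n) \<union> partner ` (set (meets n) - set (meets m))"
proof -
  have "\<forall>m\<in>set sections. \<forall>n\<in>set sections. m \<noteq> n \<longrightarrow> (length (shared m n) = 1 \<or> length (shared m n) = 3) \<and>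
     set (meets m) = set (shared m n @ map partner (filter (Not \<circ> List.member (meets m)) (meets n)))"
    by code_simp
  with assms show "length (shared m n) = 1 \<or> length (shared m n) = 3"
    "set (meets m) = set (shared m n) \<union> partner ` (set (meets n) - set (meets m))"
    by auto
qed

text \<open>The sixteen lines realize the selections of one parity among all 32, and exchanging one
  element for its partner changes the parity.\<close>

lemma selection_cases:
  assumes "a1 \<in> {7, 23}" "a2 \<in> {8, 24}" "a3 \<in> {9, 25}" "a4 \<in> {10, 26}" "a5 \<in> {11, 27::nat}"
  obtains n where "n \<in> set sections" "set (meets n) = {a1, a2, a3, a4, a5}"
  | n where "n \<in> set sections" "set (meets n) = {partner a1, a2, a3, a4, a5}"
proof -
  have "\<forall>a1\<in>set [7, 23]. \<forall>a2\<in>set [8, 24]. \<forall>a3\<in>set [9, 25]. \<forall>a4\<in>set [10, 26]. \<forall>a5\<in>set [11, 27].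
    \<exists>n\<in>set sections. set (meets n) = set [a1, a2, a3, a4, a5] \<or> set (meets n) = set [partner a1, a2, a3, a4, a5]"
    by code_simp
  moreover have "a1 \<in> set [7, 23]" "a2 \<in> set [8, 24]" "a3 \<in> set [9, 25]" "a4 \<in> set [10, 26]" "a5 \<in> set [11, 27]"
    using assms by simp_all
  ultimately have "\<exists>n\<in>set sections. set (meets n) = set [a1, a2, a3, a4, a5] \<or> set (meets n) = set [partner a1, a2, a3, a4, a5]"
    by blast
  then show ?thesis using that by auto
qed

text \<open>An element of order 9 and a reflection that together act transitively.\<close>

definition perm9 :: "nat list" where
  "perm9 = [27, 7, 22, 1, 20, 21, 23, 11, 16, 5, 13, 14, 6, 15, 4, 12, 19, 10, 18, 2, 25, 8, 17, 3, 24, 9, 26]"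

text \<open>Exchanges the first and the third blown-up point.\<close>

definition perm2 :: "nat list" where
  "perm2 = [3, 2, 1, 4, 5, 6, 9, 8, 7, 10, 11, 12, 15, 14, 13, 18, 17, 16, 21, 20, 19, 22, 25, 24, 23, 26, 27]"

definition list_perm :: "nat list \<Rightarrow> nat \<Rightarrow> nat" where
  "list_perm xs n = (if 1 \<le> n \<and> n \<le> 27 then xs ! (n - 1) else n)"

lemma list_perm_G_max:
  assumes "set (map (list_perm xs) [1..<28]) = set [1..<28]"
    and "\<forall>m\<in>set [1..<28]. \<forall>n\<in>set [1..<28]. incidence (list_perm xs m) (list_perm xs n) = incidence m n"
  shows "list_perm xs \<in> G_max"
proof -
  have int: "{1..27} = set [1..<28::nat]" by auto
  have im: "list_perm xs ` {1..27} = {1..27}" using assms(1) unfolding int by simp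
  then have "bij_betw (list_perm xs) {1..27} {1..27}"
    by (simp add: bij_betw_def eq_card_imp_inj_on)
  then have "list_perm xs permutes {1..27}"
    by (rule bij_imp_permutes) (auto simp: list_perm_def)
  moreover have "reference_pairing (list_perm xs m) (list_perm xs n) = reference_pairing m n"
    if "m \<in> {1..27}" "n \<in> {1..27}" for m n
  proof -
    have "list_perm xs m \<in> {1..27}" "list_perm xs n \<in> {1..27}" using im that by blast+
    moreover have "incidence (list_perm xs m) (list_perm xs n) = incidence m n"
      using assms(2) that unfolding int by blast
    ultimately show ?thesis using that by (simp only: reference_pairing_eq_incidence)
  qed
  ultimately show ?thesis by (simp add: G_max_def pairing_group_def)
qed

lemma perm9_G_max: "list_perm perm9 \<in> G_max"
  by (rule list_perm_G_max) code_simp+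

lemma perm2_G_max: "list_perm perm2 \<in> G_max"
  by (rule list_perm_G_max) code_simp+

lemma G_max_id: "id \<in> G_max"
  by (simp add: G_max_def pairing_group_def permutes_id)

lemma G_max_comp: "p \<in> G_max \<Longrightarrow> q \<in> G_max \<Longrightarrow> p \<circ> q \<in> G_max"
  unfolding G_max_def pairing_group_def using permutes_in_image[of q "{1..27}"]
  by (auto simp: permutes_compose)

lemma G_max_inv:
  assumes "p \<in> G_max"
  shows "inv_into UNIV p \<in> G_max"
proof -
  have p: "p permutes {1..27}" using assms by (simp add: G_max_def pairing_group_def)
  have "reference_pairing (inv_into UNIV p m) (inv_into UNIV p n) = reference_pairing m n" if "m \<in> {1..27}" "n \<in> {1..27}" for m n
  proof -
    have "inv_into UNIV p m \<in> {1..27}" "inv_into UNIV p n \<in> {1..27}"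
      using permutes_in_image[OF permutes_inv[OF p]] that by blast+
    then have "reference_pairing (p (inv_into UNIV p m)) (p (inv_into UNIV p n)) = reference_pairing (inv_into UNIV p m) (inv_into UNIV p n)"
      using assms by (simp add: G_max_def pairing_group_def)
    then show ?thesis by (simp add: permutes_inverses[OF p])
  qed
  then show ?thesis using permutes_inv[OF p] by (simp add: G_max_def pairing_group_def)
qed

lemma G_max_transitive:
  assumes "a \<in> {1..27}"
  obtains g where "g \<in> G_max" "g 6 = a"
proof -
  let ?p = "list_perm perm9" and ?q = "list_perm perm2"
  \<comment> \<open>The three nine-cycles of \<open>perm9\<close>; \<open>perm2\<close> leads into
    the second by \<open>3 \<mapsto> 1\<close> and into the third by
    \<open>21 \<mapsto> 19\<close>.\<close>
  define orbit :: "nat list" where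
    "orbit = [6, 21, 25, 24, 3, 22, 8, 11, 13, 1, 27, 26, 9, 16, 12, 14, 15, 4, 19, 18, 10, 5, 20, 2, 7, 23, 17]"
  have step: "\<forall>i\<in>set [1..<27]. orbit ! i = ?p (orbit ! (i - 1)) \<or> (\<exists>j\<in>set [0..<i]. orbit ! i = ?q (orbit ! j))"
    unfolding orbit_def by code_simp
  have reach: "\<exists>g\<in>G_max. g 6 = orbit ! i" if "i < 27" for i
    using that
  proof (induction i rule: less_induct)
    case (less i)
    show ?case
    proof (cases "i = 0")
      case True
      then show ?thesis using G_max_id by (intro bexI[of _ id]) (simp_all add: orbit_def)
    next
      case False
      then have "i \<in> set [1..<27]" using less.prems by simp
      with step consider "orbit ! i = ?p (orbit ! (i - 1))" | j where "j < i" "orbit ! i = ?q (orbit ! j)"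
        by (metis atLeastLessThan_iff set_upt)
      then show ?thesis
      proof cases
        case 1
        then show ?thesis using less.IH[of "i - 1"] less.prems False G_max_comp[OF perm9_G_max]
          by (metis comp_apply diff_less less_imp_diff_less less_one neq0_conv)
      next
        case 2
        then show ?thesis using less.IH[of j] less.prems G_max_comp[OF perm2_G_max]
          by (metis comp_apply less_trans)
      qed
    qed
  qed
  have "a \<in> set orbit"
  proof -
    have "set [1..<28] = set orbit" unfolding orbit_def by code_simp
    then show ?thesis using assms by auto
  qed
  moreover have "length orbit = 27" by (simp add: orbit_def)
  ultimately obtain i where "i < 27" "orbit ! i = a" by (auto simp: in_set_conv_nth)
  with reach obtain g where "g \<in> G_max" "g 6 = a" by blast
  then show ?thesis by (rule that)
qed

section \<open>The numbered lines\<close>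

text \<open>Opaque letters for the elementary symmetric functions keep the later polynomial
  identities small.\<close>

lemma quartic_sign_change:
  fixes x1 :: "'a::comm_ring_1"
  obtains a0 a1 a2 a3 where
    "[:- x1, 1:] * ([:- x2, 1:] * ([:- x3, 1:] * [:- x4, 1:])) = [:a0, a1, a2, a3, 1:]"
    "[:x1, 1:] * ([:x2, 1:] * ([:x3, 1:] * [:x4, 1:])) = [:a0, - a1, a2, - a3, 1:]"
proof
  show "[:- x1, 1:] * ([:- x2, 1:] * ([:- x3, 1:] * [:- x4, 1:])) = [:x1 * x2 * x3 * x4,
    - (x1 * x2 * x3 + x1 * x2 * x4 + x1 * x3 * x4 + x2 * x3 * x4),
    x1 * x2 + x1 * x3 + x1 * x4 + x2 * x3 + x2 * x4 + x3 * x4, - (x1 + x2 + x3 + x4), 1:]"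
    "[:x1, 1:] * ([:x2, 1:] * ([:x3, 1:] * [:x4, 1:])) = [:x1 * x2 * x3 * x4,
    - (- (x1 * x2 * x3 + x1 * x2 * x4 + x1 * x3 * x4 + x2 * x3 * x4)),
    x1 * x2 + x1 * x3 + x1 * x4 + x2 * x3 + x2 * x4 + x3 * x4, - (- (x1 + x2 + x3 + x4)), 1:]"
    by (simp_all add: algebra_simps)
qed

text \<open>The second polynomial is \<open>- p(- T)\<close> if \<open>p\<close> denotes the
  first.\<close>

lemma quintic_sign_change:
  fixes x1 :: "'a::comm_ring_1"
  obtains c0 c1 c2 c3 c4 where
    "[:- x1, 1:] * ([:- x2, 1:] * ([:- x3, 1:] * ([:- x4, 1:] * [:- x5, 1:]))) = [:c0, c1, c2, c3, c4, 1:]"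
    "[:x1, 1:] * ([:x2, 1:] * ([:x3, 1:] * ([:x4, 1:] * [:x5, 1:]))) = [:- c0, c1, - c2, c3, - c4, 1:]"
proof -
  obtain a0 a1 a2 a3 where a:
    "[:- x2, 1:] * ([:- x3, 1:] * ([:- x4, 1:] * [:- x5, 1:])) = [:a0, a1, a2, a3, 1:]"
    "[:x2, 1:] * ([:x3, 1:] * ([:x4, 1:] * [:x5, 1:])) = [:a0, - a1, a2, - a3, 1:]"
    by (rule quartic_sign_change)
  show ?thesis
    by (rule that[of "- x1 * a0" "a0 - x1 * a1" "a1 - x1 * a2" "a2 - x1 * a3" "a3 - x1"]; unfold a)
      (simp_all add: algebra_simps)
qed

text \<open>Labels are attached to all ten lines, with the signs built in by \<open>odd\<close>; in
  this form injectivity means that the five squares are distinct and nonzero.\<close>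

locale line_labels =
  fixes \<beta> :: "nat \<Rightarrow> 'a::field"
  assumes two: "(2::'a) \<noteq> 0"
    and odd: "m \<in> set conics \<Longrightarrow> \<beta> (partner m) = - \<beta> m"
    and inj: "inj_on \<beta> (set conics)"
begin

definition label_poly :: "nat \<Rightarrow> 'a poly" where
  "label_poly n = (\<Prod>m\<in>set (meets n). [:- \<beta> m, 1:])"

definition all_poly :: "'a poly" where
  "all_poly = (\<Prod>m\<in>set conics. [:- \<beta> m, 1:])"

definition "d = poly.coeff (label_poly 12) 0"
definition "f1 = poly.coeff all_poly 2"
definition "f2 = poly.coeff all_poly 4"
definition "f3 = poly.coeff all_poly 6"
definition "f4 = poly.coeff all_poly 8"

lemma beta_nonzero: "m \<in> set conics \<Longrightarrow> \<beta> m \<noteq> 0"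
  using odd[of m] inj_onD[OF inj, of "partner m" m] partner_conics[of m] by auto

text \<open>Two selections differ by an even number of sign changes, so their labels have the same
  product.\<close>

lemma const_label_poly:
  assumes "n \<in> set sections"
  shows "poly.coeff (label_poly n) 0 = d"
proof -
  have "\<beta> 7 = - \<beta> 23" "\<beta> 8 = - \<beta> 24" "\<beta> 9 = - \<beta> 25" "\<beta> 10 = - \<beta> 26" "\<beta> 11 = - \<beta> 27"
    using odd[of 23] odd[of 24] odd[of 25] odd[of 26] odd[of 27] by (simp_all add: partner_def conics_def)
  then show ?thesis
    using assms by (auto simp: sections_def d_def label_poly_def meets_def poly_0_coeff_0[symmetric] poly_prod)
qed

text \<open>A selection and its partners exhaust \<open>conics\<close>, so the product of all ten
  factors is \<open>p(T) * (- p(- T))\<close> for \<open>p = label_poly n\<close>.\<close>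

lemma label_poly_expand:
  assumes "n \<in> set sections"
  obtains c1 c2 c3 c4 where "label_poly n = [:d, c1, c2, c3, c4, 1:]"
    "all_poly = [:d, c1, c2, c3, c4, 1:] * [:- d, c1, - c2, c3, - c4, 1:]"
proof -
  obtain m1 m2 m3 m4 m5 where m: "meets n = [m1, m2, m3, m4, m5]"
    using meets_sections(2)[OF assms] by (auto simp: eval_nat_numeral length_Suc_conv)
  have sub: "set (meets n) \<subseteq> set conics" by (rule meets_sections(3)[OF assms])
  obtain c0 c1 c2 c3 c4 where c:
    "[:- \<beta> m1, 1:] * ([:- \<beta> m2, 1:] * ([:- \<beta> m3, 1:] * ([:- \<beta> m4, 1:] * [:- \<beta> m5, 1:]))) = [:c0, c1, c2, c3, c4, 1:]"
    "[:\<beta> m1, 1:] * ([:\<beta> m2, 1:] * ([:\<beta> m3, 1:] * ([:\<beta> m4, 1:] * [:\<beta> m5, 1:]))) = [:- c0, c1, - c2, c3, - c4, 1:]"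
    by (rule quintic_sign_change)
  have list: "(\<Prod>m\<in>set (meets n). g m) = g m1 * (g m2 * (g m3 * (g m4 * g m5)))" for g :: "nat \<Rightarrow> 'a poly"
    unfolding prod.distinct_set_conv_list[OF meets_sections(1)[OF assms]] unfolding m by simp
  have p: "label_poly n = [:c0, c1, c2, c3, c4, 1:]" unfolding label_poly_def list c ..
  have inj': "inj_on partner (set (meets n))"
    using sub partner_conics(2) by (metis inj_on_inverseI subsetD)
  have "all_poly = (\<Prod>m\<in>set (meets n). [:- \<beta> m, 1:]) * (\<Prod>m\<in>partner ` set (meets n). [:- \<beta> m, 1:])"
    unfolding all_poly_def meets_sections(4)[OF assms]
    by (rule prod.union_disjoint) (use meets_sections(5)[OF assms] in auto)
  also have "(\<Prod>m\<in>partner ` set (meets n). [:- \<beta> m, 1:]) = (\<Prod>m\<in>set (meets n). [:\<beta> m, 1:])"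
    unfolding prod.reindex[OF inj'] by (rule prod.cong) (use sub odd in auto)
  finally have "all_poly = [:c0, c1, c2, c3, c4, 1:] * [:- c0, c1, - c2, c3, - c4, 1:]"
    unfolding list c .
  moreover have "c0 = d" using const_label_poly[OF assms] p by simp
  ultimately show ?thesis using p by (intro that) simp_all
qed

lemma label_12: "12 \<in> set sections"
  by (simp add: sections_def)

lemma section_poly_iff:
  "[:d, c1, c2, c3, c4, 1:] * [:- d, c1, - c2, c3, - c4, 1:] = [:- d\<^sup>2, 0, g1, 0, g2, 0, g3, 0, g4, 0, 1:] \<longleftrightarrow>
    g4 = 2 * c3 - c4\<^sup>2 \<and> g3 = c3\<^sup>2 + 2 * c1 - 2 * c4 * c2 \<and>
    g2 = 2 * c3 * c1 - c2\<^sup>2 - 2 * c4 * d \<and> g1 = c1\<^sup>2 - 2 * c2 * d"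
  by (auto simp: algebra_simps power2_eq_square)

lemma all_poly_eq: "all_poly = [:- d\<^sup>2, 0, f1, 0, f2, 0, f3, 0, f4, 0, 1:]"
proof -
  obtain c1 c2 c3 c4 where *: "all_poly = [:d, c1, c2, c3, c4, 1:] * [:- d, c1, - c2, c3, - c4, 1:]"
    using label_poly_expand[OF label_12] by metis
  have "\<exists>g1 g2 g3 g4. all_poly = [:- d\<^sup>2, 0, g1, 0, g2, 0, g3, 0, g4, 0, 1:]"
    unfolding * section_poly_iff by simp
  then obtain g1 g2 g3 g4 where g: "all_poly = [:- d\<^sup>2, 0, g1, 0, g2, 0, g3, 0, g4, 0, 1:]" by blast
  then have "f1 = g1" "f2 = g2" "f3 = g3" "f4 = g4"
    by (simp_all add: f1_def f2_def f3_def f4_def numeral_eq_Suc)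
  with g show ?thesis by simp
qed

sublocale cubic_data d f1 f2 f3 f4 "\<beta> ` set conics"
proof
  have "- d\<^sup>2 = poly all_poly 0" by (simp add: all_poly_eq)
  also have "\<dots> = (\<Prod>m\<in>set conics. - \<beta> m)" by (simp add: all_poly_def poly_prod)
  also have "\<dots> \<noteq> 0" using beta_nonzero by simp
  finally show "d \<noteq> 0" by auto
  show "[:- d\<^sup>2, 0, f1, 0, f2, 0, f3, 0, f4, 0, 1:] = (\<Prod>b\<in>\<beta> ` set conics. [:- b, 1:])"
    unfolding prod.reindex[OF inj] by (simp flip: all_poly_eq add: all_poly_def)
qed (use two in simp_all)

lemma section_poly_label_poly: "n \<in> set sections \<Longrightarrow> section_poly (label_poly n)"
  using label_poly_expand[of n] section_poly_iff[of _ _ _ _ f1 f2 f3 f4] unfolding all_poly_eq section_poly_def by metis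

lemma poly_label_poly: "n \<in> set sections \<Longrightarrow> m \<in> set conics \<Longrightarrow> poly (label_poly n) (\<beta> m) = 0 \<longleftrightarrow> m \<in> set (meets n)"
  using inj_onD[OF inj, of m] meets_sections(3)[of n] by (auto simp: label_poly_def poly_prod)

lemma beta_add_nonzero:
  assumes "n \<in> set sections" "k \<in> set (meets n)" "m \<in> set (meets n)"
  shows "\<beta> k + \<beta> m \<noteq> 0"
proof
  assume "\<beta> k + \<beta> m = 0"
  then have "\<beta> k = - \<beta> m" by (simp only: eq_neg_iff_add_eq_0)
  then have "\<beta> k = \<beta> (partner m)"
    using odd[of m] meets_sections(3)[OF assms(1)] assms(3) by auto
  then have "k = partner m"
    using inj_onD[OF inj] meets_sections(3)[OF assms(1)] assms(2,3) partner_conics(1) by (metis subsetD)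
  then show False using meets_sections(5)[OF assms(1)] assms by blast
qed

text \<open>Each pair contains a label that is a root of \<open>p\<close>, so \<open>p\<close> is
  the product over some selection. A selection of the wrong parity would have constant coefficient
  \<open>- d\<close> instead of \<open>d\<close>.\<close>

lemma section_poly_imp_label_poly:
  assumes "section_poly p"
  obtains n where "n \<in> set sections" "p = label_poly n"
proof -
  obtain c1 c2 c3 c4 where p: "p = [:d, c1, c2, c3, c4, 1:]"
    and c: "[:d, c1, c2, c3, c4, 1:] * [:- d, c1, - c2, c3, - c4, 1:] = all_poly"
    using assms unfolding section_poly_def all_poly_eq section_poly_iff by metis
  have sel: "poly p (\<beta> m) = 0 \<or> poly p (\<beta> (partner m)) = 0" if "m \<in> set conics" for m
  proof -
    have "poly p (\<beta> m) * poly [:- d, c1, - c2, c3, - c4, 1:] (\<beta> m) = poly all_poly (\<beta> m)"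
      by (simp only: p c[symmetric] poly_mult)
    also have "\<dots> = 0" using that by (auto simp: all_poly_def poly_prod)
    also have "poly [:- d, c1, - c2, c3, - c4, 1:] (\<beta> m) = - poly p (- \<beta> m)"
      by (simp add: p algebra_simps)
    finally show ?thesis using odd[OF that] by simp
  qed
  have ex: "\<exists>m\<in>{m, partner m}. poly p (\<beta> m) = 0" if "m \<in> set conics" for m
    using sel[OF that] by blast
  obtain a1 where a1: "a1 \<in> {7, 23}" "poly p (\<beta> a1) = 0" using ex[of 7] by (auto simp: conics_def partner_def)
  obtain a2 where a2: "a2 \<in> {8, 24}" "poly p (\<beta> a2) = 0" using ex[of 8] by (auto simp: conics_def partner_def)
  obtain a3 where a3: "a3 \<in> {9, 25}" "poly p (\<beta> a3) = 0" using ex[of 9] by (auto simp: conics_def partner_def)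
  obtain a4 where a4: "a4 \<in> {10, 26}" "poly p (\<beta> a4) = 0" using ex[of 10] by (auto simp: conics_def partner_def)
  obtain a5 where a5: "a5 \<in> {11, 27}" "poly p (\<beta> a5) = 0" using ex[of 11] by (auto simp: conics_def partner_def)
  note a = a1(1) a2(1) a3(1) a4(1) a5(1)
  have root: "\<forall>m\<in>{a1, a2, a3, a4, a5}. poly p (\<beta> m) = 0" using a1 a2 a3 a4 a5 by simp
  define S where "S = {a1, a2, a3, a4, a5}"
  have S: "S \<subseteq> set conics" and dist: "distinct [a1, a2, a3, a4, a5]"
    using a by (auto simp: S_def conics_def)
  then have cardS: "card S = 5" unfolding S_def by (simp add: card_insert_if)
  \<comment> \<open>Both sides are monic of degree 5, so their difference has degree at most 4, yet
    it vanishes at five labels.\<close>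
  have prod_S: "p = (\<Prod>m\<in>S. [:- \<beta> m, 1:])"
  proof (rule ccontr)
    define r where "r = p - (\<Prod>m\<in>S. [:- \<beta> m, 1:])"
    assume "p \<noteq> (\<Prod>m\<in>S. [:- \<beta> m, 1:])"
    then have r0: "r \<noteq> 0" by (simp add: r_def)
    obtain b0 b1 b2 b3 b4 where "(\<Prod>m\<in>S. [:- \<beta> m, 1:]) = [:b0, b1, b2, b3, b4, 1:]"
    proof -
      have "(\<Prod>m\<in>S. [:- \<beta> m, 1:]) = [:- \<beta> a1, 1:] * ([:- \<beta> a2, 1:] * ([:- \<beta> a3, 1:] * ([:- \<beta> a4, 1:] * [:- \<beta> a5, 1:])))"
        unfolding S_def using dist by simp
      moreover obtain b0 b1 b2 b3 b4 where "\<dots> = [:b0, b1, b2, b3, b4, 1:]" by (rule quintic_sign_change)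
      ultimately have "(\<Prod>m\<in>S. [:- \<beta> m, 1:]) = [:b0, b1, b2, b3, b4, 1:]" by (rule trans)
      then show ?thesis by (rule that)
    qed
    then have "r = [:d - b0, c1 - b1, c2 - b2, c3 - b3, c4 - b4:]" by (simp add: r_def p)
    then have "Polynomial.degree r \<le> 4" by (auto intro!: degree_le simp: coeff_pCons split: nat.splits)
    moreover have "card {x. poly r x = 0} \<le> Polynomial.degree r" by (rule card_poly_roots_bound[OF r0])
    moreover have "\<beta> ` S \<subseteq> {x. poly r x = 0}" using root by (auto simp: r_def poly_prod S_def)
    then have "card (\<beta> ` S) \<le> card {x. poly r x = 0}" by (intro card_mono poly_roots_finite r0)
    moreover have "card (\<beta> ` S) = 5" using cardS inj_on_subset[OF inj S] by (simp add: card_image)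
    ultimately show False by simp
  qed
  from a show ?thesis
  proof (cases rule: selection_cases)
    case (1 n)
    then show ?thesis using that prod_S by (simp add: label_poly_def S_def)
  next
    case (2 n)
    have a1': "a1 \<in> set conics" using S by (simp add: S_def)
    define k where "k = (\<Prod>m\<in>{a2, a3, a4, a5}. - \<beta> m)"
    have "partner a1 \<notin> {a2, a3, a4, a5}" using a by (auto simp: partner_def)
    then have "d = - \<beta> (partner a1) * k"
      using const_label_poly[OF 2(1)] by (simp add: label_poly_def 2(2) k_def poly_0_coeff_0[symmetric] poly_prod)
    moreover have "d = - \<beta> a1 * k"
    proof -
      have "d = poly p 0" by (simp add: p)
      also have "\<dots> = - \<beta> a1 * k" using dist by (simp add: prod_S S_def k_def poly_prod)
      finally show ?thesis .
    qed
    ultimately have "d = \<beta> a1 * k" "d = - (\<beta> a1 * k)" using odd[OF a1'] by simp_all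
    then have "d + d = 0" by (metis add.right_inverse)
    then have "2 * d = 0" by simp
    then show ?thesis using two d by simp
  qed
qed

definition \<nu> :: "nat \<Rightarrow> ('a ^ 4) set" where
  "\<nu> n = (if n = 6 then line0 else if n \<in> set conics then conic_line d (\<beta> n) else section_line (label_poly n))"

lemma nu_simps:
  "\<nu> 6 = line0" "n \<in> set conics \<Longrightarrow> \<nu> n = conic_line d (\<beta> n)"
  "n \<in> set sections \<Longrightarrow> \<nu> n = section_line (label_poly n)"
  using label_disjoint by (auto simp: \<nu>_def)

text \<open>With \<open>C\<close> the product over the shared lines, the quintics are
  \<open>C(T) A(T)\<close> and \<open>C(T) A(- T)\<close>, where \<open>A\<close> has degree 4 or 2.
  For degree 4 the determinant of \<open>section_lines_inter\<close> vanishes identically; for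
  degree 2 it is a nonzero multiple of the product of the pairwise sums of the three shared
  labels.\<close>

lemma section_pairing:
  assumes m: "m \<in> set sections" and n: "n \<in> set sections" and "m \<noteq> n"
  shows "section_line (label_poly m) \<inter> section_line (label_poly n) \<noteq> {0} \<longleftrightarrow> length (shared m n) = 1"
proof -
  define R where "R = filter (\<lambda>x. x \<notin> set (meets m)) (meets n)"
  define S where "S = shared m n"
  have len: "length S + length R = 5"
    unfolding S_def R_def shared_altdef using sum_length_filter_compl meets_sections(2)[OF n] by metis
  have dist: "distinct S" "distinct R"
    using meets_sections(1)[OF n] by (simp_all add: S_def R_def shared_altdef)
  have un: "set (meets n) = set S \<union> set R" "set S \<inter> set R = {}" by (auto simp: S_def R_def shared_altdef)
  have um: "set (meets m) = set S \<union> partner ` set R"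
    using meets_two_sections(2)[OF assms] by (simp add: S_def R_def set_diff_eq)
  have sub: "set R \<subseteq> set conics" using meets_sections(3)[OF n] by (auto simp: R_def)
  have dm: "set S \<inter> partner ` set R = {}"
    using meets_sections(5)[OF n] un(1) by blast
  have inj': "inj_on partner (set R)"
    using sub partner_conics(2) by (metis inj_on_inverseI subsetD)
  have pn: "label_poly n = (\<Prod>x\<in>set S. [:- \<beta> x, 1:]) * (\<Prod>x\<in>set R. [:- \<beta> x, 1:])"
    unfolding label_poly_def un(1) by (rule prod.union_disjoint) (use un in auto)
  have "label_poly m = (\<Prod>x\<in>set S. [:- \<beta> x, 1:]) * (\<Prod>x\<in>partner ` set R. [:- \<beta> x, 1:])"
    unfolding label_poly_def um by (rule prod.union_disjoint) (use dm in auto)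
  also have "(\<Prod>x\<in>partner ` set R. [:- \<beta> x, 1:]) = (\<Prod>x\<in>set R. [:\<beta> x, 1:])"
    unfolding prod.reindex[OF inj'] by (rule prod.cong) (use sub odd in auto)
  finally have pm: "label_poly m = (\<Prod>x\<in>set S. [:- \<beta> x, 1:]) * (\<Prod>x\<in>set R. [:\<beta> x, 1:])" .
  note lists = prod.distinct_set_conv_list[OF dist(1)] prod.distinct_set_conv_list[OF dist(2)]
  have lists': "prod_list (map g [x1]) = g x1" "prod_list (map g [x1, x2]) = g x1 * g x2"
    "prod_list (map g [x1, x2, x3]) = g x1 * (g x2 * g x3)"
    "prod_list (map g [x1, x2, x3, x4]) = g x1 * (g x2 * (g x3 * g x4))"
    for g :: "nat \<Rightarrow> 'a poly" and x1 x2 x3 x4 by simp_all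
  have nz: "\<beta> x + \<beta> y \<noteq> 0" if "x \<in> set S \<union> set R" "y \<in> set S \<union> set R" for x y
    using beta_add_nonzero[OF n] that un by simp
  from meets_two_sections(1)[OF assms] show ?thesis
  proof
    assume "length (shared m n) = 1"
    then have lS: "length S = 1" and lR: "length R = 4" using len by (simp_all add: S_def)
    obtain s where s: "S = [s]" using lS by (auto simp: length_Suc_conv)
    obtain r1 r2 r3 r4 where r: "R = [r1, r2, r3, r4]" using lR by (auto simp: eval_nat_numeral length_Suc_conv)
    obtain a0 a1 a2 a3 where
      a: "[:- \<beta> r1, 1:] * ([:- \<beta> r2, 1:] * ([:- \<beta> r3, 1:] * [:- \<beta> r4, 1:])) = [:a0, a1, a2, a3, 1:]"
      "[:\<beta> r1, 1:] * ([:\<beta> r2, 1:] * ([:\<beta> r3, 1:] * [:\<beta> r4, 1:])) = [:a0, - a1, a2, - a3, 1:]"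
      by (rule quartic_sign_change)
    have "label_poly n = [:- \<beta> s, 1:] * [:a0, a1, a2, a3, 1:]" "label_poly m = [:- \<beta> s, 1:] * [:a0, - a1, a2, - a3, 1:]"
      unfolding pn pm lists unfolding s r lists' a by (rule refl)+
    then show ?thesis unfolding section_lines_inter using lS
      by (simp add: numeral_eq_Suc S_def)
  next
    assume l: "length (shared m n) = 3"
    then have lS: "length S = 3" and lR: "length R = 2" using len by (simp_all add: S_def)
    obtain s1 s2 s3 where s: "S = [s1, s2, s3]" using lS by (auto simp: eval_nat_numeral length_Suc_conv)
    obtain r1 r2 where r: "R = [r1, r2]" using lR by (auto simp: eval_nat_numeral length_Suc_conv)
    define x y z where "x = - (\<beta> s1 + \<beta> s2 + \<beta> s3)" and "y = \<beta> s1 * \<beta> s2 + \<beta> s1 * \<beta> s3 + \<beta> s2 * \<beta> s3"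
      and "z = - (\<beta> s1 * \<beta> s2 * \<beta> s3)"
    define a b where "a = \<beta> r1 + \<beta> r2" and "b = \<beta> r1 * \<beta> r2"
    have C: "[:- \<beta> s1, 1:] * ([:- \<beta> s2, 1:] * [:- \<beta> s3, 1:]) = [:z, y, x, 1:]"
      by (simp add: x_def y_def z_def algebra_simps)
    have A: "[:- \<beta> r1, 1:] * [:- \<beta> r2, 1:] = [:b, - a, 1:]" "[:\<beta> r1, 1:] * [:\<beta> r2, 1:] = [:b, a, 1:]"
      by (simp_all add: a_def b_def algebra_simps)
    have "label_poly n = [:z, y, x, 1:] * [:b, - a, 1:]" "label_poly m = [:z, y, x, 1:] * [:b, a, 1:]"
      unfolding pn pm lists unfolding s r lists' A C by (rule refl)+
    then have "section_line (label_poly m) \<inter> section_line (label_poly n) \<noteq> {0} \<longleftrightarrow> (2 * a * y) * (2 * a * x) = (2 * a * z) * (2 * a)"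
      unfolding section_lines_inter by (simp add: numeral_eq_Suc algebra_simps)
    also have "\<dots> \<longleftrightarrow> (2 * a) ^ 2 * (x * y - z) = 0"
      by (simp add: algebra_simps power2_eq_square)
    finally have iff: "section_line (label_poly m) \<inter> section_line (label_poly n) \<noteq> {0} \<longleftrightarrow> (2 * a) ^ 2 * (x * y - z) = 0" .
    have "x * y - z = - ((\<beta> s1 + \<beta> s2) * (\<beta> s1 + \<beta> s3) * (\<beta> s2 + \<beta> s3))"
      by (simp add: x_def y_def z_def algebra_simps)
    moreover have "\<beta> s1 + \<beta> s2 \<noteq> 0" "\<beta> s1 + \<beta> s3 \<noteq> 0" "\<beta> s2 + \<beta> s3 \<noteq> 0" "a \<noteq> 0"
      unfolding a_def by (rule nz; simp add: s r)+
    moreover have "(4::'a) \<noteq> 0" using two mult_eq_0_iff[of "2::'a" 2] by simp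
    ultimately show ?thesis using iff l by simp
  qed
qed

text \<open>Since \<open>line_pairing\<close> tests equality first, intersecting lines must also be
  shown to be distinct; where the equations do not tell, a third line does that meets only one of
  them.\<close>

lemma nu_pairing:
  assumes "m \<in> {1..27}" "n \<in> {1..27}"
  shows "line_pairing (\<nu> m) (\<nu> n) = incidence m n"
proof -
  have conic_section: "conic_line d (\<beta> k) \<inter> section_line (label_poly l) \<noteq> {0} \<longleftrightarrow> k \<in> set (meets l)"
    if k: "k \<in> set conics" and l: "l \<in> set sections" for k l
  proof -
    obtain c1 c2 c3 c4 where "label_poly l = [:d, c1, c2, c3, c4, 1:]"
      using label_poly_expand[OF l] by metis
    from conic_line_inter_section_line[OF beta_nonzero[OF k] this] show ?thesis
      using poly_label_poly[OF l k] by simp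
  qed
  have sym: "line_pairing L M = line_pairing M L" for L M :: "('a ^ 4) set"
    by (auto simp: line_pairing_def Int_commute)
  have nonzero: "\<exists>x. x \<noteq> 0 \<and> x \<in> L" if "vec.dim L = 2" for L :: "('a ^ 4) set"
  proof (rule ccontr)
    assume "\<not> ?thesis"
    then have "L \<subseteq> {0}" by blast
    then show False using that vec.dim_eq_0[of L] by simp
  qed
  have disj: "line_pairing L M = 0" if "L \<inter> M = {0}" "vec.dim L = 2" for L M :: "('a ^ 4) set"
    using that nonzero[of L] by (auto simp: line_pairing_def)
  have meet: "line_pairing L M = 1" if "L \<inter> M \<noteq> {0}" "L \<noteq> M" for L M :: "('a ^ 4) set"
    using that by (simp add: line_pairing_def)
  have L_conic: "line_pairing line0 (\<nu> k) = 1" if "k \<in> set conics" for k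
    using that conic_line_ne_line0 line0_inter_conic_line by (metis meet nu_simps(2))
  have L_section: "line_pairing line0 (\<nu> k) = 0" if "k \<in> set sections" for k
    using that by (simp add: disj nu_simps line0_inter_section_line)
  have C_section: "line_pairing (\<nu> k) (\<nu> l) = (if k \<in> set (meets l) then 1 else 0)"
    if "k \<in> set conics" "l \<in> set sections" for k l
  proof (cases "k \<in> set (meets l)")
    case True
    have "\<nu> k \<noteq> \<nu> l"
      using that L_conic[of k] L_section[of l] by auto
    with True show ?thesis using that conic_section[OF that] by (simp add: meet nu_simps)
  next
    case False
    then show ?thesis using that conic_section[OF that] by (simp add: disj nu_simps)
  qed
  have C_C: "line_pairing (\<nu> k) (\<nu> l) = (if k = l then -1 else if l = partner k then 1 else 0)"
    if "k \<in> set conics" "l \<in> set conics" for k l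
  proof -
    consider "k = l" | "k \<noteq> l" "l = partner k" | "k \<noteq> l" "l \<noteq> partner k" by blast
    then show ?thesis
    proof cases
      case 1
      then show ?thesis by (simp add: line_pairing_def)
    next
      case 2
      have "\<beta> k \<noteq> \<beta> l" using 2 inj_onD[OF inj] that by blast
      then have "conic_line d (\<beta> k) \<noteq> conic_line d (\<beta> l)" using conic_line_inj by blast
      moreover have "conic_line d (\<beta> k) \<inter> conic_line d (\<beta> l) \<noteq> {0}"
        using 2 that odd conic_lines_partner[of "\<beta> k" d] beta_nonzero by simp
      ultimately show ?thesis using 2 that meet by (simp add: nu_simps)
    next
      case 3
      have "\<beta> k \<noteq> \<beta> l" "\<beta> (partner k) \<noteq> \<beta> l" using 3 inj_onD[OF inj] that partner_conics(1) by blast+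
      then have "\<beta> k - \<beta> l \<noteq> 0" "\<beta> k + \<beta> l \<noteq> 0" using odd[OF that(1)] by (auto simp: add_eq_0_iff)
      then have "(\<beta> k - \<beta> l) * (\<beta> k + \<beta> l) \<noteq> 0" by simp
      then have "(\<beta> k)\<^sup>2 \<noteq> (\<beta> l)\<^sup>2" by (simp add: algebra_simps power2_eq_square)
      then show ?thesis using 3 that \<open>\<beta> k \<noteq> \<beta> l\<close> by (simp add: disj nu_simps conic_lines_disjoint)
    qed
  qed
  have S_S: "line_pairing (\<nu> k) (\<nu> l) = (if k = l then -1 else if length (shared k l) = 1 then 1 else 0)"
    if "k \<in> set sections" "l \<in> set sections" for k l
  proof -
    consider "k = l" | "k \<noteq> l" "length (shared k l) = 1" | "k \<noteq> l" "length (shared k l) \<noteq> 1" by blast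
    then show ?thesis
    proof cases
      case 1
      then show ?thesis by (simp add: line_pairing_def)
    next
      case 2
      have "\<exists>x\<in>set (meets l). x \<notin> set (meets k)"
      proof (rule ccontr)
        assume "\<not> ?thesis"
        then have "shared k l = meets l" by (auto simp: shared_altdef filter_id_conv)
        then show False using 2 meets_sections(2)[OF that(2)] by simp
      qed
      then obtain x where x: "x \<in> set (meets l)" "x \<notin> set (meets k)" by blast
      then have "x \<in> set conics" using meets_sections(3)[OF that(2)] by blast
      from C_section[OF this that(1)] C_section[OF this that(2)] x have "\<nu> k \<noteq> \<nu> l" by auto
      then show ?thesis using 2 that section_pairing by (simp add: meet nu_simps)
    next
      case 3
      then have "section_line (label_poly k) \<inter> section_line (label_poly l) = {0}"
        using section_pairing[OF that] by blast
      then show ?thesis using 3 that by (simp add: disj nu_simps)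
    qed
  qed
  have dc: "k \<noteq> 6" "k \<notin> set sections" if "k \<in> set conics" for k using that label_disjoint by auto
  have ds: "k \<noteq> 6" "k \<notin> set conics" if "k \<in> set sections" for k using that label_disjoint by auto
  have self: "line_pairing L L = -1" for L :: "('a ^ 4) set" by (simp add: line_pairing_def)
  have conic_section_ne: "k \<noteq> l" "l \<noteq> k" if "k \<in> set conics" "l \<in> set sections" for k l
    using that label_disjoint(3) by blast+
  consider "m = 6" | "m \<in> set conics" | "m \<in> set sections" using assms(1) label_cases by blast
  then show ?thesis
  proof cases
    case 1
    then show ?thesis using assms(2) L_conic L_section dc ds self
      unfolding label_cases by (auto simp: incidence_def nu_simps(1))
  next
    case m: 2
    from assms(2) consider "n = 6" | "n \<in> set conics" | "n \<in> set sections" unfolding label_cases by blast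
    then show ?thesis
    proof cases
      case 1
      then show ?thesis using m L_conic[OF m] dc[OF m] sym[of "\<nu> m"] by (simp add: incidence_def nu_simps(1))
    next
      case 2
      then show ?thesis using C_C[OF m 2] dc[OF m] dc[OF 2] m by (simp add: incidence_def)
    next
      case 3
      then show ?thesis using C_section[OF m 3] dc[OF m] ds[OF 3] m conic_section_ne[OF m 3] by (simp add: incidence_def)
    qed
  next
    case m: 3
    from assms(2) consider "n = 6" | "n \<in> set conics" | "n \<in> set sections" unfolding label_cases by blast
    then show ?thesis
    proof cases
      case 1
      then show ?thesis using m L_section[OF m] ds[OF m] sym[of "\<nu> m"] by (simp add: incidence_def nu_simps(1))
    next
      case 2
      then show ?thesis using C_section[OF 2 m] dc[OF 2] ds[OF m] sym[of "\<nu> m"] conic_section_ne[OF 2 m] by (simp add: incidence_def)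
    next
      case 3
      then show ?thesis using S_S[OF m 3] ds[OF m] ds[OF 3] by (simp add: incidence_def)
    qed
  qed
qed

text \<open>Only a line paired with itself gives -1, so the pairing implies injectivity.
  Surjectivity is the classification of lines combined with that of the quintics
  \<open>p\<close>.\<close>

lemma nu_bij: "bij_betw \<nu> {1..27} {L. vec.subspace L \<and> vec.dim L = 2 \<and> (\<forall>x\<in>L. cub x = 0)}"
proof (rule bij_betw_imageI)
  show "inj_on \<nu> {1..27}"
  proof (rule inj_onI)
    fix m n :: nat assume mn: "m \<in> {1..27}" "n \<in> {1..27}" and "\<nu> m = \<nu> n"
    then have "incidence m n = -1" using nu_pairing[OF mn] by (simp add: line_pairing_def)
    then show "m = n" by (auto simp: incidence_def split: if_splits)
  qed
next
  have "\<nu> n \<in> {L. vec.subspace L \<and> vec.dim L = 2 \<and> (\<forall>x\<in>L. cub x = 0)}" if "n \<in> {1..27}" for n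
    using that unfolding label_cases
    by (auto simp: nu_simps cub_line0 intro: cub_conic_line cub_section_line section_poly_label_poly)
  moreover have "L \<in> \<nu> ` {1..27}" if L: "vec.subspace L" "vec.dim L = 2" "\<forall>x\<in>L. cub x = 0" for L
  proof -
    have "L = line0 \<or> (\<exists>b\<in>\<beta> ` set conics. L = conic_line d b) \<or> (\<exists>p. section_poly p \<and> L = section_line p)"
      using lines_classification L by blast
    then have "\<exists>n. (n = 6 \<or> n \<in> set conics \<or> n \<in> set sections) \<and> L = \<nu> n"
      using nu_simps section_poly_imp_label_poly by (metis imageE)
    then show ?thesis unfolding label_cases[symmetric] by blast
  qed
  ultimately show "\<nu> ` {1..27} = {L. vec.subspace L \<and> vec.dim L = 2 \<and> (\<forall>x\<in>L. cub x = 0)}" by blast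
qed

end

section \<open>Equivariant labels\<close>

text \<open>Dedekind's argument: choose \<open>w\<close> with
  \<open>\<sigma> w \<noteq> \<rho> w\<close>, apply the relation to \<open>w * z\<close> and
  subtract \<open>\<rho> w\<close> times the relation; the term of \<open>\<rho>\<close>
  disappears.\<close>

lemma embeddings_independent:
  fixes c :: "('l \<Rightarrow> 'l) \<Rightarrow> 'l::field"
  assumes "finite S" "\<forall>\<sigma>\<in>S. field_embedding \<sigma>" "\<And>z. (\<Sum>\<sigma>\<in>S. c \<sigma> * \<sigma> z) = 0" "\<tau> \<in> S"
  shows "c \<tau> = 0"
  using assms
proof (induction S arbitrary: c \<tau> rule: finite_induct)
  case (insert \<rho> S)
  have emb: "field_embedding \<sigma>" if "\<sigma> \<in> insert \<rho> S" for \<sigma> using insert.prems that by blast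
  have S0: "c \<sigma> = 0" if \<sigma>: "\<sigma> \<in> S" for \<sigma>
  proof -
    have "\<sigma> \<noteq> \<rho>" using insert.hyps \<sigma> by blast
    then obtain w where w: "\<sigma> w \<noteq> \<rho> w" by blast
    have "(\<Sum>\<sigma>\<in>S. c \<sigma> * (\<sigma> w - \<rho> w) * \<sigma> z) = 0" for z
    proof -
      have "(\<Sum>\<sigma>\<in>insert \<rho> S. c \<sigma> * (\<sigma> w - \<rho> w) * \<sigma> z)
          = (\<Sum>\<sigma>\<in>insert \<rho> S. c \<sigma> * \<sigma> (w * z) - \<rho> w * (c \<sigma> * \<sigma> z))"
        using emb by (intro sum.cong) (simp_all add: field_embedding_def algebra_simps)
      also have "\<dots> = (\<Sum>\<sigma>\<in>insert \<rho> S. c \<sigma> * \<sigma> (w * z)) - \<rho> w * (\<Sum>\<sigma>\<in>insert \<rho> S. c \<sigma> * \<sigma> z)"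
        by (simp only: sum_subtractf sum_distrib_left)
      also have "\<dots> = 0" by (simp only: insert.prems(2)) simp
      finally show ?thesis using insert.hyps by simp
    qed
    from insert.IH[OF _ this \<sigma>] have "c \<sigma> * (\<sigma> w - \<rho> w) = 0" using insert.prems(1) by blast
    then show ?thesis using w by simp
  qed
  have "c \<rho> * \<rho> 1 = 0" using insert.prems(2)[of 1] insert.hyps S0 by simp
  then have 0: "c \<rho> = 0" using emb[of \<rho>] by (simp add: field_embedding_def)
  show ?case
  proof (cases "\<tau> = \<rho>")
    case True
    then show ?thesis using 0 by simp
  next
    case False
    then have "\<tau> \<in> S" using insert.prems(3) by blast
    then show ?thesis by (rule S0)
  qed
qed simp

text \<open>A vector space over an infinite field is not a finite union of proper subspaces: on the
  family \<open>v + c w\<close> each pair excludes at most one \<open>c\<close>.\<close>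

lemma ex_separating_vector:
  fixes e :: "'k::field \<Rightarrow> 'l::field" and E :: "('i \<Rightarrow> 'l) set"
  assumes e: "field_embedding e" and inf: "infinite (UNIV :: 'k set)"
    and E: "E \<noteq> {}" "\<And>v w c. v \<in> E \<Longrightarrow> w \<in> E \<Longrightarrow> (\<lambda>i. v i + e c * w i) \<in> E"
    and J: "finite J" "\<And>m n. (m, n) \<in> J \<Longrightarrow> \<exists>v\<in>E. v m \<noteq> v n"
  shows "\<exists>v\<in>E. \<forall>(m, n)\<in>J. v m \<noteq> v n"
  using J
proof (induction J rule: finite_induct)
  case empty
  then show ?case using E by auto
next
  case (insert p J)
  interpret field_emb e using e by unfold_locales
  obtain a b where p: "p = (a, b)" by (cases p)
  obtain v where v: "v \<in> E" "\<forall>(m, n)\<in>J. v m \<noteq> v n" using insert by blast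
  obtain w where w: "w \<in> E" "w a \<noteq> w b" using insert.prems p by blast
  define bad where "bad = (\<lambda>(m, n). {c. v m + e c * w m = v n + e c * w n})"
  have "finite (bad q)" if "q \<in> insert p J" for q
  proof -
    obtain m n where q: "q = (m, n)" by (cases q)
    \<comment> \<open>Two bad values force \<open>w m = w n\<close> and \<open>v m = v n\<close>,
      but \<open>v\<close> separates the old pairs and \<open>w\<close> the new one.\<close>
    have "c = c'" if "c \<in> bad q" "c' \<in> bad q" for c c'
    proof (rule ccontr)
      assume "c \<noteq> c'"
      have eqs: "v m + e c * w m = v n + e c * w n" "v m + e c' * w m = v n + e c' * w n"
        using that by (simp_all add: bad_def q)
      have "(e c - e c') * (w m - w n) = (v m + e c * w m) - (v n + e c * w n) - ((v m + e c' * w m) - (v n + e c' * w n))"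
        by (simp add: algebra_simps)
      also have "\<dots> = 0" unfolding eqs by simp
      finally have wmn: "w m = w n" using \<open>c \<noteq> c'\<close> by simp
      then have "v m = v n" using eqs(1) by simp
      with wmn v(2) w(2) \<open>q \<in> insert p J\<close> show False by (auto simp: q p)
    qed
    then have "bad q \<subseteq> {c}" if "c \<in> bad q" for c using that by blast
    then show ?thesis by (metis finite.emptyI finite.insertI finite_subset equals0I)
  qed
  then have "finite (\<Union>q\<in>insert p J. bad q)" using insert.hyps by blast
  then obtain c where c: "c \<notin> (\<Union>q\<in>insert p J. bad q)" using inf by (metis UNIV_eq_I)
  have "\<forall>(m, n)\<in>insert p J. v m + e c * w m \<noteq> v n + e c * w n"
    using c by (fastforce simp: bad_def)
  then show ?case using E(2)[OF v(1) w(1), of c] by (intro bexI[of _ "\<lambda>i. v i + e c * w i"])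
qed

definition line_stabilizer :: "(nat \<Rightarrow> nat) \<Rightarrow> bool" where
  "line_stabilizer g \<longleftrightarrow> g permutes {1..27} \<and> g 6 = 6 \<and>
     (\<forall>m\<in>{1..27}. \<forall>n\<in>{1..27}. incidence (g m) (g n) = incidence m n)"

lemma incidence_6: "incidence n 6 = (if n = 6 then -1 else if n \<in> set conics then 1 else 0)"
  by (auto simp: incidence_def)

lemma line_stabilizer_incidence:
  "line_stabilizer g \<Longrightarrow> m \<in> {1..27} \<Longrightarrow> n \<in> {1..27} \<Longrightarrow> incidence (g m) (g n) = incidence m n"
  unfolding line_stabilizer_def by blast

lemma line_stabilizer_conics:
  assumes g: "line_stabilizer g" and m: "m \<in> set conics"
  shows "g m \<in> set conics" "g (partner m) = partner (g m)"
proof -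
  have perm: "g permutes {1..27}" using g by (simp add: line_stabilizer_def)
  have g6: "g 6 = 6" using g by (simp add: line_stabilizer_def)
  have conics: "g k \<in> set conics" if "k \<in> set conics" for k
  proof -
    have k: "k \<in> {1..27}" "k \<noteq> 6" using that label_cases label_disjoint by blast+
    have "incidence (g k) (g 6) = incidence k 6" using k by (intro line_stabilizer_incidence[OF g]) auto
    then have "incidence (g k) 6 = 1" using g6 k that by (simp add: incidence_6)
    then show ?thesis by (auto simp: incidence_def split: if_splits)
  qed
  show "g m \<in> set conics" using conics m .
  have pm: "partner m \<in> set conics" "partner m \<noteq> m" using partner_conics m by blast+
  have "incidence (g m) (g (partner m)) = incidence m (partner m)"
    using g m pm label_cases unfolding line_stabilizer_def by blast
  also have "\<dots> = 1" using m pm label_disjoint by (auto simp: incidence_def)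
  finally show "g (partner m) = partner (g m)"
    using conics[OF m] conics[OF pm(1)] label_disjoint(1) by (auto simp: incidence_def split: if_splits)
qed

lemma line_stabilizer_sections:
  assumes g: "line_stabilizer g" and n: "n \<in> set sections"
  shows "g n \<in> set sections" "set (meets (g n)) = g ` set (meets n)"
proof -
  have perm: "g permutes {1..27}" using g by (simp add: line_stabilizer_def)
  have n27: "n \<in> {1..27}" "n \<noteq> 6" "n \<notin> set conics" using n label_cases label_disjoint by blast+
  have "incidence (g n) (g 6) = incidence n 6" using n27 by (intro line_stabilizer_incidence[OF g]) auto
  then have "incidence (g n) 6 = 0" using g n27 by (simp add: incidence_6 line_stabilizer_def)
  moreover have "g n \<in> {1..27}" using permutes_in_image[OF perm] n27 by blast
  ultimately show gn: "g n \<in> set sections"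
    unfolding label_cases by (auto simp: incidence_def split: if_splits)
  have "g ` set (meets n) \<subseteq> set (meets (g n))"
  proof
    fix x assume "x \<in> g ` set (meets n)"
    then obtain m where m: "m \<in> set (meets n)" "x = g m" by blast
    then have mc: "m \<in> set conics" using meets_sections(3)[OF n] by blast
    have "incidence (g m) (g n) = incidence m n"
      using g mc n label_cases unfolding line_stabilizer_def by blast
    also have "\<dots> = 1" using m mc n27 label_disjoint by (auto simp: incidence_def)
    finally show "x \<in> set (meets (g n))"
      using m line_stabilizer_conics(1)[OF g mc] gn label_disjoint by (auto simp: incidence_def split: if_splits)
  qed
  moreover have "card (g ` set (meets n)) = 5"
    using meets_sections(1,2)[OF n] permutes_inj_on[OF perm] by (simp add: card_image distinct_card)
  moreover have "card (set (meets (g n))) = 5"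
    using meets_sections(1,2)[OF gn] by (simp add: distinct_card)
  ultimately show "set (meets (g n)) = g ` set (meets n)"
    by (intro card_subset_eq[symmetric]) auto
qed

text \<open>Odd equivariant vectors form a space over \<open>'k\<close>. Sums over \<open>G\<close>
  produce elements, Dedekind's lemma makes them separate any two lines, and a generic combination
  separates all of them at once.\<close>

lemma ex_equivariant_labels:
  fixes \<phi> :: "'k::field \<Rightarrow> 'l::field" and G :: "('l \<Rightarrow> 'l) set" and j :: "('l \<Rightarrow> 'l) \<Rightarrow> nat \<Rightarrow> nat"
  assumes inf: "infinite (UNIV :: 'k set)" and two: "(2::'l) \<noteq> 0" and phi: "field_embedding \<phi>"
    and G: "finite G" "id \<in> G" "\<And>\<sigma> \<tau>. \<sigma> \<in> G \<Longrightarrow> \<tau> \<in> G \<Longrightarrow> \<sigma> \<circ> \<tau> \<in> G"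
    and emb: "\<And>\<sigma>. \<sigma> \<in> G \<Longrightarrow> field_embedding \<sigma>" and base: "\<And>\<sigma> a. \<sigma> \<in> G \<Longrightarrow> \<sigma> (\<phi> a) = \<phi> a"
    and j: "j id = id" "\<And>\<sigma> \<tau>. \<sigma> \<in> G \<Longrightarrow> \<tau> \<in> G \<Longrightarrow> j (\<sigma> \<circ> \<tau>) = j \<sigma> \<circ> j \<tau>"
      "\<And>\<sigma>. \<sigma> \<in> G \<Longrightarrow> line_stabilizer (j \<sigma>)"
  obtains \<beta> where "line_labels \<beta>" "\<And>\<sigma> m. \<sigma> \<in> G \<Longrightarrow> m \<in> set conics \<Longrightarrow> \<beta> (j \<sigma> m) = \<sigma> (\<beta> m)"
proof -
  interpret phi: field_emb \<phi> using phi by unfold_locales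
  define E where "E = {v. \<forall>m\<in>set conics. v (partner m) = - v m \<and> (\<forall>\<sigma>\<in>G. v (j \<sigma> m) = \<sigma> (v m))}"
  have embs: "\<sigma> (x + y) = \<sigma> x + \<sigma> y" "\<sigma> (x * y) = \<sigma> x * \<sigma> y" "\<sigma> 0 = 0" "\<sigma> (x - y) = \<sigma> x - \<sigma> y"
    "\<sigma> (sum f A) = (\<Sum>a\<in>A. \<sigma> (f a))"
    if "\<sigma> \<in> G" for \<sigma> x y and f :: "('l \<Rightarrow> 'l) \<Rightarrow> 'l" and A
  proof -
    interpret field_emb \<sigma> using emb[OF that] by unfold_locales
    show "\<sigma> (x + y) = \<sigma> x + \<sigma> y" "\<sigma> (x * y) = \<sigma> x * \<sigma> y" "\<sigma> 0 = 0" "\<sigma> (x - y) = \<sigma> x - \<sigma> y"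
      "\<sigma> (sum f A) = (\<Sum>a\<in>A. \<sigma> (f a))" by (simp_all add: sum)
  qed
  have E0: "(\<lambda>_. 0) \<in> E" using embs(3) by (simp add: E_def)
  have E_add: "(\<lambda>i. v i + \<phi> c * w i) \<in> E" if "v \<in> E" "w \<in> E" for v w c
    unfolding E_def
  proof (intro CollectI ballI conjI)
    fix m assume m: "m \<in> set conics"
    show "v (partner m) + \<phi> c * w (partner m) = - (v m + \<phi> c * w m)"
      using that m by (simp add: E_def)
    fix \<sigma> assume \<sigma>: "\<sigma> \<in> G"
    show "v (j \<sigma> m) + \<phi> c * w (j \<sigma> m) = \<sigma> (v m + \<phi> c * w m)"
      using that m \<sigma> unfolding embs(1,2)[OF \<sigma>] base[OF \<sigma>] by (simp add: E_def)
  qed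
  have sep: "\<exists>v\<in>E. v m \<noteq> v n" if mn: "m \<in> set conics" "n \<in> set conics" "m \<noteq> n" for m n
  proof -
    \<comment> \<open>\<open>h z\<close> collects the translates of \<open>z\<close> placed at
      \<open>m\<close>, with \<open>G\<close> acting on numbers and values together;
      \<open>v z\<close> is its antisymmetrization under \<open>partner\<close>.\<close>
    define h where "h = (\<lambda>z x. \<Sum>\<sigma>\<in>G. if j \<sigma> m = x then \<sigma> z else 0)"
    define v where "v = (\<lambda>z x. h z x - h z (partner x))"
    have perm: "inj (j \<sigma>)" if "\<sigma> \<in> G" for \<sigma>
      using j(3)[OF that] permutes_inj unfolding line_stabilizer_def by blast
    have h: "h z (j \<tau> x) = \<tau> (h z x)" if \<tau>: "\<tau> \<in> G" for \<tau> z x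
    proof -
      have "inj_on (\<lambda>\<rho>. \<tau> \<circ> \<rho>) G"
      proof (rule inj_onI)
        interpret field_emb \<tau> using emb[OF \<tau>] by unfold_locales
        fix \<rho> \<rho>' assume "\<tau> \<circ> \<rho> = \<tau> \<circ> \<rho>'"
        then show "\<rho> = \<rho>'" by (simp add: fun_eq_iff)
      qed
      moreover have "(\<lambda>\<rho>. \<tau> \<circ> \<rho>) ` G \<subseteq> G" using G(3) \<tau> by blast
      ultimately have bij: "bij_betw (\<lambda>\<rho>. \<tau> \<circ> \<rho>) G G"
        using G(1) by (simp add: bij_betw_def card_subset_eq card_image)
      have "h z (j \<tau> x) = (\<Sum>\<rho>\<in>G. if j (\<tau> \<circ> \<rho>) m = j \<tau> x then (\<tau> \<circ> \<rho>) z else 0)"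
        unfolding h_def by (rule sum.reindex_bij_betw[OF bij, symmetric])
      also have "\<dots> = (\<Sum>\<rho>\<in>G. \<tau> (if j \<rho> m = x then \<rho> z else 0))"
        using j(2)[OF \<tau>] embs(3)[OF \<tau>] perm[OF \<tau>] by (intro sum.cong) (auto simp: inj_eq)
      also have "\<dots> = \<tau> (h z x)" unfolding h_def embs(5)[OF \<tau>] ..
      finally show ?thesis .
    qed
    have vE: "v z \<in> E" for z unfolding E_def
    proof (intro CollectI ballI conjI)
      fix x assume x: "x \<in> set conics"
      show "v z (partner x) = - v z x" using partner_conics(2)[OF x] by (simp add: v_def)
      fix \<sigma> assume \<sigma>: "\<sigma> \<in> G"
      show "v z (j \<sigma> x) = \<sigma> (v z x)"
        unfolding v_def line_stabilizer_conics(2)[OF j(3)[OF \<sigma>] x, symmetric] h[OF \<sigma>] embs(4)[OF \<sigma>] ..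
    qed
    \<comment> \<open>The coefficients of \<open>v z m - v z n\<close> as a combination of
      automorphisms applied to \<open>z\<close>. The one at \<open>id\<close> is 1, or 2 if
      \<open>n\<close> is the partner of \<open>m\<close>.\<close>
    define c :: "('l \<Rightarrow> 'l) \<Rightarrow> 'l" where
      "c = (\<lambda>\<sigma>. of_bool (j \<sigma> m = m) - of_bool (j \<sigma> m = partner m)
         - (of_bool (j \<sigma> m = n) - of_bool (j \<sigma> m = partner n)))"
    have "v z m - v z n = (\<Sum>\<sigma>\<in>G. c \<sigma> * \<sigma> z)" for z
      unfolding v_def h_def sum_subtractf[symmetric] by (intro sum.cong) (auto simp: c_def algebra_simps)
    moreover have "c id \<noteq> 0"
      using two mn partner_conics(3)[OF mn(1)] by (auto simp: c_def j(1))
    then have "\<exists>z. (\<Sum>\<sigma>\<in>G. c \<sigma> * \<sigma> z) \<noteq> 0"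
      using embeddings_independent[of G c id] G emb by blast
    ultimately have "\<exists>z. v z m \<noteq> v z n" by (metis right_minus_eq)
    then show ?thesis using vE by blast
  qed
  have "\<exists>v\<in>E. \<forall>(m, n)\<in>{(m, n). m \<in> set conics \<and> n \<in> set conics \<and> m \<noteq> n}. v m \<noteq> v n"
  proof (rule ex_separating_vector[OF phi inf _ E_add])
    show "finite {(m, n). m \<in> set conics \<and> n \<in> set conics \<and> m \<noteq> n}"
      by (rule finite_subset[of _ "set conics \<times> set conics"]) auto
  qed (use E0 sep in auto)
  then obtain v where v: "v \<in> E" "inj_on v (set conics)" by (auto simp: inj_on_def)
  show ?thesis
  proof (rule that)
    show "line_labels v" using v two by unfold_locales (auto simp: E_def)
  qed (use v in \<open>auto simp: E_def\<close>)
qed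

section \<open>Change of field\<close>

lemma (in field_emb) map_coords_scale: "map_coords e (c *s v) = e c *s map_coords e v"
  by (simp add: map_coords_def vec_eq_iff)

lemma (in field_emb) map_coords_add: "map_coords e (v + w) = map_coords e v + map_coords e w"
  by (simp add: map_coords_def vec_eq_iff)

lemma (in field_emb) map_coords_eq_iff: "map_coords e v = map_coords e w \<longleftrightarrow> v = w"
  by (simp add: map_coords_def vec_eq_iff)

lemma (in field_emb) map_coords_graph_line:
  "map_coords e v \<in> graph_line i j (map_coords e u) (map_coords e w) \<longleftrightarrow> v \<in> graph_line i j u w"
proof -
  have "map_coords e v $ i *s map_coords e u + map_coords e v $ j *s map_coords e w = map_coords e (v $ i *s u + v $ j *s w)"
    by (simp add: map_coords_scale map_coords_add) (simp add: map_coords_def)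
  then show ?thesis by (simp add: graph_line_def map_coords_eq_iff)
qed

lemma (in field_emb) normalized_map_coords: "normalized i j u w \<Longrightarrow> normalized i j (map_coords e u) (map_coords e w)"
  by (simp add: normalized_def map_coords_def)

lemma (in field_emb) line_defined_over_graph_line:
  assumes "normalized i j u w"
  shows "line_defined_over e (graph_line i j (map_coords e u) (map_coords e w))"
  unfolding line_defined_over_def graph_line_eq_span[OF normalized_map_coords[OF assms]]
  by (rule exI[of _ "{u, w}"]) simp

text \<open>The rational points form the graph line over the small field, so conjugating them
  amounts to embedding the basis by \<open>e \<circ> \<sigma>\<close> instead of
  \<open>e\<close>.\<close>

lemma (in field_emb) conj_line_graph_line:
  assumes n: "normalized i j u w" and \<sigma>: "field_embedding \<sigma>"
  shows "conj_line e \<sigma> (graph_line i j (map_coords e u) (map_coords e w)) =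
    graph_line i j (map_coords (\<lambda>x. e (\<sigma> x)) u) (map_coords (\<lambda>x. e (\<sigma> x)) w)"
proof -
  interpret \<sigma>: field_emb \<sigma> using \<sigma> by unfold_locales
  interpret e\<sigma>: field_emb "\<lambda>x. e (\<sigma> x)" using field_embedding_comp[OF \<sigma> emb] by unfold_locales
  have comp: "map_coords e (map_coords \<sigma> v) = map_coords (\<lambda>x. e (\<sigma> x)) v" for v :: "'a ^ 4"
    by (simp add: map_coords_def vec_eq_iff)
  have "vec.span {map_coords (\<lambda>x. e (\<sigma> x)) v | v. v \<in> graph_line i j u w}
      = vec.span {map_coords (\<lambda>x. e (\<sigma> x)) u, map_coords (\<lambda>x. e (\<sigma> x)) w}"
  proof (rule vec.span_eq[THEN iffD2], rule conjI)
    show "{map_coords (\<lambda>x. e (\<sigma> x)) v | v. v \<in> graph_line i j u w}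
        \<subseteq> vec.span {map_coords (\<lambda>x. e (\<sigma> x)) u, map_coords (\<lambda>x. e (\<sigma> x)) w}"
      unfolding graph_line_eq_span[OF e\<sigma>.normalized_map_coords[OF n], symmetric]
      using e\<sigma>.map_coords_graph_line by blast
    show "{map_coords (\<lambda>x. e (\<sigma> x)) u, map_coords (\<lambda>x. e (\<sigma> x)) w}
        \<subseteq> vec.span {map_coords (\<lambda>x. e (\<sigma> x)) v | v. v \<in> graph_line i j u w}"
      using graph_line_mem[OF n] by (auto intro!: vec.span_base)
  qed
  then show ?thesis
    unfolding conj_line_def map_coords_graph_line comp
      graph_line_eq_span[OF e\<sigma>.normalized_map_coords[OF n]] .
qed

context line_labels
begin

lemma labels_map:
  assumes "field_embedding (e :: 'a \<Rightarrow> 'b::field)"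
  shows "line_labels (\<lambda>n. e (\<beta> n))"
proof -
  interpret field_emb e using assms by unfold_locales
  show ?thesis
    using two two_nonzero odd inj by unfold_locales (auto simp: inj_on_def)
qed

lemma map_label_poly:
  assumes "field_embedding (e :: 'a \<Rightarrow> 'b::field)"
  shows "line_labels.label_poly (\<lambda>n. e (\<beta> n)) n = map_poly e (label_poly n)"
    "line_labels.d (\<lambda>n. e (\<beta> n)) = e d"
    "line_labels.f1 (\<lambda>n. e (\<beta> n)) = e f1" "line_labels.f2 (\<lambda>n. e (\<beta> n)) = e f2"
    "line_labels.f3 (\<lambda>n. e (\<beta> n)) = e f3" "line_labels.f4 (\<lambda>n. e (\<beta> n)) = e f4"
proof -
  interpret field_emb e using assms by unfold_locales
  interpret e: line_labels "\<lambda>n. e (\<beta> n)" by (rule labels_map[OF assms])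
  show lp: "e.label_poly n = map_poly e (label_poly n)" for n
    by (simp add: e.label_poly_def label_poly_def map_poly_prod)
  have ap: "e.all_poly = map_poly e all_poly"
    by (simp add: e.all_poly_def all_poly_def map_poly_prod)
  show "e.d = e d" "e.f1 = e f1" "e.f2 = e f2" "e.f3 = e f3" "e.f4 = e f4"
    by (simp_all add: e.d_def e.f1_def e.f2_def e.f3_def e.f4_def d_def f1_def f2_def f3_def f4_def lp ap)
qed

text \<open>The basis is chosen before \<open>e\<close>: the same \<open>u\<close> and
  \<open>w\<close> describe the line under every embedding, in particular under \<open>to_ac\<close>
  and its composite with a Galois element.\<close>

lemma nu_graph_line:
  assumes "n \<in> {1..27}"
  obtains i j u w where "normalized i j u w"
    "\<And>e :: 'a \<Rightarrow> 'b::field. field_embedding e \<Longrightarrow>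
       line_labels.\<nu> (\<lambda>n. e (\<beta> n)) n = graph_line i j (map_coords e u) (map_coords e w)"
proof -
  have map_vec4: "map_coords e (vec4 a b c d) = vec4 (e a) (e b) (e c) (e d)" for e :: "'a \<Rightarrow> 'b" and a b c d
    by (simp add: vec4_eq_iff map_coords_def)
  consider "n = 6" | "n \<in> set conics" | "n \<in> set sections" using assms label_cases by blast
  then show ?thesis
  proof cases
    case 1
    show ?thesis
    proof (rule that[OF normalized_lines(1)])
      fix e :: "'a \<Rightarrow> 'b" assume e: "field_embedding e"
      interpret field_emb e using e by unfold_locales
      interpret e: line_labels "\<lambda>n. e (\<beta> n)" by (rule labels_map[OF e])
      show "e.\<nu> n = graph_line 1 2 (map_coords e (vec4 1 0 0 0)) (map_coords e (vec4 0 1 0 0))"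
        by (simp only: 1 e.nu_simps(1) map_vec4) (simp add: line0_def)
    qed
  next
    case 2
    show ?thesis
    proof (rule that[OF normalized_lines(2)[of "\<beta> n" "d / \<beta> n + \<beta> n ^ 4" "(\<beta> n)\<^sup>2"]])
      fix e :: "'a \<Rightarrow> 'b" assume e: "field_embedding e"
      interpret field_emb e using e by unfold_locales
      interpret e: line_labels "\<lambda>n. e (\<beta> n)" by (rule labels_map[OF e])
      show "e.\<nu> n = graph_line 1 3 (map_coords e (vec4 1 (\<beta> n) 0 0)) (map_coords e (vec4 0 (d / \<beta> n + \<beta> n ^ 4) 1 ((\<beta> n)\<^sup>2)))"
        by (simp only: e.nu_simps(2)[OF 2] map_vec4 map_label_poly[OF e]) (simp add: conic_line_def)
    qed
  next
    case 3
    let ?p = "label_poly n"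
    show ?thesis
    proof (rule that[OF normalized_lines(3)[of "poly.coeff ?p 2" "- poly.coeff ?p 1" "poly.coeff ?p 4" "- poly.coeff ?p 3"]])
      fix e :: "'a \<Rightarrow> 'b" assume e: "field_embedding e"
      interpret field_emb e using e by unfold_locales
      interpret e: line_labels "\<lambda>n. e (\<beta> n)" by (rule labels_map[OF e])
      show "e.\<nu> n = graph_line 3 4 (map_coords e (vec4 (poly.coeff ?p 2) (- poly.coeff ?p 1) 1 0))
          (map_coords e (vec4 (poly.coeff ?p 4) (- poly.coeff ?p 3) 0 1))"
        by (simp only: e.nu_simps(3)[OF 3] map_vec4 map_label_poly[OF e]) (simp add: section_line_def)
    qed
  qed
qed

text \<open>The coefficients are invariants of the stabilizer, so relabelling keeps the surface and
  renumbers its lines. For \<open>\<gamma> = \<sigma> \<circ> \<beta>\<close> this converts the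
  Galois action on labels into one on lines.\<close>

lemma labels_permute:
  assumes "line_labels \<gamma>" and g: "line_stabilizer g"
    and eq: "\<And>m. m \<in> set conics \<Longrightarrow> \<gamma> m = \<beta> (g m)"
  shows "line_labels.d \<gamma> = d" "line_labels.f1 \<gamma> = f1" "line_labels.f2 \<gamma> = f2"
    "line_labels.f3 \<gamma> = f3" "line_labels.f4 \<gamma> = f4"
    "n \<in> {1..27} \<Longrightarrow> line_labels.\<nu> \<gamma> n = \<nu> (g n)"
proof -
  interpret c: line_labels \<gamma> by fact
  have perm: "g permutes {1..27}" and g6: "g 6 = 6" using g by (simp_all add: line_stabilizer_def)
  have inj_g: "inj_on g A" for A using permutes_inj_on[OF perm] .
  have lp: "c.label_poly n = label_poly (g n)" if n: "n \<in> set sections" for n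
    unfolding c.label_poly_def label_poly_def line_stabilizer_sections(2)[OF g n] prod.reindex[OF inj_g]
    using eq meets_sections(3)[OF n] by (intro prod.cong) auto
  have "g ` set conics = set conics"
    using line_stabilizer_conics(1)[OF g] inj_g by (intro card_subset_eq) (auto simp: card_image)
  then have "all_poly = (\<Prod>m\<in>g ` set conics. [:- \<beta> m, 1:])" by (simp add: all_poly_def)
  also have "\<dots> = c.all_poly"
    unfolding prod.reindex[OF inj_g] c.all_poly_def using eq by (intro prod.cong) auto
  finally have ap: "all_poly = c.all_poly" .
  show d: "c.d = d"
    unfolding c.d_def lp[OF label_12] by (rule const_label_poly[OF line_stabilizer_sections(1)[OF g label_12]])
  show "c.f1 = f1" "c.f2 = f2" "c.f3 = f3" "c.f4 = f4"
    by (simp_all add: c.f1_def c.f2_def c.f3_def c.f4_def f1_def f2_def f3_def f4_def ap)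
  show "c.\<nu> n = \<nu> (g n)" if "n \<in> {1..27}"
  proof -
    consider "n = 6" | "n \<in> set conics" | "n \<in> set sections" using \<open>n \<in> {1..27}\<close> label_cases by blast
    then show ?thesis
    proof cases
      case 1
      then show ?thesis using g6 by (simp add: nu_simps c.nu_simps)
    next
      case 2
      then show ?thesis using line_stabilizer_conics(1)[OF g 2] by (simp add: nu_simps c.nu_simps d eq)
    next
      case 3
      then show ?thesis using line_stabilizer_sections(1)[OF g 3] by (simp add: nu_simps c.nu_simps lp)
    qed
  qed
qed

end

lemma line_stabilizer_G_max: "g \<in> G_max \<Longrightarrow> g 6 = 6 \<Longrightarrow> line_stabilizer g"
  unfolding line_stabilizer_def G_max_def pairing_group_def
proof (intro conjI ballI; elim CollectE conjE)
  fix m n :: nat assume p: "g permutes {1..27}" and mn: "m \<in> {1..27}" "n \<in> {1..27}"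
    and r: "\<forall>m\<in>{1..27}. \<forall>n\<in>{1..27}. reference_pairing (g m) (g n) = reference_pairing m n"
  have "g m \<in> {1..27}" "g n \<in> {1..27}" using permutes_in_image[OF p] mn by blast+
  then show "incidence (g m) (g n) = incidence m n"
    using r mn by (simp only: reference_pairing_eq_incidence[symmetric])
qed

theorem theorem7p1:
  fixes \<phi> :: "'k::field \<Rightarrow> 'l::field"
    and i :: "('l \<Rightarrow> 'l) \<Rightarrow> (nat \<Rightarrow> nat)"
    and a :: nat
  assumes "infinite (UNIV :: 'k set)"
    and "CHAR('k) \<noteq> 2"
    and "field_embedding \<phi>"
    and "normal_extension \<phi>"
    and "separable_extension \<phi>"
    and "a \<in> {1..27}"
    and "i \<in> hom (galois_group \<phi>) (sym_group 27 \<lparr>carrier := U_line a\<rparr>)"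
    and "inj_on i (carrier (galois_group \<phi>))"
  shows "\<exists>F :: (4, 'k) mpoly. nonsingular_cubic_surface F \<and>
     (\<exists>\<nu>. line_numbering (\<lambda>c. to_ac (\<phi> c) :: 'l alg_closure) F \<nu> \<and>
          (\<forall>n\<in>{1..27}. line_defined_over to_ac (\<nu> n)) \<and>
          (\<forall>\<sigma>\<in>carrier (galois_group \<phi>). \<forall>n\<in>{1..27}. conj_line to_ac \<sigma> (\<nu> n) = \<nu> (i \<sigma> n))) \<and>
     unirational_surface F"
proof -
  define G where "G = carrier (galois_group \<phi>)"
  interpret phi: field_emb \<phi> using assms(3) by unfold_locales
  interpret ac: field_emb "to_ac :: 'l \<Rightarrow> 'l alg_closure" by unfold_locales (rule field_embedding_to_ac)
  have emb: "field_embedding \<sigma>" and base: "\<sigma> (\<phi> x) = \<phi> x" if "\<sigma> \<in> G" for \<sigma> x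
    using that by (simp_all add: G_def galois_group_def)
  have G_id: "id \<in> G" by (simp add: G_def galois_group_def field_embedding_def)
  have G_comp: "\<sigma> \<circ> \<tau> \<in> G" if "\<sigma> \<in> G" "\<tau> \<in> G" for \<sigma> \<tau>
    using that by (auto simp: G_def galois_group_def field_embedding_def intro: bij_comp)
  have two_k: "(2 :: 'k) \<noteq> 0"
  proof
    assume "(2 :: 'k) = 0"
    then have "CHAR('k) dvd 2" using of_nat_eq_0_iff_char_dvd[of 2, where 'a = 'k] by simp
    then have "CHAR('k) = 1" using assms(2) by (metis dvd_antisym nat_dvd_1_iff_1 prime_nat_iff two_is_prime_nat)
    then show False by simp
  qed
  then have two: "(2 :: 'l) \<noteq> 0" by (rule phi.two_nonzero)

  have i_U: "i \<sigma> \<in> U_line a" if "\<sigma> \<in> G" for \<sigma>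
    using assms(7) that by (auto simp: hom_def G_def)
  have i_comp: "i (\<sigma> \<circ> \<tau>) = i \<sigma> \<circ> i \<tau>" if "\<sigma> \<in> G" "\<tau> \<in> G" for \<sigma> \<tau>
    using assms(7) that by (auto simp: hom_def G_def galois_group_def sym_group_def)
  have i_perm: "i \<sigma> permutes {1..27}" if "\<sigma> \<in> G" for \<sigma>
    using i_U[OF that] by (simp add: U_line_def G_max_def pairing_group_def)
  have i_id: "i id = id"
  proof -
    have "i id \<circ> i id = i id" using i_comp[OF G_id G_id] by simp
    then show ?thesis using permutes_inj[OF i_perm[OF G_id]] by (auto simp: fun_eq_iff inj_eq)
  qed
  \<comment> \<open>The sums over the group in the construction of the labels need finiteness, which
    injectivity of \<open>i\<close> provides.\<close>
  have finG: "finite G"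
  proof -
    have "i ` G \<subseteq> {p. p permutes {1..27}}" using i_perm by blast
    then have "finite (i ` G)" using finite_permutations[of "{1..27::nat}"] finite_subset by blast
    then show ?thesis using assms(8) unfolding G_def by (rule finite_imageD)
  qed

  obtain g where g: "g \<in> G_max" "g 6 = a" using G_max_transitive[OF assms(6)] .
  define h where "h = inv_into UNIV g"
  have gperm: "g permutes {1..27}" using g by (simp add: G_max_def pairing_group_def)
  have h: "h \<in> G_max" unfolding h_def by (rule G_max_inv[OF g(1)])
  have hperm: "h permutes {1..27}" using h by (simp add: G_max_def pairing_group_def)
  have gh: "g (h x) = x" and hg: "h (g x) = x" for x
    unfolding h_def using permutes_inverses[OF gperm] by simp_all
  \<comment> \<open>Conjugation by \<open>g\<close> moves the fixed line from \<open>a\<close> to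
    6.\<close>
  define j where "j = (\<lambda>\<sigma>. h \<circ> i \<sigma> \<circ> g)"
  have j_id: "j id = id" by (simp add: j_def i_id fun_eq_iff hg)
  have j_comp: "j (\<sigma> \<circ> \<tau>) = j \<sigma> \<circ> j \<tau>" if "\<sigma> \<in> G" "\<tau> \<in> G" for \<sigma> \<tau>
    by (simp add: j_def i_comp[OF that] fun_eq_iff gh)
  have j_stab: "line_stabilizer (j \<sigma>)" if "\<sigma> \<in> G" for \<sigma>
  proof (rule line_stabilizer_G_max)
    have "i \<sigma> \<in> G_max" "i \<sigma> a = a" using i_U[OF that] by (simp_all add: U_line_def)
    then show "j \<sigma> \<in> G_max" "j \<sigma> 6 = 6"
      unfolding j_def using g h hg[of 6] by (auto intro!: G_max_comp)
  qed

  obtain \<beta> where labels: "line_labels \<beta>" and equiv: "\<And>\<sigma> m. \<sigma> \<in> G \<Longrightarrow> m \<in> set conics \<Longrightarrow> \<beta> (j \<sigma> m) = \<sigma> (\<beta> m)"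
    by (rule ex_equivariant_labels[of \<phi> G j, OF assms(1) two assms(3) finG G_id])
      ((rule G_comp; assumption), (rule emb; assumption), (rule base; assumption), rule j_id,
        (rule j_comp; assumption), (rule j_stab; assumption), blast)
  interpret line_labels \<beta> by (rule labels)
  have fixed: "x \<in> range \<phi>" if "\<And>\<sigma>. \<sigma> \<in> G \<Longrightarrow> \<sigma> x = x" for x
    by (rule galois_fixed_field[OF assms(3,4,5)]) (use that in \<open>simp add: G_def\<close>)
  \<comment> \<open>\<open>\<sigma> \<circ> \<beta>\<close> is both the image of the labels under
    the embedding \<open>\<sigma>\<close> and their relabelling by \<open>j \<sigma>\<close>;
    comparing the two shows the coefficients to be fixed.\<close>
  have inv: "\<sigma> d = d" "\<sigma> f1 = f1" "\<sigma> f2 = f2" "\<sigma> f3 = f3" "\<sigma> f4 = f4" if "\<sigma> \<in> G" for \<sigma>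
    using labels_permute[OF labels_map[OF emb[OF that]] j_stab[OF that]] equiv[OF that]
      map_label_poly[OF emb[OF that]] by simp_all
  obtain d' f1' f2' f3' f4' where descend: "d = \<phi> d'" "f1 = \<phi> f1'" "f2 = \<phi> f2'" "f3 = \<phi> f3'" "f4 = \<phi> f4'"
  proof -
    have "d \<in> range \<phi>" "f1 \<in> range \<phi>" "f2 \<in> range \<phi>" "f3 \<in> range \<phi>" "f4 \<in> range \<phi>"
      by (rule fixed, erule inv)+
    then show ?thesis using that by blast
  qed
  define F where "F = cubic_poly d' f1' f2' f3' f4'"

  have alg: "algebraic_extension \<phi>" using assms(4) by (simp add: normal_extension_def)
  \<comment> \<open>\<open>\<iota> \<circ> \<beta>\<close> labels the same form \<open>F\<close>
    over the closure of the base field.\<close>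
  obtain \<iota> :: "'l \<Rightarrow> 'k alg_closure" where \<iota>: "field_embedding \<iota>" "\<And>c. \<iota> (\<phi> c) = to_ac c"
    using embed_into_alg_closed[OF assms(3) alg field_embedding_to_ac] by metis
  interpret k: line_labels "\<lambda>n. \<iota> (\<beta> n)" by (rule labels_map[OF \<iota>(1)])
  have data: "cubic_data (to_ac d') (to_ac f1') (to_ac f2') (to_ac f3') (to_ac f4') ((\<lambda>n. \<iota> (\<beta> n)) ` set conics)"
    using k.cubic_data_axioms unfolding map_label_poly[OF \<iota>(1)] descend \<iota>(2) .
  have nonsing: "nonsingular_cubic_surface F" and unirat: "unirational_surface F"
    unfolding F_def using nonsingular_cubic_poly[OF data] unirational_cubic_poly[OF assms(1) data] by blast+

  interpret l: line_labels "\<lambda>n. to_ac (\<beta> n) :: 'l alg_closure" by (rule labels_map[OF field_embedding_to_ac])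
  interpret phi_ac: field_emb "\<lambda>c. to_ac (\<phi> c) :: 'l alg_closure"
    by unfold_locales (rule field_embedding_comp[OF assms(3) field_embedding_to_ac])
  \<comment> \<open>Composing with \<open>h\<close> undoes the conjugation, since
    \<open>j \<sigma> \<circ> h = h \<circ> i \<sigma>\<close>.\<close>
  define N where "N = (\<lambda>n. l.\<nu> (h n))"
  have h_range: "h n \<in> {1..27}" if "n \<in> {1..27}" for n using permutes_in_image[OF hperm] that by blast
  have lines: "lines_on (\<lambda>c. to_ac (\<phi> c)) F = {L. vec.subspace L \<and> vec.dim L = 2 \<and> (\<forall>x\<in>L. l.cub x = 0)}"
  proof -
    have "l.cub x = mp_eval (\<lambda>c. to_ac (\<phi> c)) F (($) x)" for x
      unfolding F_def phi_ac.mp_eval_cubic_poly map_label_poly[OF field_embedding_to_ac] descend ..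
    moreover have "l.cub 0 = 0" by (simp add: cubic_def)
    ultimately show ?thesis unfolding lines_on_def surface_points_def by (intro Collect_cong) auto
  qed
  have pair: "line_pairing (N m) (N n) = reference_pairing m n" if mn: "m \<in> {1..27}" "n \<in> {1..27}" for m n
  proof -
    have "line_pairing (N m) (N n) = reference_pairing (h m) (h n)"
      unfolding N_def using l.nu_pairing h_range mn by (simp only: reference_pairing_eq_incidence)
    also have "\<dots> = reference_pairing m n" using h mn unfolding G_max_def pairing_group_def by blast
    finally show ?thesis .
  qed
  have "line_numbering (\<lambda>c. to_ac (\<phi> c)) F N"
    unfolding line_numbering_def
  proof
    show "bij_betw N {1..27} (lines_on (\<lambda>c. to_ac (\<phi> c)) F)"
      unfolding lines N_def using bij_betw_trans[OF permutes_imp_bij[OF hperm] l.nu_bij] by (simp add: comp_def)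
    have "(\<forall>m\<in>{1..27}. \<forall>n\<in>{1..27}. line_pairing (N (q m)) (N (q n)) = line_pairing (N m) (N n)) \<longleftrightarrow>
        (\<forall>m\<in>{1..27}. \<forall>n\<in>{1..27}. reference_pairing (q m) (q n) = reference_pairing m n)"
      if q: "q permutes {1..27}" for q
    proof -
      have qr: "q m \<in> {1..27}" if "m \<in> {1..27}" for m using permutes_in_image[OF q] that by blast
      show ?thesis by (intro ball_cong refl) (simp only: pair qr)
    qed
    then show "pairing_group (\<lambda>m n. line_pairing (N m) (N n)) = G_max"
      unfolding G_max_def pairing_group_def by (intro Collect_cong conj_cong refl)
  qed
  moreover have "line_defined_over to_ac (N n)" if n: "n \<in> {1..27}" for n
  proof -
    obtain p q u w where norm: "normalized p q u w"
      and graph: "\<And>e :: 'l \<Rightarrow> 'l alg_closure. field_embedding e \<Longrightarrow>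
        line_labels.\<nu> (\<lambda>n. e (\<beta> n)) (h n) = graph_line p q (map_coords e u) (map_coords e w)"
      by (rule nu_graph_line[where 'b = "'l alg_closure", OF h_range[OF n]]) blast
    show ?thesis unfolding N_def graph[OF field_embedding_to_ac] by (rule ac.line_defined_over_graph_line[OF norm])
  qed
  moreover have "conj_line to_ac \<sigma> (N n) = N (i \<sigma> n)" if \<sigma>: "\<sigma> \<in> G" and n: "n \<in> {1..27}" for \<sigma> n
  proof -
    have e\<sigma>: "field_embedding (\<lambda>x. to_ac (\<sigma> x) :: 'l alg_closure)"
      by (rule field_embedding_comp[OF emb[OF \<sigma>] field_embedding_to_ac])
    obtain p q u w where norm: "normalized p q u w"
      and graph: "\<And>e :: 'l \<Rightarrow> 'l alg_closure. field_embedding e \<Longrightarrow>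
        line_labels.\<nu> (\<lambda>n. e (\<beta> n)) (h n) = graph_line p q (map_coords e u) (map_coords e w)"
      by (rule nu_graph_line[where 'b = "'l alg_closure", OF h_range[OF n]]) blast
    have "conj_line to_ac \<sigma> (N n) = line_labels.\<nu> (\<lambda>n. to_ac (\<sigma> (\<beta> n))) (h n)"
      unfolding N_def graph[OF field_embedding_to_ac] ac.conj_line_graph_line[OF norm emb[OF \<sigma>]]
      by (rule graph[OF e\<sigma>, symmetric])
    also have "\<dots> = l.\<nu> (j \<sigma> (h n))"
      by (rule l.labels_permute(6)[OF labels_map[OF e\<sigma>] j_stab[OF \<sigma>] _ h_range[OF n]]) (simp add: equiv[OF \<sigma>])
    also have "\<dots> = N (i \<sigma> n)" by (simp add: N_def j_def gh)
    finally show ?thesis .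
  qed
  ultimately show ?thesis using nonsing unirat unfolding G_def by blast
qed

end
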